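(* Let $F$ be a complete null wave front in $\mathbb R^3_1$ which has no self-intersections outside of a compact subset of $\mathbb R^3_1$. Then $F$ has at least four non-cuspidal edge singular points, i.e. at least four singular points which are not cuspidal edge singular points.
   Context: $F:M^2\to\mathbb R^3_1$ is $C^r$ with $r=\infty$ or $r=\omega$ (real analytic), $M^2$ a $C^r$ 2-manifold. $\mathbb R^3_1$ is $\mathbb R^3$ with coordinates $(t,x,y)$ and Lorentzian inner product $\langle v,w\rangle=-v_0w_0+v_1w_1+v_2w_2$; $|\cdot|_E$ is the standard Euclidean norm. A non-zero vector $v$ is light-like if $\langle v,v\rangle=0$, and points in the future direction if $v_0>0$. A $C^r$-map $F:M^2\to\mathbb R^3$ is a (co-orientable) $C^r$-wave front if there is a $C^r$-map $\tilde\alpha:M^2\to(\mathbb R^3)^*\setminus\{0\}$ with $\tilde\alpha_p(dF_p(v))=0$ for all $p$ and $v\in T_pM^2$ such that $(F,\pi\circ\tilde\alpha):M^2\to\mathbb R^3\times P^*(\mathbb R^3)$ is an immersion, $\pi$ being the projection onto the projective space of $(\mathbb R^3)^*$. It is null if the vector field $\hat\xi$ along $F$ given by $\langle\hat\xi_p,x\rangle=\tilde\alpha_p(x)$ is light-like at every $p$. $\hat\xi_E$ is the rescaling of $\hat\xi$ pointing in the future direction with $|\hat\xi_E|_E=\sqrt2$. The $E$-normalized null vector field $\xi_E$ is the unique $C^r$ vector field on $M^2$ with $dF(\xi_E)=\hat\xi_E$ whose integral curves are mapped by $F$ into light-like lines (it exists for every null wave front). $F$ is $L$-complete if through each $p\in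 M^2$ there is an integral curve $\gamma:\mathbb R\to M^2$ of $\xi_E$ such that $F\circ\gamma(\mathbb R)$ is an entire light-like line. A singular point of $F$ is a point where $F$ is not an immersion; $F$ is complete if it is $L$-complete and its singular set is a non-empty compact subset of $M^2$. "No self-intersections outside of a compact subset $K\subset\mathbb R^3_1$" means that $F$ is injective on $F^{-1}(\mathbb R^3_1\setminus K)$. A singular point $p$ of $F$ is a cuspidal edge if the germ of $F$ at $p$ is equivalent, up to local diffeomorphisms of source and target, to the germ of $(u,v)\mapsto(u^2,u^3,v)$ at the origin. *)

theory Defs
  imports "HOL-Analysis.Analysis"
begin

section \<open>Maps of class $C^\infty$ and $C^\omega$\<close>

datatype regularity = Smooth | Analytic

text \<open>In finite dimension \<open>f\<close> is of class $C^{n+1}$ on an open set iff it is differentiable there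
  and all its directional derivatives are of class $C^n$. Only used for open sets.\<close>

fun Ck_on :: "nat \<Rightarrow> ('a::real_normed_vector \<Rightarrow> 'b::real_normed_vector) \<Rightarrow> 'a set \<Rightarrow> bool" where
  "Ck_on 0 f S \<longleftrightarrow> continuous_on S f"
| "Ck_on (Suc n) f S \<longleftrightarrow>
     (\<forall>x\<in>S. f differentiable (at x)) \<and> (\<forall>v. Ck_on n (\<lambda>x. frechet_derivative f (at x) v) S)"

definition smooth_on :: "('a::real_normed_vector \<Rightarrow> 'b::real_normed_vector) \<Rightarrow> 'a set \<Rightarrow> bool" where
  "smooth_on f S \<longleftrightarrow> (\<forall>n. Ck_on n f S)"

text \<open>\<open>a\<close> is the family of coefficients of a power series in several variables, indexed by
  multi-indices \<open>k\<close>.\<close>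

definition analytic_at :: "(real^'n \<Rightarrow> 'b::real_normed_vector) \<Rightarrow> real^'n \<Rightarrow> bool" where
  "analytic_at f p \<longleftrightarrow>
     (\<exists>e>0. \<exists>a :: ('n \<Rightarrow> nat) \<Rightarrow> 'b. \<forall>x\<in>ball p e.
        ((\<lambda>k. (\<Prod>i\<in>UNIV. (x$i - p$i) ^ k i) *\<^sub>R a k) has_sum f x) UNIV)"

fun Cr_on :: "regularity \<Rightarrow> (real^'n \<Rightarrow> 'b::real_normed_vector) \<Rightarrow> (real^'n) set \<Rightarrow> bool" where
  "Cr_on Smooth f S \<longleftrightarrow> smooth_on f S"
| "Cr_on Analytic f S \<longleftrightarrow> smooth_on f S \<and> (\<forall>p\<in>S. analytic_at f p)"


section \<open>Two-dimensional manifolds\<close>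

text \<open>The underlying topological space is a whole type \<open>'m\<close> which is Hausdorff and second
  countable; the differentiable structure is an atlas. Manifolds need not be connected.
  The map of a chart \<open>(U, \<phi>)\<close> is only meaningful on \<open>U\<close>.\<close>

type_synonym 'm chart = "'m set \<times> ('m \<Rightarrow> real^2)"

abbreviation dom_of :: "'m chart \<Rightarrow> 'm set" where
  "dom_of c \<equiv> fst c"

abbreviation coord :: "'m chart \<Rightarrow> 'm \<Rightarrow> real^2" where
  "coord c \<equiv> snd c"

abbreviation cod_of :: "'m chart \<Rightarrow> (real^2) set" where
  "cod_of c \<equiv> coord c ` dom_of c"

abbreviation param :: "'m chart \<Rightarrow> real^2 \<Rightarrow> 'm" where
  "param c \<equiv> inv_into (dom_of c) (coord c)"

definition Cr_atlas ::
    "regularity \<Rightarrow> 'm::{t2_space, second_countable_topology} chart set \<Rightarrow> bool" where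
  "Cr_atlas r A \<longleftrightarrow>
     (\<Union>c\<in>A. dom_of c) = UNIV \<and>
     (\<forall>c\<in>A. open (dom_of c) \<and> open (cod_of c) \<and>
        homeomorphism (dom_of c) (cod_of c) (coord c) (param c)) \<and>
     (\<forall>c\<in>A. \<forall>d\<in>A. Cr_on r (coord d \<circ> param c) (coord c ` (dom_of c \<inter> dom_of d)))"

definition Cr_map :: "regularity \<Rightarrow> 'm chart set \<Rightarrow> ('m \<Rightarrow> 'b::real_normed_vector) \<Rightarrow> bool" where
  "Cr_map r A f \<longleftrightarrow> (\<forall>c\<in>A. Cr_on r (f \<circ> param c) (cod_of c))"

text \<open>The differential of \<open>f\<close> at \<open>p\<close>, applied to the tangent vector whose components in the
  chart \<open>c\<close> are \<open>v\<close>.\<close>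

definition differential ::
    "'m chart \<Rightarrow> ('m \<Rightarrow> 'b::real_normed_vector) \<Rightarrow> 'm \<Rightarrow> real^2 \<Rightarrow> 'b" where
  "differential c f p v = frechet_derivative (f \<circ> param c) (at (coord c p)) v"

definition immersion_at :: "'m chart set \<Rightarrow> ('m \<Rightarrow> 'b::real_normed_vector) \<Rightarrow> 'm \<Rightarrow> bool" where
  "immersion_at A f p \<longleftrightarrow> (\<forall>c\<in>A. p \<in> dom_of c \<longrightarrow> inj (differential c f p))"

definition singular_set :: "'m chart set \<Rightarrow> ('m \<Rightarrow> 'b::real_normed_vector) \<Rightarrow> 'm set" where
  "singular_set A f = {p. \<not> immersion_at A f p}"

text \<open>A vector field is given by its components in each chart of the atlas, which have to obey
  the transformation rule for tangent vectors.\<close>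

type_synonym 'm vfield = "'m chart \<Rightarrow> 'm \<Rightarrow> real^2"

definition Cr_vector_field :: "regularity \<Rightarrow> 'm chart set \<Rightarrow> 'm vfield \<Rightarrow> bool" where
  "Cr_vector_field r A X \<longleftrightarrow>
     (\<forall>c\<in>A. Cr_on r (X c \<circ> param c) (cod_of c)) \<and>
     (\<forall>c\<in>A. \<forall>d\<in>A. \<forall>p \<in> dom_of c \<inter> dom_of d. X d p = differential c (coord d) p (X c p))"

definition integral_curve ::
    "'m::topological_space chart set \<Rightarrow> 'm vfield \<Rightarrow> real set \<Rightarrow> (real \<Rightarrow> 'm) \<Rightarrow> bool" where
  "integral_curve A X I \<gamma> \<longleftrightarrow>
     open I \<and> is_interval I \<and> continuous_on I \<gamma> \<and>
     (\<forall>t\<in>I. \<forall>c\<in>A. \<gamma> t \<in> dom_of c \<longrightarrow>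
        ((coord c \<circ> \<gamma>) has_vector_derivative X c (\<gamma> t)) (at t))"


section \<open>Lorentz-Minkowski space\<close>

text \<open>The coordinates $(t,x,y)$ are the components \<open>1\<close>, \<open>2\<close>, \<open>3\<close> of \<open>real^3\<close>; the Euclidean norm
  is \<open>norm\<close>.\<close>

definition lorentz :: "real^3 \<Rightarrow> real^3 \<Rightarrow> real" where
  "lorentz v w = - v$1 * w$1 + v$2 * w$2 + v$3 * w$3"

definition light_like :: "real^3 \<Rightarrow> bool" where
  "light_like v \<longleftrightarrow> v \<noteq> 0 \<and> lorentz v v = 0"

definition future :: "real^3 \<Rightarrow> bool" where
  "future v \<longleftrightarrow> v$1 > 0"

definition light_like_line :: "(real^3) set \<Rightarrow> bool" where
  "light_like_line L \<longleftrightarrow> (\<exists>q v. light_like v \<and> L = range (\<lambda>s. q + s *\<^sub>R v))"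


section \<open>Null wave fronts\<close>

type_synonym covector = "(real^3) \<Rightarrow>\<^sub>L real"

text \<open>Points of the projective space of covectors are the lines spanned by non-zero covectors.
  For each vector \<open>w\<close>, the lines not annihilating \<open>w\<close> are the domain of an affine chart with values
  in the affine plane of all covectors \<open>\<beta>\<close> with \<open>\<beta> w = 1\<close>. These charts cover the projective
  space.\<close>

definition proj :: "covector \<Rightarrow> covector set" where
  "proj \<beta> = span {\<beta>}"

definition affine_chart :: "real^3 \<Rightarrow> covector set \<Rightarrow> covector" where
  "affine_chart w L = (THE \<beta>. \<beta> \<in> L \<and> blinfun_apply \<beta> w = 1)"

lemma affine_chart_proj:
  assumes "blinfun_apply \<beta> w \<noteq> 0"
  shows "affine_chart w (proj \<beta>) = (1 / blinfun_apply \<beta> w) *\<^sub>R \<beta>"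
  unfolding affine_chart_def
proof (rule the_equality)
  show "(1 / blinfun_apply \<beta> w) *\<^sub>R \<beta> \<in> proj \<beta> \<and> blinfun_apply ((1 / blinfun_apply \<beta> w) *\<^sub>R \<beta>) w = 1"
    using assms by (auto simp: proj_def blinfun.scaleR_left intro: span_base span_scale)
next
  fix \<beta>' assume "\<beta>' \<in> proj \<beta> \<and> blinfun_apply \<beta>' w = 1"
  then obtain k where k: "\<beta>' = k *\<^sub>R \<beta>" and "blinfun_apply \<beta>' w = 1"
    unfolding proj_def span_singleton by blast
  then have "k * blinfun_apply \<beta> w = 1"
    by (simp add: blinfun.scaleR_left)
  with k show "\<beta>' = (1 / blinfun_apply \<beta> w) *\<^sub>R \<beta>"
    using assms by (simp add: field_simps)
qed

text \<open>The last conjunct says that \<open>(F, proj \<circ> \<alpha>)\<close> is an immersion into the product of the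
  three-space with the projective space, expressed in the affine charts of the latter.\<close>

definition wave_front ::
    "regularity \<Rightarrow> 'm chart set \<Rightarrow> ('m \<Rightarrow> real^3) \<Rightarrow> ('m \<Rightarrow> covector) \<Rightarrow> bool" where
  "wave_front r A F \<alpha> \<longleftrightarrow>
     Cr_map r A F \<and> Cr_map r A \<alpha> \<and> (\<forall>p. \<alpha> p \<noteq> 0) \<and>
     (\<forall>p. \<forall>c\<in>A. p \<in> dom_of c \<longrightarrow> (\<forall>v. blinfun_apply (\<alpha> p) (differential c F p v) = 0)) \<and>
     (\<forall>p w. blinfun_apply (\<alpha> p) w \<noteq> 0 \<longrightarrow>
        immersion_at A (\<lambda>q. (F q, affine_chart w (proj (\<alpha> q)))) p)"

definition xi_hat :: "('m \<Rightarrow> covector) \<Rightarrow> 'm \<Rightarrow> real^3" where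
  "xi_hat \<alpha> p = (THE w. \<forall>x. lorentz w x = blinfun_apply (\<alpha> p) x)"

lemma xi_hat: "lorentz (xi_hat \<alpha> p) x = blinfun_apply (\<alpha> p) x"
proof -
  let ?a = "blinfun_apply (\<alpha> p)"
  have "\<exists>!w. \<forall>x. lorentz w x = ?a x"
  proof (rule ex1I)
    show "\<forall>x. lorentz (vector [- ?a (axis 1 1), ?a (axis 2 1), ?a (axis 3 1)]) x = ?a x"
    proof
      fix x :: "real^3"
      have "x = x$1 *\<^sub>R axis 1 1 + x$2 *\<^sub>R axis 2 1 + x$3 *\<^sub>R axis 3 1"
        by (simp add: vec_eq_iff forall_3 axis_def)
      then have "?a x = ?a (x$1 *\<^sub>R axis 1 1 + x$2 *\<^sub>R axis 2 1 + x$3 *\<^sub>R axis 3 1)"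
        by simp
      then show "lorentz (vector [- ?a (axis 1 1), ?a (axis 2 1), ?a (axis 3 1)]) x = ?a x"
        by (simp add: lorentz_def blinfun.add_right blinfun.scaleR_right)
    qed
  next
    fix w assume "\<forall>x. lorentz w x = ?a x"
    then have "?a x = lorentz w x" for x by simp
    then show "w = vector [- ?a (axis 1 1), ?a (axis 2 1), ?a (axis 3 1)]"
      by (simp add: vec_eq_iff forall_3 lorentz_def axis_def)
  qed
  from theI'[OF this] show ?thesis
    by (simp add: xi_hat_def)
qed

definition null_wave_front ::
    "regularity \<Rightarrow> 'm chart set \<Rightarrow> ('m \<Rightarrow> real^3) \<Rightarrow> ('m \<Rightarrow> covector) \<Rightarrow> bool" where
  "null_wave_front r A F \<alpha> \<longleftrightarrow> wave_front r A F \<alpha> \<and> (\<forall>p. light_like (xi_hat \<alpha> p))"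

definition xi_hat_E :: "('m \<Rightarrow> covector) \<Rightarrow> 'm \<Rightarrow> real^3" where
  "xi_hat_E \<alpha> p = (THE w. (\<exists>k. w = k *\<^sub>R xi_hat \<alpha> p) \<and> future w \<and> norm w = sqrt 2)"

lemma xi_hat_E:
  assumes "light_like (xi_hat \<alpha> p)"
  shows "(\<exists>k. xi_hat_E \<alpha> p = k *\<^sub>R xi_hat \<alpha> p) \<and> future (xi_hat_E \<alpha> p) \<and> norm (xi_hat_E \<alpha> p) = sqrt 2"
proof -
  define w where "w = xi_hat \<alpha> p"
  have "w \<noteq> 0" and null: "- w$1 * w$1 + w$2 * w$2 + w$3 * w$3 = 0"
    using assms by (auto simp: light_like_def lorentz_def w_def)
  have w1: "w$1 \<noteq> 0"
  proof
    assume "w$1 = 0"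
    with null have "w$2 = 0" "w$3 = 0"
      by (simp_all add: sum_squares_eq_zero_iff)
    with \<open>w$1 = 0\<close> \<open>w \<noteq> 0\<close> show False by (simp add: vec_eq_iff forall_3)
  qed
  define k where "k = sgn (w$1) * sqrt 2 / norm w"
  have "\<exists>!v. (\<exists>k. v = k *\<^sub>R w) \<and> future v \<and> norm v = sqrt 2"
  proof (rule ex1I)
    have "k * w$1 > 0"
      using w1 \<open>w \<noteq> 0\<close> by (cases "w$1 > 0") (simp_all add: k_def sgn_if mult_pos_neg divide_neg_pos)
    moreover have "\<bar>k\<bar> * norm w = sqrt 2"
      using w1 \<open>w \<noteq> 0\<close> by (simp add: k_def abs_mult sgn_if)
    ultimately show "(\<exists>l. k *\<^sub>R w = l *\<^sub>R w) \<and> future (k *\<^sub>R w) \<and> norm (k *\<^sub>R w) = sqrt 2"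
      by (auto simp: future_def)
  next
    fix v assume v: "(\<exists>k. v = k *\<^sub>R w) \<and> future v \<and> norm v = sqrt 2"
    then obtain l where l: "v = l *\<^sub>R w" by blast
    with v have "l * w$1 > 0" "\<bar>l\<bar> * norm w = sqrt 2"
      by (simp_all add: future_def)
    then have "sgn l = sgn (w$1)" "\<bar>l\<bar> = sqrt 2 / norm w"
      using \<open>w \<noteq> 0\<close> by (auto simp: sgn_if zero_less_mult_iff field_simps)
    then have "l = k" by (metis k_def mult_sgn_abs times_divide_eq_right)
    with l show "v = k *\<^sub>R w" by simp
  qed
  from theI'[OF this] show ?thesis
    by (simp add: xi_hat_E_def w_def)
qed

definition E_normalized_null_field ::
    "regularity \<Rightarrow> 'm::topological_space chart set \<Rightarrow> ('m \<Rightarrow> real^3) \<Rightarrow> ('m \<Rightarrow> covector)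
      \<Rightarrow> 'm vfield \<Rightarrow> bool" where
  "E_normalized_null_field r A F \<alpha> X \<longleftrightarrow>
     Cr_vector_field r A X \<and>
     (\<forall>p. \<forall>c\<in>A. p \<in> dom_of c \<longrightarrow> differential c F p (X c p) = xi_hat_E \<alpha> p) \<and>
     (\<forall>I \<gamma>. integral_curve A X I \<gamma> \<longrightarrow> (\<exists>L. light_like_line L \<and> F ` \<gamma> ` I \<subseteq> L))"

text \<open>For a null wave front the E-normalized null vector field exists and is unique (up to its
  irrelevant components in charts outside \<open>A\<close> and at points outside the domain of a chart).\<close>

definition L_complete ::
    "regularity \<Rightarrow> 'm::topological_space chart set \<Rightarrow> ('m \<Rightarrow> real^3) \<Rightarrow> ('m \<Rightarrow> covector) \<Rightarrow> bool" where
  "L_complete r A F \<alpha> \<longleftrightarrow>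
     (\<exists>X. E_normalized_null_field r A F \<alpha> X \<and>
        (\<forall>p. \<exists>\<gamma>. integral_curve A X UNIV \<gamma> \<and> p \<in> range \<gamma> \<and> light_like_line (range (F \<circ> \<gamma>))))"

definition complete_front ::
    "regularity \<Rightarrow> 'm::topological_space chart set \<Rightarrow> ('m \<Rightarrow> real^3) \<Rightarrow> ('m \<Rightarrow> covector) \<Rightarrow> bool" where
  "complete_front r A F \<alpha> \<longleftrightarrow>
     L_complete r A F \<alpha> \<and> singular_set A F \<noteq> {} \<and> compact (singular_set A F)"


section \<open>Cuspidal edges\<close>

definition diffeomorphism ::
    "('a::real_normed_vector \<Rightarrow> 'b::real_normed_vector) \<Rightarrow> 'a set \<Rightarrow> 'b set \<Rightarrow> bool" where
  "diffeomorphism g V W \<longleftrightarrow>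
     open V \<and> open W \<and> bij_betw g V W \<and> smooth_on g V \<and> smooth_on (inv_into V g) W"

definition standard_cuspidal_edge :: "real^2 \<Rightarrow> real^3" where
  "standard_cuspidal_edge x = vector [(x$1)^2, (x$1)^3, x$2]"

text \<open>Since a chart \<open>c\<close> is itself a diffeomorphism onto its image, every local diffeomorphism from
  the plane at the origin to \<open>'m\<close> at \<open>p\<close> is locally of the form \<open>param c \<circ> \<psi>\<close>. Also in the analytic
  case the diffeomorphisms are only required to be smooth.\<close>

definition cuspidal_edge :: "'m chart set \<Rightarrow> ('m \<Rightarrow> real^3) \<Rightarrow> 'm \<Rightarrow> bool" where
  "cuspidal_edge A F p \<longleftrightarrow>
     (\<exists>c\<in>A. p \<in> dom_of c \<and>
        (\<exists>\<psi> V U \<Phi> W W'.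
           diffeomorphism \<psi> V U \<and> 0 \<in> V \<and> \<psi> 0 = coord c p \<and> U \<subseteq> cod_of c \<and>
           diffeomorphism \<Phi> W W' \<and>
           (\<forall>x\<in>V. F (param c (\<psi> x)) \<in> W \<and>
              \<Phi> (F (param c (\<psi> x))) = standard_cuspidal_edge x)))"

end

theory Submission
  imports Defs
begin

text \<open>Through every point runs a light-like line with direction \<open>\<xi> = (1, cos \<theta>, sin \<theta>)\<close>, on which
  \<open>\<xi>\<close> and the intersection \<open>\<sigma>\<close> of the line with the plane $t = 0$ are constant. A point is singular
  iff $d\sigma + t\,d\xi = 0$, so each line carries at most one singular point, and near a singular point
  \<open>\<theta>\<close> is a local parameter of the singular set. As that set is compact, it contains a closed
  curve \<open>C\<close> parametrized by \<open>\<theta>\<close>, of period $2\pi k$, and $(F \circ C)' = m\,(1, \cos\theta, \sin\theta)$.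
  Far away two of the light-like lines emanating from \<open>C\<close> at parameters about $2\pi$ apart meet;
  injectivity forces them to come from the same point, hence $k = 1$. Now \<open>m\<close> is
  $2\pi$-periodic and orthogonal to $1$, $\cos$ and $\sin$, so it has at least four zeros
  (Sturm--Hurwitz). At a zero of \<open>m\<close> the image of the singular curve has velocity $0$, which is
  impossible for a cuspidal edge.\<close>

section \<open>Periodic functions of one real variable\<close>

text \<open>The closed curve comes from lifting. Sending a singular point to its direction \<xi> is
  a local homeomorphism from the singular set to the circle, and compactness makes the size of the
  local inverses uniform, so the angle lifts to the whole real line as for a covering map. One lift
  suffices, whatever other components the singular set has. The lines meet for the following reason.
  The line through \<open>F (C x)\<close> passes over the point of the (x,y)-plane with polar
  coordinates \<rho>, \<phi> exactly when x is critical for \<rho> cos(x - \<phi>) + H x, where H x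
  is minus the Lorentz product of \<open>F (C x)\<close> and (1, cos x, sin x); the critical value
  is the time at which it does so. For large \<rho> each window of radius pi/2 about \<phi> + 2 pi j
  contains a maximum, the height of one sheet of the front. Going once around the circle turns the
  sheet j into the sheet j + 1, and after k turns the first sheet returns, so neighbouring sheets
  cannot keep the same strict order everywhere: somewhere two consecutive heights agree.\<close>

lemma window_maximum:
  fixes H :: "real \<Rightarrow> real"
  assumes H: "\<And>x. (H has_real_derivative H' x) (at x)"
    and B: "\<And>x. \<bar>H' x\<bar> < \<rho>"
  shows "\<exists>u. \<bar>u\<bar> < pi / 2 \<and> (\<forall>w. \<bar>w\<bar> \<le> pi / 2 \<longrightarrow> \<rho> * cos w + H (x + w) \<le> \<rho> * cos u + H (x + u)) \<and>
    H' (x + u) = \<rho> * sin u"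
proof -
  define f where "f w = \<rho> * cos w + H (x + w)" for w
  have f': "(f has_real_derivative H' (x + w) - \<rho> * sin w) (at w)" for w
  proof -
    have "((\<lambda>w. H (x + w)) has_real_derivative H' (x + w)) (at w)"
      using H[of "x + w"] DERIV_shift[of H _ w x] by (simp add: add.commute)
    then show ?thesis
      unfolding f_def by (auto intro!: derivative_eq_intros)
  qed
  have "continuous_on {- pi / 2..pi / 2} f"
    by (intro continuous_at_imp_continuous_on ballI DERIV_isCont[OF f'])
  then obtain u where u: "u \<in> {- pi / 2..pi / 2}" and max: "\<And>w. w \<in> {- pi / 2..pi / 2} \<Longrightarrow> f w \<le> f u"
    using continuous_attains_sup[of "{- pi / 2..pi / 2}" f] by auto
  \<comment> \<open>At the right end of the window \<rho> cos w has slope -\<rho>, at the left end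
    slope \<rho>, and both dominate \<open>H'\<close>. So the maximum is interior, hence a critical
    point.\<close>
  have "u \<noteq> pi / 2"
  proof
    assume "u = pi / 2"
    then have "sin u = 1" using sin_pi_half by metis
    with B[of "x + u"] have "H' (x + u) - \<rho> * sin u < 0" by simp
    from DERIV_neg_dec_left[OF f' this] obtain d where d: "d > 0" "\<And>h. 0 < h \<Longrightarrow> h < d \<Longrightarrow> f u < f (u - h)"
      by auto
    \<comment> \<open>The cap 1 keeps the comparison point inside the window, whose length pi
      exceeds 1.\<close>
    have "f u < f (u - min (d / 2) 1)" by (rule d(2)) (use d(1) in auto)
    moreover have "u - min (d / 2) 1 \<in> {- pi / 2..pi / 2}"
      using d(1) \<open>u = pi / 2\<close> pi_gt3 by (auto simp: min_def)
    ultimately show False using max[of "u - min (d / 2) 1"] by linarith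
  qed
  moreover have "u \<noteq> - pi / 2"
  proof
    assume "u = - pi / 2"
    then have "sin u = -1" by simp
    with B[of "x + u"] have "H' (x + u) - \<rho> * sin u > 0" by simp
    from DERIV_pos_inc_right[OF f' this] obtain d where d: "d > 0" "\<And>h. 0 < h \<Longrightarrow> h < d \<Longrightarrow> f u < f (u + h)"
      by auto
    have "f u < f (u + min (d / 2) 1)" by (rule d(2)) (use d(1) in auto)
    moreover have "u + min (d / 2) 1 \<in> {- pi / 2..pi / 2}"
      using d(1) \<open>u = - pi / 2\<close> pi_gt3 by (auto simp: min_def)
    ultimately show False using max[of "u + min (d / 2) 1"] by linarith
  qed
  ultimately have u': "- pi / 2 < u" "u < pi / 2" using u by auto
  have "H' (x + u) - \<rho> * sin u = 0"
  proof (rule DERIV_local_max[OF f'])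
    show "0 < min (u + pi / 2) (pi / 2 - u)" using u' by auto
    show "\<forall>y. \<bar>u - y\<bar> < min (u + pi / 2) (pi / 2 - u) \<longrightarrow> f y \<le> f u"
      using max by (auto simp: abs_less_iff)
  qed
  moreover have "\<bar>u\<bar> < pi / 2" using u' by (simp add: abs_less_iff)
  moreover have "f w \<le> f u" if "\<bar>w\<bar> \<le> pi / 2" for w
    using that by (intro max) (auto simp: abs_le_iff)
  ultimately show ?thesis unfolding f_def by (intro exI[of _ u]) auto
qed

text \<open>The maximum over the window around \<open>x\<close> is $2\pi k$-periodic in \<open>x\<close>, so it can neither increase
  nor decrease at every shift by $2\pi$.\<close>

lemma common_value_of_window_maxima:
  fixes H :: "real \<Rightarrow> real" and k :: nat
  assumes H: "\<And>x. (H has_real_derivative H' x) (at x)"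
    and B: "\<And>x. \<bar>H' x\<bar> < \<rho>"
    and per: "\<And>x. H (x + 2 * pi * real k) = H x" and "k > 0"
  obtains \<phi> a b where "\<bar>a - \<phi>\<bar> < pi / 2" "\<bar>b - \<phi> - 2 * pi\<bar> < pi / 2"
    "H' a = \<rho> * sin (a - \<phi>)" "H' b = \<rho> * sin (b - \<phi>)"
    "\<rho> * cos (a - \<phi>) + H a = \<rho> * cos (b - \<phi>) + H b"
proof -
  obtain u where u: "\<And>x. \<bar>u x\<bar> < pi / 2" and H'u: "\<And>x. H' (x + u x) = \<rho> * sin (u x)"
    and max: "\<And>x w. \<bar>w\<bar> \<le> pi / 2 \<Longrightarrow> \<rho> * cos w + H (x + w) \<le> \<rho> * cos (u x) + H (x + u x)"
    using window_maximum[OF H B] by metis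
  define \<tau> where "\<tau> x = \<rho> * cos (u x) + H (x + u x)" for x
  have lip: "\<bar>H x - H y\<bar> \<le> \<rho> * \<bar>x - y\<bar>" for x y
    using field_differentiable_bound[of UNIV H H' \<rho> x y] H B by (auto simp: less_imp_le)
  \<comment> \<open>The maximizer \<open>u x\<close> need not depend continuously on x, but the
    maximum does: \<open>u x\<close> also competes in the window around y, and H is
    \<rho>-Lipschitz.\<close>
  have le: "\<tau> x \<le> \<tau> y + \<rho> * \<bar>x - y\<bar>" for x y
  proof -
    have "\<tau> x \<le> \<rho> * cos (u x) + H (y + u x) + \<rho> * \<bar>x - y\<bar>"
      using lip[of "x + u x" "y + u x"] by (simp add: \<tau>_def)
    then show ?thesis
      using max[of "u x" y] u[of x] by (simp add: \<tau>_def)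
  qed
  have per\<tau>: "\<tau> (x + 2 * pi * real k) = \<tau> x" for x
    using max[of "u x" "x + 2 * pi * real k"] max[of "u (x + 2 * pi * real k)" x]
      u[of x] u[of "x + 2 * pi * real k"] per[of "x + u x"] per[of "x + u (x + 2 * pi * real k)"]
    by (simp add: \<tau>_def algebra_simps)
  define D where "D x = \<tau> (x + 2 * pi) - \<tau> x" for x
  have "\<rho> \<ge> 0" using B[of 0] by linarith
  have "\<rho>-lipschitz_on UNIV \<tau>"
    unfolding lipschitz_on_def using \<open>\<rho> \<ge> 0\<close> le
    by (simp add: dist_real_def abs_le_iff) (metis abs_minus_commute le add.commute diff_le_eq)
  then have \<tau>_cont: "continuous_on UNIV \<tau>" by (rule lipschitz_on_continuous_on)
  have D_cont: "continuous_on UNIV D"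
    unfolding D_def by (intro continuous_intros continuous_on_compose2[OF \<tau>_cont]) auto
  have Suc2: "2 * pi * real (Suc j) = 2 * pi * real j + 2 * pi" for j
    by (simp add: algebra_simps)
  have "\<exists>x. D x \<le> 0"
  proof (rule ccontr)
    assume "\<not> ?thesis"
    then have *: "\<tau> (2 * pi * real j) < \<tau> (2 * pi * real (Suc j))" for j
      unfolding Suc2 by (simp add: D_def not_le)
    have "\<tau> (2 * pi * real 0) < \<tau> (2 * pi * real k)"
      using lift_Suc_mono_less[of "\<lambda>j. \<tau> (2 * pi * real j)" 0 k] * \<open>k > 0\<close> by blast
    with per\<tau>[of 0] show False by simp
  qed
  moreover have "\<exists>x. D x \<ge> 0"
  proof (rule ccontr)
    assume "\<not> ?thesis"
    then have *: "- \<tau> (2 * pi * real j) < - \<tau> (2 * pi * real (Suc j))" for j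
      unfolding Suc2 by (simp add: D_def not_le)
    have "- \<tau> (2 * pi * real 0) < - \<tau> (2 * pi * real k)"
      using lift_Suc_mono_less[of "\<lambda>j. - \<tau> (2 * pi * real j)" 0 k] * \<open>k > 0\<close> by blast
    with per\<tau>[of 0] show False by simp
  qed
  moreover have "is_interval (range D)"
    using connected_continuous_image[OF D_cont] by (simp add: is_interval_connected_1)
  ultimately have "0 \<in> range D"
    by (meson mem_is_interval_1_I rangeI)
  then obtain \<phi> where "D \<phi> = 0" by auto
  show thesis
  proof (rule that[of "\<phi> + u \<phi>" \<phi> "\<phi> + 2 * pi + u (\<phi> + 2 * pi)"])
    have *: "\<phi> + 2 * pi + u (\<phi> + 2 * pi) - \<phi> = u (\<phi> + 2 * pi) + 2 * pi" by simp
    show "H' (\<phi> + 2 * pi + u (\<phi> + 2 * pi)) = \<rho> * sin (\<phi> + 2 * pi + u (\<phi> + 2 * pi) - \<phi>)"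
      unfolding * using H'u by simp
    show "\<rho> * cos (\<phi> + u \<phi> - \<phi>) + H (\<phi> + u \<phi>) =
      \<rho> * cos (\<phi> + 2 * pi + u (\<phi> + 2 * pi) - \<phi>) + H (\<phi> + 2 * pi + u (\<phi> + 2 * pi))"
      unfolding * using \<open>D \<phi> = 0\<close> by (simp add: D_def \<tau>_def)
    show "\<bar>\<phi> + 2 * pi + u (\<phi> + 2 * pi) - \<phi> - 2 * pi\<bar> < pi / 2"
      using u[of "\<phi> + 2 * pi"] by simp
  qed (use u[of \<phi>] H'u[of \<phi>] in auto)
qed

text \<open>Darboux property, which spares continuity of \<open>T'\<close>: between a point of
  negative slope and a later one of positive slope the minimum of T is interior, hence a critical
  point. The opposite order is the same argument for -T, so \<open>f\<close> below stands for either
  function.\<close>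

lemma derivative_constant_sign:
  fixes T :: "real \<Rightarrow> real"
  assumes T: "\<And>x. (T has_real_derivative T' x) (at x)"
    and nz: "\<And>x. a < x \<Longrightarrow> x < b \<Longrightarrow> T' x \<noteq> 0"
  shows "(\<forall>x. a < x \<and> x < b \<longrightarrow> T' x \<ge> 0) \<or> (\<forall>x. a < x \<and> x < b \<longrightarrow> T' x \<le> 0)"
proof (rule ccontr)
  assume "\<not> ?thesis"
  then obtain x y where xy: "a < x" "x < b" "T' x < 0" "a < y" "y < b" "T' y > 0"
    by (auto simp: not_le)
  have False if "p < q" "a < p" "q < b" "f = T \<and> f' = T' \<or> f = (\<lambda>x. - T x) \<and> f' = (\<lambda>x. - T' x)" "f' p < 0" "f' q > 0" for p q f f'
  proof -
    have f: "(f has_real_derivative f' x) (at x)" for x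
      using that(4) T by (auto intro!: derivative_eq_intros)
    have "continuous_on {p..q} f"
      by (intro continuous_at_imp_continuous_on ballI DERIV_isCont[OF f])
    then obtain m where m: "m \<in> {p..q}" and min: "\<And>w. w \<in> {p..q} \<Longrightarrow> f m \<le> f w"
      using continuous_attains_inf[of "{p..q}" f] \<open>p < q\<close> by auto
    obtain d where d: "d > 0" "\<And>h. 0 < h \<Longrightarrow> h < d \<Longrightarrow> f (p + h) < f p"
      using DERIV_neg_dec_right[OF f \<open>f' p < 0\<close>] by auto
    obtain e where e: "e > 0" "\<And>h. 0 < h \<Longrightarrow> h < e \<Longrightarrow> f (q - h) < f q"
      using DERIV_pos_inc_left[OF f \<open>f' q > 0\<close>] by auto
    have "f (p + min (d / 2) (q - p)) < f p" "p + min (d / 2) (q - p) \<in> {p..q}"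
      using d \<open>p < q\<close> by (auto simp: min_def)
    then have "m \<noteq> p" using min by fastforce
    have "f (q - min (e / 2) (q - p)) < f q" "q - min (e / 2) (q - p) \<in> {p..q}"
      using e \<open>p < q\<close> by (auto simp: min_def)
    then have "m \<noteq> q" using min by fastforce
    have "f' m = 0"
    proof (rule DERIV_local_min[OF f])
      show "0 < min (m - p) (q - m)" using m \<open>m \<noteq> p\<close> \<open>m \<noteq> q\<close> by auto
      show "\<forall>y. \<bar>m - y\<bar> < min (m - p) (q - m) \<longrightarrow> f m \<le> f y"
        using min by (auto simp: abs_less_iff)
    qed
    moreover have "T' m \<noteq> 0" using nz[of m] m that by auto
    ultimately show False using that(4) by auto
  qed
  from this[of x y T T'] this[of y x "\<lambda>x. - T x" "\<lambda>x. - T' x"] xy show False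
    by (cases x y rule: linorder_cases) auto
qed

text \<open>The function \<open>w\<close> below lies in the span of $1$, $\cos$, $\sin$ and changes sign exactly at \<open>p\<close> and
  \<open>q\<close>. Hence \<open>w * T'\<close> has a periodic antiderivative, which is monotone.\<close>

lemma two_sign_changes_imp_zero:
  fixes T :: "real \<Rightarrow> real"
  assumes T: "\<And>x. (T has_real_derivative T' x) (at x)"
    and P: "\<And>x. (P has_real_derivative T' x * cos x) (at x)"
    and Q: "\<And>x. (Q has_real_derivative T' x * sin x) (at x)"
    and per: "\<And>x. T (x + 2 * pi) = T x" "\<And>x. P (x + 2 * pi) = P x" "\<And>x. Q (x + 2 * pi) = Q x"
    and pq: "p \<le> q" "q \<le> p + 2 * pi"
    and pos: "\<And>x. p < x \<Longrightarrow> x < q \<Longrightarrow> T' x \<ge> 0"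
    and neg: "\<And>x. q < x \<Longrightarrow> x < p + 2 * pi \<Longrightarrow> T' x \<le> 0"
    and x: "p < x" "x < p + 2 * pi" "x \<noteq> q"
  shows "T' x = 0"
proof -
  \<comment> \<open>The product formula gives 2 w x = cos((q - p)/2) - cos(x - (p + q)/2). Expanding
    the last cosine yields the coefficients of the antiderivative of
    \<open>2 * w x * T' x\<close>.\<close>
  define L where "L x = cos ((q - p) / 2) * T x - cos ((p + q) / 2) * P x - sin ((p + q) / 2) * Q x" for x
  define w where "w x = sin ((x - p) / 2) * sin ((x - q) / 2)" for x
  have w: "2 * w x = cos ((q - p) / 2) - cos ((p + q) / 2) * cos x - sin ((p + q) / 2) * sin x" for x
  proof -
    have "2 * w x = cos ((x - p) / 2 - (x - q) / 2) - cos ((x - p) / 2 + (x - q) / 2)"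
      unfolding w_def by (simp add: sin_times_sin)
    also have "(x - p) / 2 - (x - q) / 2 = (q - p) / 2" by (simp add: field_simps)
    also have "(x - p) / 2 + (x - q) / 2 = x - (p + q) / 2" by (simp add: field_simps)
    also have "cos (x - (p + q) / 2) = cos ((p + q) / 2) * cos x + sin ((p + q) / 2) * sin x"
      by (simp add: cos_diff)
    finally show ?thesis by simp
  qed
  have L': "(L has_real_derivative 2 * w x * T' x) (at x)" for x
    unfolding L_def w by (auto intro!: derivative_eq_intros T P Q simp: algebra_simps)
  have w1: "w x < 0" if "p < x" "x < q" for x
  proof -
    have "sin ((x - p) / 2) > 0" "sin ((q - x) / 2) > 0"
      using that pq by (auto intro!: sin_gt_zero)
    moreover have "sin ((x - q) / 2) = - sin ((q - x) / 2)"
      by (metis minus_diff_eq minus_divide_left sin_minus)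
    ultimately show ?thesis unfolding w_def by (simp add: mult_pos_neg)
  qed
  have w2: "w x > 0" if "q < x" "x < p + 2 * pi" for x
    unfolding w_def using that pq by (intro mult_pos_pos sin_gt_zero) auto
  have L'_le: "2 * w x * T' x \<le> 0" if x: "p < x" "x < p + 2 * pi" for x
  proof (cases x q rule: linorder_cases)
    case less with w1[of x] pos[of x] x show ?thesis by (auto simp: mult_le_0_iff)
  next
    case equal then show ?thesis by (simp add: w_def)
  next
    case greater with w2[of x] neg[of x] x show ?thesis by (auto simp: mult_le_0_iff)
  qed
  have cont: "continuous_on S L" for S
    by (intro continuous_at_imp_continuous_on ballI DERIV_isCont[OF L'])
  have anti: "L y \<le> L x" if "p \<le> x" "x \<le> y" "y \<le> p + 2 * pi" for x y
  proof (rule DERIV_nonpos_imp_decreasing_open[OF \<open>x \<le> y\<close>])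
    show "\<exists>z. (L has_real_derivative z) (at t) \<and> z \<le> 0" if "x < t" "t < y" for t
      using L'[of t] L'_le[of t] that \<open>p \<le> x\<close> \<open>y \<le> p + 2 * pi\<close> by force
  qed (rule cont)
  \<comment> \<open>A monotone function with equal values at both ends of the period is constant, so
    its derivative vanishes in between.\<close>
  have "L (p + 2 * pi) = L p" by (simp add: L_def per)
  then have const: "L y = L p" if "p \<le> y" "y \<le> p + 2 * pi" for y
    using anti[of p y] anti[of y "p + 2 * pi"] that by auto
  have "2 * w x * T' x = 0"
  proof (rule DERIV_local_const[OF L'])
    show "0 < min (x - p) (p + 2 * pi - x)" using x by auto
    show "\<forall>y. \<bar>x - y\<bar> < min (x - p) (p + 2 * pi - x) \<longrightarrow> L x = L y"
    proof (intro allI impI)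
      fix y assume "\<bar>x - y\<bar> < min (x - p) (p + 2 * pi - x)"
      then show "L x = L y" using const[of x] const[of y] x by (auto simp: abs_less_iff)
    qed
  qed
  moreover have "w x \<noteq> 0" using w1[of x] w2[of x] x by force
  ultimately show ?thesis by simp
qed

text \<open>The periodic antiderivatives say that \<open>T'\<close> is orthogonal to 1, cos and sin.
  With at most three zeros, a period splits into at most three arcs of constant sign. Sign changes
  around a circle are even in number, so at most two arcs remain after merging, and then
  \<open>two_sign_changes_imp_zero\<close> produces infinitely many zeros.\<close>

lemma four_critical_points:
  fixes T :: "real \<Rightarrow> real"
  assumes T: "\<And>x. (T has_real_derivative T' x) (at x)"
    and P: "\<And>x. (P has_real_derivative T' x * cos x) (at x)"
    and Q: "\<And>x. (Q has_real_derivative T' x * sin x) (at x)"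
    and per: "\<And>x. T (x + 2 * pi) = T x" "\<And>x. P (x + 2 * pi) = P x" "\<And>x. Q (x + 2 * pi) = Q x"
  obtains Z where "Z \<subseteq> {x. 0 \<le> x \<and> x < 2 * pi \<and> T' x = 0}" "finite Z" "card Z = 4"
proof -
  define Z where "Z = {x. 0 \<le> x \<and> x < 2 * pi \<and> T' x = 0}"
  have T'per: "T' (x + 2 * pi) = T' x" for x
  proof -
    have "((\<lambda>x. T (x + 2 * pi)) has_real_derivative T' (x + 2 * pi)) (at x)"
      using T[of "x + 2 * pi"] by (simp add: DERIV_shift)
    then show ?thesis using T[of x] per(1) by (simp add: DERIV_unique)
  qed
  \<comment> \<open>An arc may be empty (p = q or q = p + 2 pi), which covers one sign on the whole
    period.\<close>
  have arcs: "infinite Z"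
    if "p \<le> q" "q \<le> p + 2 * pi" "0 \<le> p" "p < 2 * pi"
      "(\<forall>x. p < x \<and> x < q \<longrightarrow> T' x \<ge> 0) \<and> (\<forall>x. q < x \<and> x < p + 2 * pi \<longrightarrow> T' x \<le> 0) \<or>
       (\<forall>x. p < x \<and> x < q \<longrightarrow> T' x \<le> 0) \<and> (\<forall>x. q < x \<and> x < p + 2 * pi \<longrightarrow> T' x \<ge> 0)" for p q
  proof -
    have *: "T' x = 0" if "p < x" "x < p + 2 * pi" "x \<noteq> q" for x
      using \<open>_ \<or> _\<close>
    proof
      assume "(\<forall>x. p < x \<and> x < q \<longrightarrow> T' x \<ge> 0) \<and> (\<forall>x. q < x \<and> x < p + 2 * pi \<longrightarrow> T' x \<le> 0)"
      with two_sign_changes_imp_zero[OF T P Q per \<open>p \<le> q\<close> \<open>q \<le> _\<close>] that show ?thesis by blast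
    next
      assume **: "(\<forall>x. p < x \<and> x < q \<longrightarrow> T' x \<le> 0) \<and> (\<forall>x. q < x \<and> x < p + 2 * pi \<longrightarrow> T' x \<ge> 0)"
      have "- T' x = 0"
        by (rule two_sign_changes_imp_zero[where T = "\<lambda>x. - T x" and P = "\<lambda>x. - P x" and Q = "\<lambda>x. - Q x"
              and T' = "\<lambda>x. - T' x" and p = p and q = q])
          (use ** that \<open>p \<le> q\<close> \<open>q \<le> _\<close> in \<open>auto intro!: derivative_eq_intros T P Q simp: per\<close>)
      then show ?thesis by simp
    qed
    have "{p<..<2 * pi} - {q} \<subseteq> Z" unfolding Z_def using * \<open>0 \<le> p\<close> by auto
    moreover have "infinite ({p<..<2 * pi} - {q})"
      using \<open>p < 2 * pi\<close> by (simp add: infinite_Ioo)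
    ultimately show ?thesis using finite_subset by blast
  qed
  \<comment> \<open>The order is not strict: one or two zeros are treated as three with
    repetitions.\<close>
  have three: "infinite Z" if z: "Z = {z1, z2, z3}" and ord: "z1 \<le> z2" "z2 \<le> z3" for z1 z2 z3
  proof -
    have z0: "0 \<le> z1" "z1 < 2 * pi" "z2 < 2 * pi" "z3 < 2 * pi" "T' z1 = 0" "T' z2 = 0" "T' z3 = 0"
      using z ord unfolding Z_def by auto
    have nz: "T' x \<noteq> 0" if "z1 < x" "x < z1 + 2 * pi" "x \<noteq> z2" "x \<noteq> z3" for x
    proof
      assume "T' x = 0"
      then have "T' (x - 2 * pi) = 0" using T'per[of "x - 2 * pi"] by simp
      then have "x \<in> Z \<or> x - 2 * pi \<in> Z"
        using \<open>T' x = 0\<close> that z0 unfolding Z_def by auto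
      with that z z0 ord show False by auto
    qed
    have s1: "(\<forall>x. z1 < x \<and> x < z2 \<longrightarrow> T' x \<ge> 0) \<or> (\<forall>x. z1 < x \<and> x < z2 \<longrightarrow> T' x \<le> 0)"
      by (rule derivative_constant_sign[OF T]) (use nz z0 ord in auto)
    have s2: "(\<forall>x. z2 < x \<and> x < z3 \<longrightarrow> T' x \<ge> 0) \<or> (\<forall>x. z2 < x \<and> x < z3 \<longrightarrow> T' x \<le> 0)"
      by (rule derivative_constant_sign[OF T]) (use nz z0 ord in auto)
    have s3: "(\<forall>x. z3 < x \<and> x < z1 + 2 * pi \<longrightarrow> T' x \<ge> 0) \<or> (\<forall>x. z3 < x \<and> x < z1 + 2 * pi \<longrightarrow> T' x \<le> 0)"
      by (rule derivative_constant_sign[OF T]) (use nz z0 ord in auto)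
    have join: "T' x \<ge> 0 \<or> \<not> (p < x \<and> x < r)"
      if "\<forall>x. p < x \<and> x < q \<longrightarrow> T' x \<ge> 0" "\<forall>x. q < x \<and> x < r \<longrightarrow> T' x \<ge> 0" "T' q = 0" for p q r x
      using that by (metis linorder_less_linear order_refl)
    have join': "T' x \<le> 0 \<or> \<not> (p < x \<and> x < r)"
      if "\<forall>x. p < x \<and> x < q \<longrightarrow> T' x \<le> 0" "\<forall>x. q < x \<and> x < r \<longrightarrow> T' x \<le> 0" "T' q = 0" for p q r x
      using that by (metis linorder_less_linear order_refl)
    \<comment> \<open>Merging the third arc with the first needs the first one moved by a full
      period.\<close>
    have shift: "\<forall>x. z1 + 2 * pi < x \<and> x < z2 + 2 * pi \<longrightarrow> T' x \<ge> 0"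
      if "\<forall>x. z1 < x \<and> x < z2 \<longrightarrow> T' x \<ge> 0"
    proof (intro allI impI)
      fix x assume "z1 + 2 * pi < x \<and> x < z2 + 2 * pi"
      then show "T' x \<ge> 0" using that[rule_format, of "x - 2 * pi"] T'per[of "x - 2 * pi"] by auto
    qed
    have shift': "\<forall>x. z1 + 2 * pi < x \<and> x < z2 + 2 * pi \<longrightarrow> T' x \<le> 0"
      if "\<forall>x. z1 < x \<and> x < z2 \<longrightarrow> T' x \<le> 0"
    proof (intro allI impI)
      fix x assume "z1 + 2 * pi < x \<and> x < z2 + 2 * pi"
      then show "T' x \<le> 0" using that[rule_format, of "x - 2 * pi"] T'per[of "x - 2 * pi"] by auto
    qed
    have T'1: "T' (z1 + 2 * pi) = 0" using T'per z0 by simp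
    note J = join[of z1 z2 z3] join[of z1 z3 "z1 + 2 * pi"] join[of z3 "z1 + 2 * pi" "z2 + 2 * pi"]
      join[of z2 z3 "z1 + 2 * pi"]
    note J' = join'[of z1 z2 z3] join'[of z1 z3 "z1 + 2 * pi"] join'[of z3 "z1 + 2 * pi" "z2 + 2 * pi"]
      join'[of z2 z3 "z1 + 2 * pi"]
    have pre: "z1 \<le> z3" "z3 \<le> z1 + 2 * pi" "z1 \<le> z1 + 2 * pi" "z2 \<le> z1 + 2 * pi" "z3 \<le> z2 + 2 * pi" "0 \<le> z2"
      using z0 ord by auto
    note A = arcs[OF pre(1,2) z0(1,2)] arcs[OF pre(3) order_refl z0(1,2)] arcs[OF ord(1) pre(4) z0(1,2)]
      arcs[OF ord(2) pre(5,6) z0(3)]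
    \<comment> \<open>In each of the eight sign patterns two cyclically adjacent arcs agree; they
      are joined across their common zero, and \<open>arcs\<close> applies to the joined arc and the
      third one.\<close>
    from s1 s2 s3 show ?thesis
    proof (elim disjE, goal_cases)
      case 1 with J(1) have "\<forall>x. z1 < x \<and> x < z3 \<longrightarrow> T' x \<ge> 0" using z0 by blast
      with 1 J(2) have "\<forall>x. z1 < x \<and> x < z1 + 2 * pi \<longrightarrow> T' x \<ge> 0" using z0 by blast
      then show ?case by (intro A(2)) auto
    next
      case 2 with J(1) have "\<forall>x. z1 < x \<and> x < z3 \<longrightarrow> T' x \<ge> 0" using z0 by blast
      with 2 show ?case by (intro A(1)) blast
    next
      case 3 with J(3) shift T'1 have "\<forall>x. z3 < x \<and> x < z2 + 2 * pi \<longrightarrow> T' x \<ge> 0" by blast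
      with 3 show ?case by (intro A(4)) blast
    next
      case 4 with J'(4) have "\<forall>x. z2 < x \<and> x < z1 + 2 * pi \<longrightarrow> T' x \<le> 0" using z0 by blast
      with 4 show ?case by (intro A(3)) blast
    next
      case 5 with J(4) have "\<forall>x. z2 < x \<and> x < z1 + 2 * pi \<longrightarrow> T' x \<ge> 0" using z0 by blast
      with 5 show ?case by (intro A(3)) blast
    next
      case 6 with J'(3) shift' T'1 have "\<forall>x. z3 < x \<and> x < z2 + 2 * pi \<longrightarrow> T' x \<le> 0" by blast
      with 6 show ?case by (intro A(4)) blast
    next
      case 7 with J'(1) have "\<forall>x. z1 < x \<and> x < z3 \<longrightarrow> T' x \<le> 0" using z0 by blast
      with 7 show ?case by (intro A(1)) blast
    next
      case 8 with J'(1) have "\<forall>x. z1 < x \<and> x < z3 \<longrightarrow> T' x \<le> 0" using z0 by blast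
      with 8 J'(2) have "\<forall>x. z1 < x \<and> x < z1 + 2 * pi \<longrightarrow> T' x \<le> 0" using z0 by blast
      then show ?case by (intro A(2)) auto
    qed
  qed
  have "Z \<noteq> {}"
  proof
    assume "Z = {}"
    then have "T' x \<noteq> 0" if "0 < x" "x < 2 * pi" for x
      using that unfolding Z_def by auto
    from derivative_constant_sign[OF T, of 0 "2 * pi", OF this] have "infinite Z"
      by (intro arcs[of 0 "2 * pi"]) auto
    with \<open>Z = {}\<close> show False by simp
  qed
  have sorted: "\<exists>a b c. {x, y, z} = {a, b, c} \<and> a \<le> b \<and> b \<le> c" for x y z :: real
    by (metis insert_commute linear)
  have "infinite Z \<or> card Z \<ge> 4"
  proof (rule ccontr)
    assume "\<not> ?thesis"
    then have "finite Z" "card Z < 4" by auto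
    moreover from this \<open>Z \<noteq> {}\<close> have "card Z \<noteq> 0" by simp
    ultimately have "card Z = 1 \<or> card Z = 2 \<or> card Z = 3" by linarith
    then have "\<exists>x y z. Z = {x, y, z}"
    proof (elim disjE)
      assume "card Z = 1"
      then show ?thesis by (metis card_1_singletonE insert_absorb2)
    next
      assume "card Z = 2"
      then show ?thesis by (metis card_2_iff insert_absorb2)
    qed (metis card_3_iff)
    with sorted three \<open>finite Z\<close> show False by metis
  qed
  then obtain Z' where "Z' \<subseteq> Z" "finite Z'" "card Z' = 4"
    by (metis infinite_arbitrarily_large obtain_subset_with_card_n)
  with that show thesis unfolding Z_def by blast
qed

section \<open>Twice differentiable maps\<close>

text \<open>Weaker than class $C^2$: the second derivatives need not be continuous.\<close>

definition C2_on :: "('a::real_normed_vector \<Rightarrow> 'b::real_normed_vector) \<Rightarrow> 'a set \<Rightarrow> bool" where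
  "C2_on f S \<longleftrightarrow> (\<exists>f'. (\<forall>x\<in>S. (f has_derivative f' x) (at x)) \<and>
     (\<forall>v. \<forall>x\<in>S. (\<lambda>x. f' x v) differentiable (at x)))"

lemma smooth_on_imp_C2_on: "smooth_on f S \<Longrightarrow> C2_on f S"
proof -
  assume "smooth_on f S"
  then have "Ck_on (Suc (Suc 0)) f S" unfolding smooth_on_def by blast
  then show ?thesis
    unfolding C2_on_def Ck_on.simps
    by (intro exI[of _ "\<lambda>x. frechet_derivative f (at x)"]) (auto simp: frechet_derivative_works)
qed

lemma C2_on_imp_differentiable: "C2_on f S \<Longrightarrow> x \<in> S \<Longrightarrow> f differentiable (at x)"
  unfolding C2_on_def differentiable_def by blast

lemma C2_on_frechet_differentiable:
  assumes "C2_on f S" "open S" "x \<in> S"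
  shows "(\<lambda>x. frechet_derivative f (at x) v) differentiable (at x)"
proof -
  obtain f' where f': "\<And>x. x \<in> S \<Longrightarrow> (f has_derivative f' x) (at x)"
    and d: "\<And>v x. x \<in> S \<Longrightarrow> (\<lambda>x. f' x v) differentiable (at x)"
    using assms(1) unfolding C2_on_def by blast
  have "(\<lambda>x. f' x v) x = frechet_derivative f (at x) v" if "x \<in> S" for x
    using frechet_derivative_at[OF f'[OF that]] by simp
  with d[OF \<open>x \<in> S\<close>, of v] show ?thesis
    by (meson assms(2,3) differentiable_def has_derivative_transform_within_open)
qed

lemma C2_on_bounded_linear:
  assumes "bounded_linear L" "C2_on f S"
  shows "C2_on (\<lambda>x. L (f x)) S"
proof -
  obtain f' where f': "\<And>x. x \<in> S \<Longrightarrow> (f has_derivative f' x) (at x)"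
    and d: "\<And>v x. x \<in> S \<Longrightarrow> (\<lambda>x. f' x v) differentiable (at x)"
    using assms(2) unfolding C2_on_def by blast
  have "((\<lambda>x. L (f x)) has_derivative (\<lambda>v. L (f' x v))) (at x)" if "x \<in> S" for x
    using bounded_linear.has_derivative[OF assms(1) f'[OF that]] .
  moreover have "(\<lambda>x. L (f' x v)) differentiable (at x)" if "x \<in> S" for x v
    using d[OF that, of v] bounded_linear.has_derivative[OF assms(1)] unfolding differentiable_def
    by metis
  ultimately show ?thesis unfolding C2_on_def by (intro exI[of _ "\<lambda>x v. L (f' x v)"]) blast
qed

lemma C2_on_diff:
  assumes "C2_on f S" "C2_on g S"
  shows "C2_on (\<lambda>x. f x - g x) S"
proof -
  obtain f' where f': "\<And>x. x \<in> S \<Longrightarrow> (f has_derivative f' x) (at x)"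
    and d: "\<And>v x. x \<in> S \<Longrightarrow> (\<lambda>x. f' x v) differentiable (at x)"
    using assms(1) unfolding C2_on_def by blast
  obtain g' where g': "\<And>x. x \<in> S \<Longrightarrow> (g has_derivative g' x) (at x)"
    and e: "\<And>v x. x \<in> S \<Longrightarrow> (\<lambda>x. g' x v) differentiable (at x)"
    using assms(2) unfolding C2_on_def by blast
  show ?thesis unfolding C2_on_def
    by (intro exI[of _ "\<lambda>x v. f' x v - g' x v"]) (use has_derivative_diff[OF f' g'] d e in auto)
qed

lemma C2_on_scaleR:
  fixes f :: "'a::real_normed_vector \<Rightarrow> real"
  assumes "C2_on f S" "C2_on g S"
  shows "C2_on (\<lambda>x. f x *\<^sub>R g x) S"
proof -
  obtain f' where f': "\<And>x. x \<in> S \<Longrightarrow> (f has_derivative f' x) (at x)"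
    and d: "\<And>v x. x \<in> S \<Longrightarrow> (\<lambda>x. f' x v) differentiable (at x)"
    using assms(1) unfolding C2_on_def by blast
  obtain g' where g': "\<And>x. x \<in> S \<Longrightarrow> (g has_derivative g' x) (at x)"
    and e: "\<And>v x. x \<in> S \<Longrightarrow> (\<lambda>x. g' x v) differentiable (at x)"
    using assms(2) unfolding C2_on_def by blast
  have "f differentiable (at x)" "g differentiable (at x)" if "x \<in> S" for x
    using f' g' that unfolding differentiable_def by blast+
  then show ?thesis unfolding C2_on_def
    by (intro exI[of _ "\<lambda>x v. f x *\<^sub>R g' x v + f' x v *\<^sub>R g x"])
      (use has_derivative_scaleR[OF f' g'] d e in \<open>auto intro!: differentiable_add differentiable_scaleR\<close>)
qed

lemma C2_on_inverse:
  fixes f :: "'a::real_normed_vector \<Rightarrow> real"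
  assumes "C2_on f S" "\<And>x. x \<in> S \<Longrightarrow> f x \<noteq> 0"
  shows "C2_on (\<lambda>x. inverse (f x)) S"
proof -
  obtain f' where f': "\<And>x. x \<in> S \<Longrightarrow> (f has_derivative f' x) (at x)"
    and d: "\<And>v x. x \<in> S \<Longrightarrow> (\<lambda>x. f' x v) differentiable (at x)"
    using assms(1) unfolding C2_on_def by blast
  have f: "f differentiable (at x)" if "x \<in> S" for x
    using f' that unfolding differentiable_def by blast
  have "((\<lambda>x. inverse (f x)) has_derivative (\<lambda>v. - (inverse (f x) * f' x v * inverse (f x)))) (at x)"
    if "x \<in> S" for x
    using Deriv.has_derivative_inverse[OF assms(2)[OF that] f'[OF that]] by simp
  moreover have "(\<lambda>x. - (inverse (f x) * f' x v * inverse (f x))) differentiable (at x)" if "x \<in> S" for x v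
    using f[OF that] d[OF that, of v] assms(2)[OF that]
    by (intro differentiable_minus differentiable_mult differentiable_inverse)
  ultimately show ?thesis unfolding C2_on_def
    by (intro exI[of _ "\<lambda>x v. - (inverse (f x) * f' x v * inverse (f x))"]) blast
qed

lemma Cr_on_imp_C2_on: "Cr_on r f S \<Longrightarrow> C2_on f S"
  by (cases r) (auto intro: smooth_on_imp_C2_on)

section \<open>Light-like lines of a null wave front\<close>

text \<open>L-completeness enters through \<open>curve\<close>: each point lies on an integral curve
  defined for all times. That F maps such a curve to a line, traversed with the coordinate t as
  parameter, is derived in \<open>F_line\<close> and \<open>F1_line\<close>.\<close>

locale null_front =
  fixes r :: regularity
    and A :: "'m::{t2_space, second_countable_topology} chart set"
    and F :: "'m \<Rightarrow> real^3"
    and \<alpha> :: "'m \<Rightarrow> covector"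
    and X :: "'m vfield"
  assumes atlas: "Cr_atlas r A"
    and front: "null_wave_front r A F \<alpha>"
    and field: "E_normalized_null_field r A F \<alpha> X"
    and curve: "\<exists>\<gamma>. integral_curve A X UNIV \<gamma> \<and> p \<in> range \<gamma>"
begin

abbreviation \<xi> :: "'m \<Rightarrow> real^3" where "\<xi> \<equiv> xi_hat_E \<alpha>"

text \<open>The point at which the light-like line through \<open>F p\<close> meets the plane $t = 0$.\<close>

definition \<sigma> :: "'m \<Rightarrow> real^3" where "\<sigma> p = F p - F p $ 1 *\<^sub>R \<xi> p"

definition C2_map :: "('m \<Rightarrow> 'b::real_normed_vector) \<Rightarrow> bool" where
  "C2_map Q \<longleftrightarrow> (\<forall>c\<in>A. C2_on (Q \<circ> param c) (cod_of c))"

lemma ex_chart: obtains c where "c \<in> A" "p \<in> dom_of c"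
  using atlas unfolding Cr_atlas_def by blast

lemma chart:
  assumes "c \<in> A"
  shows "open (dom_of c)" "open (cod_of c)" "continuous_on (dom_of c) (coord c)"
    "continuous_on (cod_of c) (param c)"
    "p \<in> dom_of c \<Longrightarrow> param c (coord c p) = p"
    "x \<in> cod_of c \<Longrightarrow> coord c (param c x) = x"
    "x \<in> cod_of c \<Longrightarrow> param c x \<in> dom_of c"
  using atlas assms unfolding Cr_atlas_def homeomorphism_def by auto

lemma transition_differentiable:
  assumes "c \<in> A" "d \<in> A" "p \<in> dom_of c" "p \<in> dom_of d"
  shows "(coord d \<circ> param c) differentiable (at (coord c p))"
  using assms atlas unfolding Cr_atlas_def
  by (intro C2_on_imp_differentiable[OF Cr_on_imp_C2_on, of r _ "coord c ` (dom_of c \<inter> dom_of d)"]) auto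

lemma has_differential:
  assumes "(Q \<circ> param c) differentiable (at (coord c p))"
  shows "((Q \<circ> param c) has_derivative differential c Q p) (at (coord c p))"
  using assms unfolding frechet_derivative_works differential_def[abs_def] .

lemma C2_map_differentiable:
  assumes "C2_map Q" "c \<in> A" "p \<in> dom_of c"
  shows "(Q \<circ> param c) differentiable (at (coord c p))"
  using assms unfolding C2_map_def by (meson C2_on_imp_differentiable imageI)

lemma C2_map_has_differential:
  assumes "C2_map Q" "c \<in> A" "p \<in> dom_of c"
  shows "((Q \<circ> param c) has_derivative differential c Q p) (at (coord c p))"
  using has_differential[OF C2_map_differentiable[OF assms]] .

lemma differential_unique:
  assumes "((Q \<circ> param c) has_derivative D) (at (coord c p))"
  shows "differential c Q p = D"
  using frechet_derivative_at[OF assms] unfolding differential_def[abs_def] by simp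

text \<open>The chain rule for the transition map; the composite agrees with
  \<open>Q \<circ> param d\<close> only near \<open>coord d p\<close>. It makes the vanishing of a
  differential independent of the chart.\<close>

lemma differential_change_chart:
  assumes Q: "C2_map Q" and c: "c \<in> A" "p \<in> dom_of c" and d: "d \<in> A" "p \<in> dom_of d"
  shows "differential d Q p v = differential c Q p (differential d (coord c) p v)"
proof -
  have "((coord c \<circ> param d) has_derivative differential d (coord c) p) (at (coord d p))"
    using has_differential[OF transition_differentiable[OF d(1) c(1) d(2) c(2)]] .
  moreover have "((Q \<circ> param c) has_derivative differential c Q p) (at ((coord c \<circ> param d) (coord d p)))"
    using C2_map_has_differential[OF Q c] chart(5)[OF d] by simp
  ultimately have 1: "((Q \<circ> param c) \<circ> (coord c \<circ> param d) has_derivative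
      differential c Q p \<circ> differential d (coord c) p) (at (coord d p))"
    by (rule diff_chain_at)
  have "open (param d -` dom_of c \<inter> cod_of d)"
    using chart[OF d(1)] chart[OF c(1)] by (meson continuous_on_open_vimage)
  moreover have "coord d p \<in> param d -` dom_of c \<inter> cod_of d"
    using chart(5)[OF d] c d by auto
  ultimately have "((Q \<circ> param d) has_derivative differential c Q p \<circ> differential d (coord c) p) (at (coord d p))"
    using chart(5)[OF c(1)] by (intro has_derivative_transform_within_open[OF 1]) auto
  from differential_unique[OF this] show ?thesis by simp
qed

lemma eventually_in_chart:
  assumes "c \<in> A" "\<gamma> t \<in> dom_of c" "isCont \<gamma> t"
  shows "\<forall>\<^sub>F s in nhds t. \<gamma> s \<in> dom_of c"
  using assms chart(1)[OF assms(1)]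
  by (metis (mono_tags) eventually_nhds_conv_at continuous_at topological_tendstoD)

text \<open>A chart map is arbitrary outside its domain, so differentiability of
  \<open>coord c \<circ> \<gamma>\<close> is meaningful only together with \<open>ev\<close>, which
  keeps \<gamma> in the domain near t.\<close>

lemma has_vector_derivative_along:
  assumes Q: "C2_map Q" and c: "c \<in> A" "\<gamma> t \<in> dom_of c" and ev: "\<forall>\<^sub>F s in nhds t. \<gamma> s \<in> dom_of c"
    and d: "((coord c \<circ> \<gamma>) has_vector_derivative w) (at t)"
  shows "((Q \<circ> \<gamma>) has_vector_derivative differential c Q (\<gamma> t) w) (at t)"
proof -
  have "((Q \<circ> param c) has_derivative differential c Q (\<gamma> t)) (at ((coord c \<circ> \<gamma>) t))"
    using C2_map_has_differential[OF Q c] by simp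
  from diff_chain_at[OF d[unfolded has_vector_derivative_def] this]
  have *: "((Q \<circ> param c) \<circ> (coord c \<circ> \<gamma>) has_derivative (\<lambda>h. h *\<^sub>R differential c Q (\<gamma> t) w)) (at t)"
    using linear_scale[OF has_derivative_linear[OF C2_map_has_differential[OF Q c]]]
    by (simp add: o_def)
  obtain U where "open U" "t \<in> U" and U: "\<And>s. s \<in> U \<Longrightarrow> \<gamma> s \<in> dom_of c"
    using ev unfolding eventually_nhds by blast
  show ?thesis unfolding has_vector_derivative_def
    by (rule has_derivative_transform_within_open[OF * \<open>open U\<close> \<open>t \<in> U\<close>])
      (use U chart(5)[OF c(1)] in auto)
qed

lemma has_vector_derivative_integral_curve:
  assumes "integral_curve A X UNIV \<gamma>" "C2_map Q" "c \<in> A" "\<gamma> t \<in> dom_of c"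
  shows "((Q \<circ> \<gamma>) has_vector_derivative differential c Q (\<gamma> t) (X c (\<gamma> t))) (at t)"
proof (rule has_vector_derivative_along[where \<gamma> = \<gamma>, OF assms(2-4)])
  show "\<forall>\<^sub>F s in nhds t. \<gamma> s \<in> dom_of c"
    using assms unfolding integral_curve_def
    by (intro eventually_in_chart) (auto simp: continuous_on_eq_continuous_at)
qed (use assms in \<open>auto simp: integral_curve_def\<close>)

section \<open>The normalized null direction as a differentiable map\<close>

lemma xi_hat_eq: "xi_hat \<alpha> p = vector [- \<alpha> p (axis 1 1), \<alpha> p (axis 2 1), \<alpha> p (axis 3 1)]"
  by (simp add: vec_eq_iff forall_3 xi_hat[symmetric]) (simp add: lorentz_def axis_def)

text \<open>On the light cone the squared Euclidean norm is twice the square of the time component,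
  so norm \<open>sqrt 2\<close> and future direction amount to time component 1. The resulting
  formula \<open>xi_eq\<close> is what gives \<xi> the regularity of \<alpha>.\<close>

lemma xi:
  shows xi_hat_1: "xi_hat \<alpha> p $ 1 \<noteq> 0"
    and xi_eq: "\<xi> p = inverse (xi_hat \<alpha> p $ 1) *\<^sub>R xi_hat \<alpha> p"
    and xi_1: "\<xi> p $ 1 = 1"
    and xi_circle: "(\<xi> p $ 2)\<^sup>2 + (\<xi> p $ 3)\<^sup>2 = 1"
proof -
  define w where "w = xi_hat \<alpha> p"
  have ll: "light_like w" using front unfolding null_wave_front_def w_def by blast
  obtain k where k: "\<xi> p = k *\<^sub>R w" and fut: "future (\<xi> p)" and nrm: "norm (\<xi> p) = sqrt 2"
    using xi_hat_E[of \<alpha> p] ll unfolding w_def by blast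
  from k fut have kw: "k * w $ 1 > 0" by (simp add: future_def)
  then show "xi_hat \<alpha> p $ 1 \<noteq> 0" by (auto simp: w_def)
  have null: "(w $ 2)\<^sup>2 + (w $ 3)\<^sup>2 = (w $ 1)\<^sup>2"
    using ll by (simp add: light_like_def lorentz_def power2_eq_square)
  have "(norm (\<xi> p))\<^sup>2 = (\<xi> p $ 1)\<^sup>2 + (\<xi> p $ 2)\<^sup>2 + (\<xi> p $ 3)\<^sup>2"
    by (simp add: norm_vec_def L2_set_def sum_3)
  moreover have circ: "(\<xi> p $ 2)\<^sup>2 + (\<xi> p $ 3)\<^sup>2 = (\<xi> p $ 1)\<^sup>2"
    using null by (simp add: k power_mult_distrib flip: distrib_left)
  ultimately have "(\<xi> p $ 1)\<^sup>2 = 1" using nrm by simp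
  with fut show 1: "\<xi> p $ 1 = 1" by (simp add: future_def power2_eq_1_iff)
  with circ show "(\<xi> p $ 2)\<^sup>2 + (\<xi> p $ 3)\<^sup>2 = 1" by simp
  from 1 k kw show "\<xi> p = inverse (xi_hat \<alpha> p $ 1) *\<^sub>R xi_hat \<alpha> p"
    by (metis inverse_unique mult.commute vector_scaleR_component w_def real_scaleR_def)
qed

lemma C2_F: "C2_map F"
  using front unfolding null_wave_front_def wave_front_def Cr_map_def C2_map_def
  by (auto intro: Cr_on_imp_C2_on)

lemma C2_alpha: "C2_map \<alpha>"
  using front unfolding null_wave_front_def wave_front_def Cr_map_def C2_map_def
  by (auto intro: Cr_on_imp_C2_on)

lemma C2_map_bounded_linear: "bounded_linear L \<Longrightarrow> C2_map Q \<Longrightarrow> C2_map (\<lambda>p. L (Q p))"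
  unfolding C2_map_def o_def by (auto intro: C2_on_bounded_linear)

lemma C2_map_diff: "C2_map P \<Longrightarrow> C2_map Q \<Longrightarrow> C2_map (\<lambda>p. P p - Q p)"
  unfolding C2_map_def o_def by (auto intro: C2_on_diff)

lemma C2_map_scaleR: "C2_map P \<Longrightarrow> C2_map Q \<Longrightarrow> C2_map (\<lambda>p. P p *\<^sub>R Q p)"
  unfolding C2_map_def o_def by (auto intro: C2_on_scaleR)

lemma C2_map_inverse: "C2_map P \<Longrightarrow> (\<And>p. P p \<noteq> 0) \<Longrightarrow> C2_map (\<lambda>p. inverse (P p :: real))"
  unfolding C2_map_def o_def by (auto intro: C2_on_inverse)

lemma C2_xi: "C2_map \<xi>"
proof -
  have "bounded_linear (\<lambda>a::covector. - (a (axis 1 1) *\<^sub>R axis 1 1) + a (axis 2 1) *\<^sub>R axis 2 1 +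
      a (axis 3 1) *\<^sub>R axis 3 1 :: real^3)"
    by (intro bounded_linear_add bounded_linear_minus bounded_linear_scaleR_const blinfun.bounded_linear_left)
  moreover have "- (a (axis 1 1) *\<^sub>R axis 1 1) + a (axis 2 1) *\<^sub>R axis 2 1 + a (axis 3 1) *\<^sub>R axis 3 1 =
      (vector [- a (axis 1 1), a (axis 2 1), a (axis 3 1)] :: real^3)" for a :: covector
    by (simp add: vec_eq_iff forall_3 axis_def)
  ultimately have "bounded_linear (\<lambda>a::covector. vector [- a (axis 1 1), a (axis 2 1), a (axis 3 1)] :: real^3)"
    by simp
  from C2_map_bounded_linear[OF this C2_alpha]
  have 1: "C2_map (xi_hat \<alpha>)" by (simp add: xi_hat_eq[symmetric])
  have 2: "C2_map (\<lambda>p. xi_hat \<alpha> p $ 1)"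
    by (rule C2_map_bounded_linear[OF bounded_linear_vec_nth 1])
  from C2_map_scaleR[OF C2_map_inverse[OF 2 xi_hat_1] 1]
  show ?thesis by (simp add: xi_eq[symmetric])
qed

lemma C2_F1: "C2_map (\<lambda>p. F p $ 1)"
  by (rule C2_map_bounded_linear[OF bounded_linear_vec_nth C2_F])

lemma C2_sigma: "C2_map \<sigma>"
  unfolding \<sigma>_def[abs_def] by (intro C2_map_diff C2_F C2_map_scaleR C2_F1 C2_xi)

lemma dF_X: "c \<in> A \<Longrightarrow> p \<in> dom_of c \<Longrightarrow> differential c F p (X c p) = \<xi> p"
  using field unfolding E_normalized_null_field_def by blast

section \<open>Integral curves and their images\<close>

lemma F_deriv:
  assumes "integral_curve A X UNIV \<gamma>"
  shows "((F \<circ> \<gamma>) has_vector_derivative \<xi> (\<gamma> t)) (at t)"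
proof -
  obtain c where c: "c \<in> A" "\<gamma> t \<in> dom_of c" by (rule ex_chart)
  show ?thesis using has_vector_derivative_integral_curve[OF assms C2_F c] dF_X[OF c] by simp
qed

text \<open>The image of \<gamma> lies on a line with some direction v. The part \<open>w\<close> of
  the velocity that is Euclidean orthogonal to v has constant product with F along \<gamma>, hence
  vanishes; the time component 1 then fixes the multiple of v.\<close>

lemma xi_const:
  assumes "integral_curve A X UNIV \<gamma>"
  shows "\<xi> (\<gamma> t) = \<xi> (\<gamma> s)"
proof -
  obtain q v where qv: "light_like v" "range (F \<circ> \<gamma>) \<subseteq> range (\<lambda>s. q + s *\<^sub>R v)"
    using field assms unfolding E_normalized_null_field_def light_like_line_def
    by (metis image_comp)
  then have "v \<noteq> 0" by (auto simp: light_like_def)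
  have "\<exists>k. \<xi> (\<gamma> t) = k *\<^sub>R v" for t
  proof -
    define w where "w = \<xi> (\<gamma> t) - (\<xi> (\<gamma> t) \<bullet> v / (v \<bullet> v)) *\<^sub>R v"
    have wv: "w \<bullet> v = 0" using \<open>v \<noteq> 0\<close> by (simp add: w_def inner_diff_left)
    have "w \<bullet> F (\<gamma> u) = w \<bullet> q" for u
    proof -
      from qv(2) obtain s where "F (\<gamma> u) = q + s *\<^sub>R v" by (auto simp: image_subset_iff)
      then show ?thesis using wv by (simp add: inner_add_right)
    qed
    moreover have "((\<lambda>u. w \<bullet> F (\<gamma> u)) has_vector_derivative w \<bullet> \<xi> (\<gamma> t)) (at t)"
      using bounded_linear.has_vector_derivative[OF bounded_linear_inner_right F_deriv[OF assms]]
      by (simp add: o_def)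
    ultimately have "w \<bullet> \<xi> (\<gamma> t) = 0"
      using vector_derivative_at[of "\<lambda>u. w \<bullet> q" "w \<bullet> \<xi> (\<gamma> t)" t] by simp
    then have "w \<bullet> w = 0" using wv unfolding w_def by (simp add: inner_diff_right)
    then show ?thesis unfolding w_def by auto
  qed
  then obtain k where k: "\<And>t. \<xi> (\<gamma> t) = k t *\<^sub>R v" by metis
  have "k t * v $ 1 = 1" for t using xi_1[of "\<gamma> t"] k[of t] by simp
  then have "k t = k s" by (metis mult_cancel_right mult_zero_right zero_neq_one)
  with k show ?thesis by simp
qed

lemma F_line:
  assumes "integral_curve A X UNIV \<gamma>"
  shows "F (\<gamma> t) = F (\<gamma> s) + (t - s) *\<^sub>R \<xi> (\<gamma> s)"
proof -
  have "((\<lambda>t. F (\<gamma> t) - t *\<^sub>R \<xi> (\<gamma> s)) has_vector_derivative 0) (at u within UNIV)" for u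
    using F_deriv[OF assms, of u] xi_const[OF assms, of u s]
    by (auto intro!: derivative_eq_intros simp: o_def)
  then obtain K where K: "\<And>u. F (\<gamma> u) - u *\<^sub>R \<xi> (\<gamma> s) = K"
    using has_vector_derivative_zero_constant[of UNIV "\<lambda>t. F (\<gamma> t) - t *\<^sub>R \<xi> (\<gamma> s)"] by auto
  from K[of t] K[of s] have "F (\<gamma> t) - t *\<^sub>R \<xi> (\<gamma> s) = F (\<gamma> s) - s *\<^sub>R \<xi> (\<gamma> s)" by simp
  then show ?thesis by (simp add: algebra_simps)
qed

lemma F1_line:
  assumes "integral_curve A X UNIV \<gamma>"
  shows "F (\<gamma> t) $ 1 = F (\<gamma> s) $ 1 + (t - s)"
  using F_line[OF assms, of t s] by (simp add: xi_1)

lemma sigma_const: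
  assumes "integral_curve A X UNIV \<gamma>"
  shows "\<sigma> (\<gamma> t) = \<sigma> (\<gamma> s)"
  by (simp add: \<sigma>_def F_line[OF assms, of t s] xi_const[OF assms, of t s] xi_1 algebra_simps)

lemma differential_X_eq_0:
  assumes Q: "C2_map Q" and "\<And>\<gamma> t s. integral_curve A X UNIV \<gamma> \<Longrightarrow> Q (\<gamma> t) = Q (\<gamma> s)"
    and c: "c \<in> A" "p \<in> dom_of c"
  shows "differential c Q p (X c p) = 0"
proof -
  obtain \<gamma> t where \<gamma>: "integral_curve A X UNIV \<gamma>" "p = \<gamma> t" using curve[of p] by blast
  have "((Q \<circ> \<gamma>) has_vector_derivative differential c Q p (X c p)) (at t)"
    using has_vector_derivative_integral_curve[OF \<gamma>(1) Q c(1)] c(2) \<gamma>(2) by simp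
  moreover have "Q \<circ> \<gamma> = (\<lambda>_. Q p)" using assms(2)[OF \<gamma>(1)] \<gamma>(2) by auto
  ultimately show ?thesis using vector_derivative_at[of "\<lambda>_. Q p" _ t] by auto
qed

lemmas dxi_X = differential_X_eq_0[OF C2_xi xi_const]
lemmas dsigma_X = differential_X_eq_0[OF C2_sigma sigma_const]

section \<open>The differentials of \<sigma> and \<xi>\<close>

lemma lorentz_dF:
  assumes "c \<in> A" "p \<in> dom_of c"
  shows "lorentz (\<xi> p) (differential c F p v) = 0"
proof -
  have "lorentz (xi_hat \<alpha> p) (differential c F p v) = 0"
    using front assms unfolding null_wave_front_def wave_front_def xi_hat by blast
  moreover have "lorentz (k *\<^sub>R u) w = k * lorentz u w" for k u w
    by (simp add: lorentz_def algebra_simps)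
  ultimately show ?thesis by (subst xi_eq) simp
qed

text \<open>Rearranged, d\<sigma> + t d\<xi> = dF - dt \<xi>. This is dF projected along \<xi> to
  the plane t = 0, and it vanishes exactly when the image of dF lies in the line spanned by
  \<xi>.\<close>

lemma dsigma_eq:
  assumes "c \<in> A" "p \<in> dom_of c"
  shows "differential c \<sigma> p v =
    differential c F p v - differential c F p v $ 1 *\<^sub>R \<xi> p - F p $ 1 *\<^sub>R differential c \<xi> p v"
proof -
  let ?x = "coord c p"
  note F' = C2_map_has_differential[OF C2_F assms, unfolded o_def]
  note x' = C2_map_has_differential[OF C2_xi assms, unfolded o_def]
  note F1' = bounded_linear.has_derivative[OF bounded_linear_vec_nth[of 1] F']
  have "((\<lambda>x. F (param c x) - F (param c x) $ 1 *\<^sub>R \<xi> (param c x)) has_derivative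
     (\<lambda>v. differential c F p v - (F (param c ?x) $ 1 *\<^sub>R differential c \<xi> p v + differential c F p v $ 1 *\<^sub>R \<xi> (param c ?x)))) (at ?x)"
    by (intro has_derivative_diff F' has_derivative_scaleR F1' x')
  then show ?thesis
    by (subst differential_unique[of \<sigma>]) (auto simp: o_def \<sigma>_def[abs_def] chart(5)[OF assms] algebra_simps)
qed

lemma differential_linear:
  assumes "C2_map Q" "c \<in> A" "p \<in> dom_of c"
  shows "linear (differential c Q p)"
  using has_derivative_linear[OF C2_map_has_differential[OF assms]] .

lemma dxi_orth:
  assumes "c \<in> A" "p \<in> dom_of c"
  shows "differential c \<xi> p v $ 1 = 0" "\<xi> p $ 2 * differential c \<xi> p v $ 2 + \<xi> p $ 3 * differential c \<xi> p v $ 3 = 0"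
proof -
  let ?x = "coord c p"
  note x' = C2_map_has_differential[OF C2_xi assms, unfolded o_def]
  have i: "((\<lambda>x. \<xi> (param c x) $ i) has_derivative (\<lambda>v. differential c \<xi> p v $ i)) (at ?x)" for i
    by (rule bounded_linear.has_derivative[OF bounded_linear_vec_nth x'])
  have "((\<lambda>x. 1) has_derivative (\<lambda>v. differential c \<xi> p v $ 1)) (at ?x)"
    using i[of 1] by (simp add: xi_1)
  from has_derivative_unique[OF this has_derivative_const] show "differential c \<xi> p v $ 1 = 0"
    by metis
  have "((\<lambda>x. \<xi> (param c x) $ 2 * \<xi> (param c x) $ 2 + \<xi> (param c x) $ 3 * \<xi> (param c x) $ 3) has_derivative
    (\<lambda>v. (\<xi> (param c ?x) $ 2 * differential c \<xi> p v $ 2 + differential c \<xi> p v $ 2 * \<xi> (param c ?x) $ 2) +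
      (\<xi> (param c ?x) $ 3 * differential c \<xi> p v $ 3 + differential c \<xi> p v $ 3 * \<xi> (param c ?x) $ 3))) (at ?x)"
    by (intro has_derivative_add has_derivative_mult i)
  then have "((\<lambda>x. 1) has_derivative
    (\<lambda>v. (\<xi> p $ 2 * differential c \<xi> p v $ 2 + differential c \<xi> p v $ 2 * \<xi> p $ 2) +
      (\<xi> p $ 3 * differential c \<xi> p v $ 3 + differential c \<xi> p v $ 3 * \<xi> p $ 3))) (at ?x)"
    by (simp add: xi_circle[unfolded power2_eq_square] chart(5)[OF assms])
  from fun_cong[OF has_derivative_unique[OF this has_derivative_const], of v]
  show "\<xi> p $ 2 * differential c \<xi> p v $ 2 + \<xi> p $ 3 * differential c \<xi> p v $ 3 = 0"
    by algebra
qed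

text \<open>The front condition in terms of \<xi>: in the affine chart belonging to the time axis
  the projective class of \<alpha> is represented by the covector -\<open>lorentz (\<xi> q)\<close>,
  so (F, \<xi>) is an immersion along with (F, [\<alpha>]).\<close>

lemma front_kernel:
  assumes c: "c \<in> A" "p \<in> dom_of c" and v: "differential c F p v = 0" "differential c \<xi> p v = 0"
  shows "v = 0"
proof -
  define \<beta> where "\<beta> q = inverse (\<alpha> q (axis 1 1)) *\<^sub>R \<alpha> q" for q
  have a1: "\<alpha> q (axis 1 1) \<noteq> 0" for q
    using xi_hat_1[of q] by (simp add: xi_hat_eq)
  have "C2_map (\<lambda>q. \<alpha> q (axis 1 1))"
    by (rule C2_map_bounded_linear[OF _ C2_alpha]) (rule blinfun.bounded_linear_left)
  then have "C2_map \<beta>" unfolding \<beta>_def[abs_def] by (intro C2_map_scaleR C2_map_inverse C2_alpha a1)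
  note b' = C2_map_has_differential[OF this c, unfolded o_def]
  note F' = C2_map_has_differential[OF C2_F c, unfolded o_def]
  note x' = C2_map_has_differential[OF C2_xi c, unfolded o_def]
  have beta: "\<beta> q y = - lorentz (\<xi> q) y" for q y
    unfolding \<beta>_def xi_eq lorentz_def blinfun.scaleR_left
    by (subst xi_hat[symmetric, where x = y], simp add: xi_hat_eq lorentz_def algebra_simps)
  have "differential c \<beta> p v y = 0" for y
  proof -
    have 1: "((\<lambda>x. \<beta> (param c x) y) has_derivative (\<lambda>v. differential c \<beta> p v y)) (at (coord c p))"
      by (rule bounded_linear.has_derivative[OF blinfun.bounded_linear_left b'])
    have "linear (\<lambda>u. - lorentz u y)"
      by (rule linearI) (simp_all add: lorentz_def algebra_simps)
    then have "bounded_linear (\<lambda>u. - lorentz u y)" by (simp add: linear_conv_bounded_linear)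
    from bounded_linear.has_derivative[OF this x'] 
    have 2: "((\<lambda>x. \<beta> (param c x) y) has_derivative (\<lambda>v. - lorentz (differential c \<xi> p v) y)) (at (coord c p))"
      by (simp add: beta)
    from has_derivative_unique[OF 1 2] have "differential c \<beta> p v y = - lorentz (differential c \<xi> p v) y"
      by metis
    then show ?thesis by (simp add: v lorentz_def)
  qed
  then have "differential c \<beta> p v = 0" by (simp add: blinfun_eqI)
  moreover have "differential c (\<lambda>q. (F q, \<beta> q)) p = (\<lambda>v. (differential c F p v, differential c \<beta> p v))"
    by (rule differential_unique) (use has_derivative_Pair[OF F' b'] in \<open>simp add: o_def\<close>)
  moreover have "immersion_at A (\<lambda>q. (F q, affine_chart (axis 1 1) (proj (\<alpha> q)))) p"
    using front a1 unfolding null_wave_front_def wave_front_def by blast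
  then have "immersion_at A (\<lambda>q. (F q, \<beta> q)) p"
    by (simp add: affine_chart_proj[OF a1] \<beta>_def[abs_def] inverse_eq_divide)
  then have "inj (differential c (\<lambda>q. (F q, \<beta> q)) p)"
    using c unfolding immersion_at_def by blast
  ultimately have "differential c (\<lambda>q. (F q, \<beta> q)) p v = differential c (\<lambda>q. (F q, \<beta> q)) p 0"
    using v(1) differential_linear[OF C2_F c] differential_linear[OF \<open>C2_map \<beta>\<close> c]
    by (simp add: linear_0)
  with \<open>inj _\<close> show ?thesis by (simp add: inj_eq)
qed

end

section \<open>Singular points and flow boxes\<close>

definition perp :: "real^2 \<Rightarrow> real^2" where "perp v = vector [- v $ 2, v $ 1]"

lemma plane_decomposition:
  fixes u v :: "real^2"
  assumes "u \<noteq> 0"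
  shows "\<exists>a b. v = a *\<^sub>R u + b *\<^sub>R perp u"
proof -
  define n where "n = (u $ 1)\<^sup>2 + (u $ 2)\<^sup>2"
  have "n \<noteq> 0" using assms by (auto simp: n_def vec_eq_iff forall_2 sum_power2_eq_zero_iff)
  have "v = ((u $ 1 * v $ 1 + u $ 2 * v $ 2) / n) *\<^sub>R u + ((u $ 1 * v $ 2 - u $ 2 * v $ 1) / n) *\<^sub>R perp u"
    using \<open>n \<noteq> 0\<close>
    by (simp add: vec_eq_iff forall_2 perp_def field_simps) (simp add: n_def power2_eq_square algebra_simps)
  then show ?thesis by blast
qed

lemma perp_not_multiple: "u \<noteq> 0 \<Longrightarrow> perp u \<noteq> k *\<^sub>R u"
proof
  assume "u \<noteq> 0" "perp u = k *\<^sub>R u"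
  then have *: "- u $ 2 = k * u $ 1" "u $ 1 = k * u $ 2"
    by (simp_all add: perp_def vec_eq_iff forall_2)
  then have "(u $ 1)\<^sup>2 + (u $ 2)\<^sup>2 = 0" by algebra
  with \<open>u \<noteq> 0\<close> show False by (simp add: vec_eq_iff forall_2 sum_power2_eq_zero_iff)
qed

context null_front begin

section \<open>Singular points in terms of d\<sigma> and d\<xi>\<close>

lemma X_nonzero:
  assumes "c \<in> A" "p \<in> dom_of c"
  shows "X c p \<noteq> 0"
  using dF_X[OF assms] linear_0[OF differential_linear[OF C2_F assms]] xi_1[of p] by auto


text \<open>Since dF(X) = \<xi> is non-zero, dF has rank at least one, and it fails to be injective
  iff its image is spanned by \<xi>; the factor is read off from the time component. A singular
  point is one where injectivity fails in some chart, hence \<open>*\<close> is proved for an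
  arbitrary chart \<open>e\<close>.\<close>

lemma singular_iff:
  assumes c: "c \<in> A" "p \<in> dom_of c"
  shows "p \<in> singular_set A F \<longleftrightarrow> (\<forall>v. differential c F p v = differential c F p v $ 1 *\<^sub>R \<xi> p)"
proof -
  have lin: "linear (differential e F p)" if "e \<in> A" "p \<in> dom_of e" for e
    using differential_linear[OF C2_F that] .
  have *: "differential e F p v = differential e F p v $ 1 *\<^sub>R \<xi> p"
    if e: "e \<in> A" "p \<in> dom_of e" and ninj: "\<not> inj (differential e F p)" for e v
  proof -
    obtain w where w: "w \<noteq> 0" "differential e F p w = 0"
      using ninj linear_injective_0[OF lin[OF e]] by blast
    obtain a b where ab: "w = a *\<^sub>R X e p + b *\<^sub>R perp (X e p)"
      using plane_decomposition[OF X_nonzero[OF e]] by blast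
    have Dw: "a *\<^sub>R \<xi> p + b *\<^sub>R differential e F p (perp (X e p)) = 0"
      using w(2) unfolding ab by (simp add: linear_add[OF lin[OF e]] linear_scale[OF lin[OF e]] dF_X[OF e])
    have "b \<noteq> 0"
    proof
      assume "b = 0"
      with Dw have "a *\<^sub>R \<xi> p = 0" by simp
      then have "a = 0" using xi_1[of p] by auto
      with \<open>b = 0\<close> ab w(1) show False by simp
    qed
    have bD: "b *\<^sub>R differential e F p (perp (X e p)) = (- a) *\<^sub>R \<xi> p"
      using Dw by (simp add: eq_neg_iff_add_eq_0 add.commute)
    have "differential e F p (perp (X e p)) = inverse b *\<^sub>R (b *\<^sub>R differential e F p (perp (X e p)))"
      using \<open>b \<noteq> 0\<close> by simp
    then have perp: "differential e F p (perp (X e p)) = (- a / b) *\<^sub>R \<xi> p"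
      unfolding bD by (simp add: divide_inverse mult.commute)
    obtain a' b' where "v = a' *\<^sub>R X e p + b' *\<^sub>R perp (X e p)"
      using plane_decomposition[OF X_nonzero[OF e]] by blast
    then have "differential e F p v = (a' + b' * (- a / b)) *\<^sub>R \<xi> p"
      by (simp add: linear_add[OF lin[OF e]] linear_scale[OF lin[OF e]] dF_X[OF e] perp algebra_simps)
    then show ?thesis by (simp add: xi_1)
  qed
  show ?thesis
  proof
    assume "p \<in> singular_set A F"
    then obtain d where d: "d \<in> A" "p \<in> dom_of d" "\<not> inj (differential d F p)"
      unfolding singular_set_def immersion_at_def by blast
    have "differential c F p v = differential d F p (differential c (coord d) p v)" for v
      by (rule differential_change_chart[OF C2_F d(1,2) c])
    then show "\<forall>v. differential c F p v = differential c F p v $ 1 *\<^sub>R \<xi> p"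
      using *[OF d] by metis
  next
    assume rhs: "\<forall>v. differential c F p v = differential c F p v $ 1 *\<^sub>R \<xi> p"
    define k where "k = differential c F p (perp (X c p)) $ 1"
    have "differential c F p (perp (X c p) - k *\<^sub>R X c p) = 0"
      using rhs[rule_format, of "perp (X c p)"]
      by (simp add: linear_diff[OF lin[OF c]] linear_scale[OF lin[OF c]] dF_X[OF c] k_def)
    moreover have "perp (X c p) - k *\<^sub>R X c p \<noteq> 0"
      using perp_not_multiple[OF X_nonzero[OF c]] by simp
    ultimately have "\<not> inj (differential c F p)"
      using linear_injective_0[OF lin[OF c]] by blast
    with c show "p \<in> singular_set A F" unfolding singular_set_def immersion_at_def by blast
  qed
qed

lemma singular_iff_dsigma:
  assumes c: "c \<in> A" "p \<in> dom_of c"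
  shows "p \<in> singular_set A F \<longleftrightarrow> (\<forall>v. differential c \<sigma> p v + F p $ 1 *\<^sub>R differential c \<xi> p v = 0)"
  unfolding singular_iff[OF c] dsigma_eq[OF c] by (auto simp: algebra_simps)

text \<open>Together with \<open>dxi_orth\<close> this puts all values of d\<sigma> and d\<xi> on
  one line, spanned by the rotated spatial part of \<xi>. Hence wherever d\<xi> is non-zero, a
  single number u solves d\<sigma> + u d\<xi> = 0.\<close>

lemma dsigma_orth:
  assumes c: "c \<in> A" "p \<in> dom_of c"
  shows "differential c \<sigma> p v $ 1 = 0" "\<xi> p $ 2 * differential c \<sigma> p v $ 2 + \<xi> p $ 3 * differential c \<sigma> p v $ 3 = 0"
proof -
  show "differential c \<sigma> p v $ 1 = 0" by (simp add: dsigma_eq[OF c] xi_1 dxi_orth[OF c])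
  show "\<xi> p $ 2 * differential c \<sigma> p v $ 2 + \<xi> p $ 3 * differential c \<sigma> p v $ 3 = 0"
    using lorentz_dF[OF c, of v] dxi_orth(2)[OF c, of v] xi_circle[of p] xi_1[of p]
    unfolding dsigma_eq[OF c] lorentz_def vector_minus_component vector_scaleR_component real_scaleR_def
    by algebra
qed

text \<open>The pair (\<sigma>, \<xi>) is an immersion transversally to the lines. Otherwise dF
  would send the transversal vector to a multiple k of \<xi>, and subtracting k X would give a
  non-zero vector in the kernel excluded by \<open>front_kernel\<close>.\<close>

lemma dsigma_dxi_nonzero:
  assumes c: "c \<in> A" "p \<in> dom_of c"
  shows "differential c \<sigma> p (perp (X c p)) \<noteq> 0 \<or> differential c \<xi> p (perp (X c p)) \<noteq> 0"
proof (rule ccontr)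
  assume "\<not> ?thesis"
  then have s: "differential c \<sigma> p (perp (X c p)) = 0" and x: "differential c \<xi> p (perp (X c p)) = 0" by auto
  define k where "k = differential c F p (perp (X c p)) $ 1"
  note lF = differential_linear[OF C2_F c] and lx = differential_linear[OF C2_xi c]
  have "differential c F p (perp (X c p) - k *\<^sub>R X c p) = 0"
    using s x unfolding dsigma_eq[OF c] by (simp add: linear_diff[OF lF] linear_scale[OF lF] dF_X[OF c] k_def)
  moreover have "differential c \<xi> p (perp (X c p) - k *\<^sub>R X c p) = 0"
    using x by (simp add: linear_diff[OF lx] linear_scale[OF lx] dxi_X[OF _ c])
  ultimately have "perp (X c p) - k *\<^sub>R X c p = 0" by (rule front_kernel[OF c])
  then show False using perp_not_multiple[OF X_nonzero[OF c], of k] by simp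
qed

section \<open>Flow boxes from the inverse function theorem\<close>

lemma C2_map_continuous:
  assumes "C2_map Q"
  shows "continuous_on UNIV Q"
  unfolding continuous_on_eq_continuous_at[OF open_UNIV]
proof
  fix p
  obtain c where c: "c \<in> A" "p \<in> dom_of c" by (rule ex_chart)
  have "continuous_on (dom_of c) (\<lambda>q. (Q \<circ> param c) (coord c q))"
  proof (rule continuous_on_compose2[OF _ chart(3)[OF c(1)]])
    show "continuous_on (cod_of c) (Q \<circ> param c)"
      using C2_map_differentiable[OF assms c(1), unfolded o_def] unfolding o_def
      by (auto intro!: continuous_at_imp_continuous_on differentiable_imp_continuous_within)
  qed auto
  then have "continuous_on (dom_of c) Q"
    by (rule continuous_on_eq) (simp add: chart(5)[OF c(1)])
  then show "isCont Q p"
    using c chart(1)[OF c(1)] by (simp add: continuous_on_eq_continuous_at)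
qed

text \<open>Coordinates \<open>(y, F $ 1)\<close> with inverse \<open>g\<close>, for a function \<open>y\<close> constant along \<open>X\<close>. The last clause says
  that for a map constant along \<open>X\<close> criticality propagates along the integral curves.\<close>

definition flow_box :: "'m chart \<Rightarrow> ('m \<Rightarrow> real) \<Rightarrow> 'm \<Rightarrow> real \<Rightarrow> 'm set \<Rightarrow> (real \<Rightarrow> real \<Rightarrow> 'm) \<Rightarrow> bool" where
  "flow_box c y p e N g \<longleftrightarrow> e > 0 \<and> open N \<and> p \<in> N \<and> N \<subseteq> dom_of c \<and>
     (\<forall>q\<in>N. \<bar>y q - y p\<bar> < e \<and> \<bar>F q $ 1 - F p $ 1\<bar> < e \<and> g (y q) (F q $ 1) = q) \<and>
     (\<forall>a b. \<bar>a - y p\<bar> < e \<longrightarrow> \<bar>b - F p $ 1\<bar> < e \<longrightarrow> g a b \<in> N \<and> y (g a b) = a \<and> F (g a b) $ 1 = b) \<and>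
     (\<forall>a b t. a differentiable (at t) \<longrightarrow> b differentiable (at t) \<longrightarrow> \<bar>a t - y p\<bar> < e \<longrightarrow> \<bar>b t - F p $ 1\<bar> < e \<longrightarrow>
        (\<lambda>t. coord c (g (a t) (b t))) differentiable (at (t::real))) \<and>
     (\<forall>(Q::'m \<Rightarrow> real^3) a b b'. C2_map Q \<longrightarrow> (\<forall>q\<in>dom_of c. differential c Q q (X c q) = 0) \<longrightarrow>
        \<bar>a - y p\<bar> < e \<longrightarrow> \<bar>b - F p $ 1\<bar> < e \<longrightarrow> \<bar>b' - F p $ 1\<bar> < e \<longrightarrow>
        (\<forall>v. differential c Q (g a b) v = 0) \<longrightarrow> (\<forall>v. differential c Q (g a b') v = 0))"

lemma flow_boxD:
  assumes "flow_box c y p e N g"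
  shows "e > 0" "open N" "p \<in> N" "N \<subseteq> dom_of c"
    and "q \<in> N \<Longrightarrow> \<bar>y q - y p\<bar> < e" "q \<in> N \<Longrightarrow> \<bar>F q $ 1 - F p $ 1\<bar> < e" "q \<in> N \<Longrightarrow> g (y q) (F q $ 1) = q"
    and "\<bar>a - y p\<bar> < e \<Longrightarrow> \<bar>b - F p $ 1\<bar> < e \<Longrightarrow> g a b \<in> N \<and> y (g a b) = a \<and> F (g a b) $ 1 = b"
  using assms unfolding flow_box_def by blast+

lemma flow_box_differentiable:
  assumes "flow_box c y p e N g" "a differentiable (at t)" "b differentiable (at t)"
    "\<bar>a t - y p\<bar> < e" "\<bar>b t - F p $ 1\<bar> < e"
  shows "(\<lambda>t. coord c (g (a t) (b t))) differentiable (at (t::real))"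
  using assms unfolding flow_box_def by blast

lemma flow_box_critical:
  fixes Q :: "'m \<Rightarrow> real^3"
  assumes "flow_box c y p e N g" "C2_map Q" "\<And>q. q \<in> dom_of c \<Longrightarrow> differential c Q q (X c q) = 0"
    "\<bar>a - y p\<bar> < e" "\<bar>b - F p $ 1\<bar> < e" "\<bar>b' - F p $ 1\<bar> < e"
    "\<And>v. differential c Q (g a b) v = 0"
  shows "differential c Q (g a b') v = 0"
  using assms unfolding flow_box_def by blast

text \<open>Inverse function theorem for (y, t) in the chart. Its derivative sends X to the second
  basis vector, because y is constant along X and dt(X) = 1, and it sends the transversal vector to
  one with non-zero first component.\<close>

lemma ex_flow_box:
  fixes y :: "'m \<Rightarrow> real"
  assumes y: "C2_map y" and y_X: "\<And>q. q \<in> dom_of c \<Longrightarrow> differential c y q (X c q) = 0"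
    and c: "c \<in> A" "p \<in> dom_of c" and dy: "differential c y p (perp (X c p)) \<noteq> 0"
    and W: "open W" "p \<in> W"
  obtains e N g where "flow_box c y p e N g" "N \<subseteq> W"
proof -
  define e1 e2 :: "real^2" where "e1 = axis 1 1" and "e2 = axis 2 1"
  have e12 [simp]: "e1 $ 1 = 1" "e1 $ 2 = 0" "e2 $ 1 = 0" "e2 $ 2 = 1" by (simp_all add: e1_def e2_def axis_def)
  have split: "z = z $ 1 *\<^sub>R e1 + z $ 2 *\<^sub>R e2" for z by (simp add: vec_eq_iff forall_2)
  define x0 where "x0 = coord c p"
  have x0: "x0 \<in> cod_of c" using c by (simp add: x0_def)
  define \<Psi> where "\<Psi> x = y (param c x) *\<^sub>R e1 + F (param c x) $ 1 *\<^sub>R e2" for x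
  define D where "D x v = differential c y (param c x) v *\<^sub>R e1 + differential c F (param c x) v $ 1 *\<^sub>R e2" for x v
  define f' where "f' x = Blinfun (D x)" for x
  define U where "U = param c -` W \<inter> cod_of c"
  have openU: "open U"
    using chart[OF c(1)] W(1) unfolding U_def by (meson continuous_on_open_vimage)
  have x0U: "x0 \<in> U" using W(2) c chart(5)[OF c] x0 by (simp add: U_def x0_def)
  have D: "(\<Psi> has_derivative D x) (at x)" if "x \<in> cod_of c" for x
  proof -
    have q: "param c x \<in> dom_of c" "coord c (param c x) = x" using chart(6,7)[OF c(1) that] by auto
    have 1: "((\<lambda>x. y (param c x)) has_derivative differential c y (param c x)) (at x)"
      using C2_map_has_differential[OF y c(1) q(1)] by (simp add: o_def q(2))
    have 2: "((\<lambda>x. F (param c x) $ 1) has_derivative (\<lambda>v. differential c F (param c x) v $ 1)) (at x)"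
      using bounded_linear.has_derivative[OF bounded_linear_vec_nth C2_map_has_differential[OF C2_F c(1) q(1)]]
      by (simp add: o_def q(2))
    show ?thesis
      unfolding \<Psi>_def[abs_def] D_def[abs_def]
      by (intro has_derivative_add has_derivative_scaleR_left 1 2)
  qed
  have blD: "bounded_linear (D x)" if "x \<in> cod_of c" for x
    using D[OF that] by (rule has_derivative_bounded_linear)
  then have f': "blinfun_apply (f' x) = D x" if "x \<in> cod_of c" for x
    using that by (simp add: f'_def bounded_linear_Blinfun_apply)
  have contf': "continuous_on U f'"
  proof (rule continuous_on_blinfun_componentwise)
    fix i :: "real^2" assume "i \<in> Basis"
    have cont: "continuous_on U (\<lambda>x. differential c Q (param c x) i)" if "C2_map Q" for Q :: "'m \<Rightarrow> 'b::real_normed_vector"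
    proof -
      have *: "differential c Q (param c x) i = frechet_derivative (Q \<circ> param c) (at x) i" if "x \<in> U" for x
        using that chart(6)[OF c(1)] by (simp add: differential_def U_def)
      have "(\<lambda>x. frechet_derivative (Q \<circ> param c) (at x) i) differentiable (at x)" if "x \<in> U" for x
        using that \<open>C2_map Q\<close> c chart(2)[OF c(1)] unfolding C2_map_def U_def
        by (intro C2_on_frechet_differentiable[of _ "cod_of c"]) auto
      then have "continuous_on U (\<lambda>x. frechet_derivative (Q \<circ> param c) (at x) i)"
        by (auto intro!: continuous_at_imp_continuous_on differentiable_imp_continuous_within)
      then show ?thesis by (rule continuous_on_eq) (simp add: *)
    qed
    have "continuous_on U (\<lambda>x. D x i)"
      unfolding D_def by (intro continuous_intros cont y C2_F)
    then show "continuous_on U (\<lambda>x. blinfun_apply (f' x) i)"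
      by (rule continuous_on_eq) (simp add: f' U_def)
  qed
  have D_X: "D x (X c (param c x)) = e2" if "x \<in> cod_of c" for x
    using chart(7)[OF c(1) that] by (simp add: D_def y_X dF_X[OF c(1)] xi_1)
  have lin0: "linear (D x0)" using blD[OF x0] by (rule bounded_linear.linear)
  have px0: "param c x0 = p" using chart(5)[OF c] by (simp add: x0_def)
  have "inj (D x0)"
    unfolding linear_injective_0[OF lin0]
  proof (intro allI impI)
    fix v assume v: "D x0 v = 0"
    obtain a b where ab: "v = a *\<^sub>R X c p + b *\<^sub>R perp (X c p)"
      using plane_decomposition[OF X_nonzero[OF c]] by blast
    have "D x0 v = a *\<^sub>R e2 + b *\<^sub>R D x0 (perp (X c p))"
      using D_X[OF x0] unfolding ab px0 by (simp add: linear_add[OF lin0] linear_scale[OF lin0])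
    with v have *: "a *\<^sub>R e2 + b *\<^sub>R D x0 (perp (X c p)) = 0" by simp
    have "D x0 (perp (X c p)) $ 1 \<noteq> 0" using dy by (simp add: D_def px0)
    moreover have "b * D x0 (perp (X c p)) $ 1 = 0" using arg_cong[OF *, of "\<lambda>z. z $ 1"] by simp
    ultimately have "b = 0" by simp
    moreover from this * have "a = 0" by (metis e12(4) add_0_right scaleR_zero_left mult_cancel_left2 real_scaleR_def vector_scaleR_component zero_index)
    ultimately show "v = 0" using ab by simp
  qed
  then obtain L where L: "linear L" "L \<circ> D x0 = id"
    using linear_injective_left_inverse[OF lin0] by blast
  have "Blinfun L o\<^sub>L f' x0 = id_blinfun"
    using L(2) by (intro blinfun_eqI) (simp add: f'[OF x0] bounded_linear_Blinfun_apply L(1) linear_conv_bounded_linear[THEN iffD1] fun_eq_iff)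
  then obtain U' V G G' where U': "open U'" "U' \<subseteq> U" "x0 \<in> U'" and V: "open V" "\<Psi> x0 \<in> V" and hom: "homeomorphism U' V \<Psi> G"
    and G': "\<And>z. z \<in> V \<Longrightarrow> (G has_derivative (G' z)) (at z)"
    and G'_inv: "\<And>z. z \<in> V \<Longrightarrow> G' z = inv (blinfun_apply (f' (G z)))"
    and bij: "\<And>z. z \<in> V \<Longrightarrow> bij (blinfun_apply (f' (G z)))"
    using inverse_function_theorem[OF openU _ contf' x0U, of \<Psi> "Blinfun L"] D f'
    by (metis (no_types, lifting) IntD2 U_def)
  have Vcod: "G z \<in> U'" "G z \<in> cod_of c" "G z \<in> U" if "z \<in> V" for z
    using that hom U' unfolding homeomorphism_def U_def by auto
  have \<Psi>G: "\<Psi> (G z) = z" if "z \<in> V" for z using that hom unfolding homeomorphism_def by auto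
  obtain r where r: "r > 0" "ball (\<Psi> x0) r \<subseteq> V" using V open_contains_ball by blast
  \<comment> \<open>Half the radius, so that the square of half-width e fits into the ball by the l1
    bound on the norm.\<close>
  define e where "e = r / 2"
  have e: "e > 0" using r by (simp add: e_def)
  have box: "a *\<^sub>R e1 + b *\<^sub>R e2 \<in> V" if "\<bar>a - y p\<bar> < e" "\<bar>b - F p $ 1\<bar> < e" for a b
  proof -
    have "norm (\<Psi> x0 - (a *\<^sub>R e1 + b *\<^sub>R e2)) \<le> \<bar>y p - a\<bar> + \<bar>F p $ 1 - b\<bar>"
      using norm_le_l1_cart[of "\<Psi> x0 - (a *\<^sub>R e1 + b *\<^sub>R e2)"] by (simp add: \<Psi>_def px0 sum_2)
    also have "\<dots> < r" using that by (simp add: e_def abs_minus_commute)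
    finally show ?thesis using r(2) by (auto simp: dist_norm)
  qed
  \<comment> \<open>Cutting down to the square makes N correspond exactly to the coordinate square,
    so that \<open>g\<close> maps back into N.\<close>
  define N where "N = (coord c -` U' \<inter> dom_of c) \<inter> ({q. \<bar>y q - y p\<bar> < e} \<inter> {q. \<bar>F q $ 1 - F p $ 1\<bar> < e})"
  define g where "g a b = param c (G (a *\<^sub>R e1 + b *\<^sub>R e2))" for a b
  have N_open: "open N"
  proof -
    have 1: "open (coord c -` U' \<inter> dom_of c)"
      using chart[OF c(1)] U'(1) by (meson continuous_on_open_vimage)
    have 2: "open {q. \<bar>y q - y p\<bar> < e}"
      by (intro open_Collect_less continuous_intros C2_map_continuous[OF y])
    have 3: "open {q. \<bar>F q $ 1 - F p $ 1\<bar> < e}"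
      by (intro open_Collect_less continuous_intros C2_map_continuous[OF C2_F])
    show ?thesis unfolding N_def by (rule open_Int[OF 1 open_Int[OF 2 3]])
  qed
  have pN: "p \<in> N" using U'(3) c e by (simp add: N_def x0_def)
  have N_sub: "N \<subseteq> W \<inter> dom_of c"
    using U'(2) chart(5)[OF c(1)] by (auto simp: N_def U_def)
  have N1: "\<bar>y q - y p\<bar> < e \<and> \<bar>F q $ 1 - F p $ 1\<bar> < e \<and> g (y q) (F q $ 1) = q" if "q \<in> N" for q
  proof -
    have q: "coord c q \<in> U'" "q \<in> dom_of c" using that by (auto simp: N_def)
    then have "G (\<Psi> (coord c q)) = coord c q" using hom by (auto simp: homeomorphism_def)
    then have "g (y q) (F q $ 1) = q" using chart(5)[OF c(1) q(2)] by (simp add: g_def \<Psi>_def)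
    with that show ?thesis by (simp add: N_def)
  qed
  have N2: "g a b \<in> N \<and> y (g a b) = a \<and> F (g a b) $ 1 = b" if "\<bar>a - y p\<bar> < e" "\<bar>b - F p $ 1\<bar> < e" for a b
  proof -
    note v = box[OF that]
    have *: "y (g a b) *\<^sub>R e1 + F (g a b) $ 1 *\<^sub>R e2 = a *\<^sub>R e1 + b *\<^sub>R e2"
      using \<Psi>G[OF v] by (simp add: \<Psi>_def g_def)
    have "y (g a b) = a" "F (g a b) $ 1 = b"
      using arg_cong[OF *, of "\<lambda>z. z $ 1"] arg_cong[OF *, of "\<lambda>z. z $ 2"] by simp_all
    moreover have "coord c (g a b) \<in> U'" "g a b \<in> dom_of c"
      using Vcod[OF v] chart(6,7)[OF c(1)] by (simp_all add: g_def)
    ultimately show ?thesis using that by (simp add: N_def)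
  qed
  have N3: "(\<lambda>t. coord c (g (a t) (b t))) differentiable (at t)"
    if ab: "a differentiable (at t)" "b differentiable (at t)" and close: "\<bar>a t - y p\<bar> < e" "\<bar>b t - F p $ 1\<bar> < e" for a b and t :: real
  proof -
    define z where "z t = a t *\<^sub>R e1 + b t *\<^sub>R e2" for t
    have z: "z differentiable (at t)" unfolding z_def[abs_def] using ab by (intro differentiable_add differentiable_scaleR) auto
    have zV: "z t \<in> V" using box[OF close] by (simp add: z_def)
    have 1: "(\<lambda>t. G (z t)) differentiable (at t)"
      using differentiable_chain_at[OF z, of G] G'[OF zV] by (auto simp: o_def differentiable_def)
    have "isCont z t" using z by (rule differentiable_imp_continuous_within)
    then have "\<forall>\<^sub>F s in nhds t. z s \<in> V"
      using V(1) zV by (metis (mono_tags) eventually_nhds_conv_at continuous_at topological_tendstoD)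
    then obtain T where T: "open T" "t \<in> T" "\<And>s. s \<in> T \<Longrightarrow> z s \<in> V" unfolding eventually_nhds by blast
    obtain DD where "((\<lambda>t. G (z t)) has_derivative DD) (at t)" using 1 unfolding differentiable_def by blast
    then have "((\<lambda>t. coord c (g (a t) (b t))) has_derivative DD) (at t)"
      by (rule has_derivative_transform_within_open[OF _ T(1,2)])
        (use T(3) Vcod chart(6)[OF c(1)] in \<open>auto simp: g_def z_def\<close>)
    then show ?thesis unfolding differentiable_def by blast
  qed
  \<comment> \<open>Second derivatives of Q are avoided: Q in the coordinates (a, b) does not depend
    on b, so its a-derivative does not either, while its b-derivative is zero everywhere.\<close>
  have N4: "differential c Q (g a b') v = 0"
    if Q: "C2_map Q" and Q_X: "\<And>q. q \<in> dom_of c \<Longrightarrow> differential c Q q (X c q) = 0"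
      and a: "\<bar>a - y p\<bar> < e" and b: "\<bar>b - F p $ 1\<bar> < e" and b': "\<bar>b' - F p $ 1\<bar> < e"
      and crit: "\<And>v. differential c Q (g a b) v = 0" for Q :: "'m \<Rightarrow> real^3" and a b b' v
  proof -
    define E where "E a b = Q (g a b)" for a b
    have G'D: "G' z (D (G z) v) = v" if "z \<in> V" for z v
      using G'_inv[OF that] bij[OF that] f'[OF Vcod(2)[OF that]] by (simp add: bij_is_inj)
    have G'e2: "G' z e2 = X c (param c (G z))" if "z \<in> V" for z
      using G'D[OF that] D_X[OF Vcod(2)[OF that]] by metis
    have EQ: "((\<lambda>z. Q (param c (G z))) has_derivative (\<lambda>v. differential c Q (param c (G z)) (G' z v))) (at z)" if "z \<in> V" for z
      using diff_chain_at[OF G'[OF that], of "Q \<circ> param c" "differential c Q (param c (G z))"]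
        C2_map_has_differential[OF Q c(1) chart(7)[OF c(1) Vcod(2)[OF that]]]
        chart(6)[OF c(1) Vcod(2)[OF that]] by (simp add: o_def)
    have lQ: "linear (differential c Q (g a b))" if "\<bar>a - y p\<bar> < e" "\<bar>b - F p $ 1\<bar> < e" for a b
      using N2[OF that] N_sub by (intro differential_linear[OF Q c(1)]) auto
    have lG': "linear (G' z)" if "z \<in> V" for z using G'[OF that] by (rule has_derivative_linear)
    have Ea: "((\<lambda>a. E a b) has_vector_derivative differential c Q (g a b) (G' (a *\<^sub>R e1 + b *\<^sub>R e2) e1)) (at a)"
      if "\<bar>a - y p\<bar> < e" "\<bar>b - F p $ 1\<bar> < e" for a b
    proof -
      have "((\<lambda>a. a *\<^sub>R e1 + b *\<^sub>R e2) has_derivative (\<lambda>h. h *\<^sub>R e1)) (at a)"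
        by (auto intro!: derivative_eq_intros)
      from diff_chain_at[OF this EQ[OF box[OF that]]] show ?thesis
        unfolding has_vector_derivative_def
        by (simp add: o_def E_def g_def[symmetric] linear_scale[OF lG'[OF box[OF that]]] linear_scale[OF lQ[OF that]])
    qed
    have Eb: "((\<lambda>b. E a b) has_vector_derivative 0) (at b)"
      if "\<bar>a - y p\<bar> < e" "\<bar>b - F p $ 1\<bar> < e" for a b
    proof -
      have "((\<lambda>b. a *\<^sub>R e1 + b *\<^sub>R e2) has_derivative (\<lambda>h. h *\<^sub>R e2)) (at b)"
        by (auto intro!: derivative_eq_intros)
      from diff_chain_at[OF this EQ[OF box[OF that]]]
      have "((\<lambda>b. E a b) has_derivative (\<lambda>h. h *\<^sub>R differential c Q (g a b) (X c (g a b)))) (at b)"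
        by (simp add: o_def E_def g_def[symmetric] linear_scale[OF lG'[OF box[OF that]]] linear_scale[OF lQ[OF that]] G'e2[OF box[OF that]])
      moreover have "differential c Q (g a b) (X c (g a b)) = 0"
        using N2[OF that] N_sub by (intro Q_X) auto
      ultimately show ?thesis unfolding has_vector_derivative_def by simp
    qed
    have Econst: "E a b = E a b'" if a': "\<bar>a - y p\<bar> < e" for a
    proof -
      let ?I = "{F p $ 1 - e<..<F p $ 1 + e}"
      obtain K where "\<And>b. b \<in> ?I \<Longrightarrow> E a b = K"
        using has_vector_derivative_zero_constant[of ?I "E a"] Eb[OF a']
        by (auto simp: abs_less_iff has_vector_derivative_at_within)
      moreover have "b \<in> ?I" "b' \<in> ?I" using b b' by (auto simp: abs_less_iff)
      ultimately show ?thesis by metis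
    qed
    let ?J = "{y p - e<..<y p + e}"
    have "((\<lambda>a. E a b) has_vector_derivative 0) (at a)"
      using Ea[OF a b] crit by simp
    then have "((\<lambda>a. E a b') has_vector_derivative 0) (at a)"
      by (rule has_vector_derivative_transform_within_open[of _ _ _ ?J])
        (use Econst a in \<open>auto simp: abs_less_iff\<close>)
    then have 1: "differential c Q (g a b') (G' (a *\<^sub>R e1 + b' *\<^sub>R e2) e1) = 0"
      using Ea[OF a b'] by (metis vector_derivative_at)
    let ?z = "a *\<^sub>R e1 + b' *\<^sub>R e2"
    have 2: "differential c Q (g a b') (G' ?z e2) = 0"
      using N2[OF a b'] N_sub unfolding G'e2[OF box[OF a b']] g_def[symmetric] by (intro Q_X) auto
    have "v = G' ?z (D (G ?z) v $ 1 *\<^sub>R e1 + D (G ?z) v $ 2 *\<^sub>R e2)"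
      using G'D[OF box[OF a b']] split by metis
    also have "\<dots> = D (G ?z) v $ 1 *\<^sub>R G' ?z e1 + D (G ?z) v $ 2 *\<^sub>R G' ?z e2"
      by (simp add: linear_add[OF lG'[OF box[OF a b']]] linear_scale[OF lG'[OF box[OF a b']]])
    finally show ?thesis using 1 2 lQ[OF a b']
      by (metis (no_types, lifting) linear_add linear_scale scaleR_zero_right add_0)
  qed
  have "flow_box c y p e N g"
    unfolding flow_box_def
  proof (intro conjI allI impI ballI)
    fix Q :: "'m \<Rightarrow> real^3" and a b b' v
    assume *: "C2_map Q" "\<forall>q\<in>dom_of c. differential c Q q (X c q) = 0"
      "\<bar>a - y p\<bar> < e" "\<bar>b - F p $ 1\<bar> < e" "\<bar>b' - F p $ 1\<bar> < e" "\<forall>v. differential c Q (g a b) v = 0"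
    show "differential c Q (g a b') v = 0"
      by (rule N4[OF *(1) _ *(3-5)]) (use * in auto)
  qed (use e N_open pN N_sub N1 N2 N3 in auto)
  then show thesis using that N_sub by blast
qed

end

section \<open>The singular set as a curve\<close>

definition \<Xi> :: "real \<Rightarrow> real^3" where "\<Xi> \<theta> = vector [1, cos \<theta>, sin \<theta>]"

context null_front begin

section \<open>Uniqueness of integral curves and transport along them\<close>

lemma C2_map_add: "C2_map P \<Longrightarrow> C2_map Q \<Longrightarrow> C2_map (\<lambda>p. P p + Q p)"
  using C2_map_diff[of P "\<lambda>p. - Q p"] C2_map_bounded_linear[OF bounded_linear_minus[OF bounded_linear_ident], of Q]
  by simp

lemma differential_bounded_linear:
  assumes "bounded_linear L" "C2_map Q" "c \<in> A" "p \<in> dom_of c"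
  shows "differential c (\<lambda>q. L (Q q)) p v = L (differential c Q p v)"
  using differential_unique[of "\<lambda>q. L (Q q)" c "\<lambda>v. L (differential c Q p v)" p]
    bounded_linear.has_derivative[OF assms(1) C2_map_has_differential[OF assms(2-4)]]
  by (simp add: o_def)

lemma differential_add:
  assumes "C2_map P" "C2_map Q" "c \<in> A" "p \<in> dom_of c"
  shows "differential c (\<lambda>q. P q + Q q) p v = differential c P p v + differential c Q p v"
  using differential_unique[of "\<lambda>q. P q + Q q" c "\<lambda>v. differential c P p v + differential c Q p v" p]
    has_derivative_add[OF C2_map_has_differential[OF assms(1,3,4)] C2_map_has_differential[OF assms(2,3,4)]]
  by (simp add: o_def)

text \<open>\<sigma> + u \<xi> assigns to q the point at time u of the line through
  \<open>F q\<close>. It is constant along integral curves, and by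
  \<open>singular_iff_dsigma\<close> a point q at time u is singular iff this map is critical at
  q.\<close>

lemma C2_pencil: "C2_map (\<lambda>q. \<sigma> q + u *\<^sub>R \<xi> q)"
  by (intro C2_map_add C2_sigma C2_map_bounded_linear[OF bounded_linear_scaleR_right C2_xi])

lemma differential_pencil:
  assumes "c \<in> A" "p \<in> dom_of c"
  shows "differential c (\<lambda>q. \<sigma> q + u *\<^sub>R \<xi> q) p v = differential c \<sigma> p v + u *\<^sub>R differential c \<xi> p v"
  by (simp add: differential_add[OF C2_sigma C2_map_bounded_linear[OF bounded_linear_scaleR_right C2_xi] assms]
      differential_bounded_linear[OF bounded_linear_scaleR_right C2_xi assms])

lemma differential_pencil_X:
  assumes "c \<in> A" "p \<in> dom_of c"
  shows "differential c (\<lambda>q. \<sigma> q + u *\<^sub>R \<xi> q) p (X c p) = 0"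
  by (simp add: differential_pencil[OF assms] dsigma_X[OF _ assms] dxi_X[OF _ assms])

text \<open>Pairing \<sigma> and \<xi> with their own transversal derivatives at p makes the
  transversal derivative of y a sum of squares, positive by
  \<open>dsigma_dxi_nonzero\<close>.\<close>

lemma ex_transverse_function:
  assumes c: "c \<in> A" "p \<in> dom_of c"
  obtains y :: "'m \<Rightarrow> real" where "C2_map y"
    "\<And>\<gamma> t s. integral_curve A X UNIV \<gamma> \<Longrightarrow> y (\<gamma> t) = y (\<gamma> s)"
    "differential c y p (perp (X c p)) \<noteq> 0"
proof
  define u where "u = differential c \<sigma> p (perp (X c p))"
  define w where "w = differential c \<xi> p (perp (X c p))"
  let ?y = "\<lambda>q. \<sigma> q \<bullet> u + \<xi> q \<bullet> w"
  have 1: "C2_map (\<lambda>q. \<sigma> q \<bullet> u)" and 2: "C2_map (\<lambda>q. \<xi> q \<bullet> w)"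
    by (intro C2_map_bounded_linear[OF bounded_linear_inner_left] C2_sigma C2_xi)+
  show "C2_map ?y" by (intro C2_map_add 1 2)
  show "?y (\<gamma> t) = ?y (\<gamma> s)" if "integral_curve A X UNIV \<gamma>" for \<gamma> t s
    using sigma_const[OF that, of t s] xi_const[OF that, of t s] by simp
  have "differential c ?y p v = differential c \<sigma> p v \<bullet> u + differential c \<xi> p v \<bullet> w" for v
    by (simp add: differential_add[OF 1 2 c] differential_bounded_linear[OF bounded_linear_inner_left C2_sigma c]
        differential_bounded_linear[OF bounded_linear_inner_left C2_xi c])
  then have "differential c ?y p (perp (X c p)) = u \<bullet> u + w \<bullet> w" unfolding u_def w_def by blast
  moreover have "u \<noteq> 0 \<or> w \<noteq> 0" unfolding u_def w_def by (rule dsigma_dxi_nonzero[OF c])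
  then have "u \<bullet> u + w \<bullet> w > 0" by (auto intro: add_pos_nonneg add_nonneg_pos)
  ultimately show "differential c ?y p (perp (X c p)) \<noteq> 0" by simp
qed

lemma integral_curve_isCont: "integral_curve A X UNIV \<gamma> \<Longrightarrow> isCont \<gamma> t"
  unfolding integral_curve_def by (simp add: continuous_on_eq_continuous_at)

lemma isCont_neighbourhood:
  fixes \<gamma> :: "real \<Rightarrow> 'm"
  assumes "isCont \<gamma> t" "open N" "\<gamma> t \<in> N"
  shows "\<exists>T. open T \<and> t \<in> T \<and> (\<forall>s\<in>T. \<gamma> s \<in> N)"
  using assms by (metis continuous_at_open)

text \<open>In a flow box a point is determined by y, which is constant along both curves, and by t,
  which grows at the same rate on both. So agreement is an open condition; disagreement is open by
  the Hausdorff property, and the real line is connected.\<close>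

lemma integral_curve_unique:
  assumes \<gamma>: "integral_curve A X UNIV \<gamma>" "integral_curve A X UNIV \<gamma>'" and eq: "\<gamma> a = \<gamma>' b"
  shows "\<gamma> (a + t) = \<gamma>' (b + t)"
proof (rule connected_induction_simple[where S = UNIV and a = 0 and b = t and P = "\<lambda>t. \<gamma> (a + t) = \<gamma>' (b + t)"])
  have cont: "isCont (\<lambda>t. \<gamma> (a + t)) t" if "integral_curve A X UNIV \<gamma>" for \<gamma> a t
  proof -
    have "isCont (\<lambda>t. a + t) t" by (intro continuous_intros)
    from continuous_at_compose[OF this integral_curve_isCont[OF that]] show ?thesis by (simp add: o_def)
  qed
  fix t0
  have "\<exists>T. open T \<and> t0 \<in> T \<and> (\<forall>x\<in>T. \<forall>y\<in>T. \<gamma> (a + x) = \<gamma>' (b + x) \<longrightarrow> \<gamma> (a + y) = \<gamma>' (b + y))"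
  proof (cases "\<gamma> (a + t0) = \<gamma>' (b + t0)")
    case True
    define q where "q = \<gamma> (a + t0)"
    obtain c where c: "c \<in> A" "q \<in> dom_of c" by (rule ex_chart)
    obtain y :: "'m \<Rightarrow> real" where y: "C2_map y"
      and yc: "\<And>\<gamma> t s. integral_curve A X UNIV \<gamma> \<Longrightarrow> y (\<gamma> t) = y (\<gamma> s)"
      and dy: "differential c y q (perp (X c q)) \<noteq> 0"
      by (rule ex_transverse_function[OF c]) blast
    obtain e N g where fb: "flow_box c y q e N g"
      by (rule ex_flow_box[OF y differential_X_eq_0[OF y yc c(1)] c dy open_UNIV UNIV_I])
    note N = flow_boxD(2,3)[OF fb] and g = flow_boxD(7)[OF fb]
    obtain T1 where T1: "open T1" "t0 \<in> T1" "\<And>s. s \<in> T1 \<Longrightarrow> \<gamma> (a + s) \<in> N"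
      using isCont_neighbourhood[OF cont[OF \<gamma>(1)] N(1)] N(2)[unfolded q_def] by metis
    obtain T2 where T2: "open T2" "t0 \<in> T2" "\<And>s. s \<in> T2 \<Longrightarrow> \<gamma>' (b + s) \<in> N"
      using isCont_neighbourhood[OF cont[OF \<gamma>(2)] N(1)] N(2)[unfolded q_def True] by metis
    have "\<gamma> (a + s) = \<gamma>' (b + s)" if "s \<in> T1 \<inter> T2" for s
    proof -
      have "y (\<gamma> (a + s)) = y (\<gamma>' (b + s))" using yc \<gamma> True by metis
      moreover have "F (\<gamma> (a + s)) $ 1 = F (\<gamma>' (b + s)) $ 1"
        using F1_line[OF \<gamma>(1), of "a + s" "a + t0"] F1_line[OF \<gamma>(2), of "b + s" "b + t0"] True by simp
      ultimately show ?thesis using g T1(3) T2(3) that by (metis IntD1 IntD2)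
    qed
    then show ?thesis using T1 T2 by (intro exI[of _ "T1 \<inter> T2"]) auto
  next
    case False
    then obtain U V where UV: "open U" "open V" "\<gamma> (a + t0) \<in> U" "\<gamma>' (b + t0) \<in> V" "U \<inter> V = {}"
      using hausdorff[OF False] by metis
    obtain T1 where T1: "open T1" "t0 \<in> T1" "\<And>s. s \<in> T1 \<Longrightarrow> \<gamma> (a + s) \<in> U"
      using isCont_neighbourhood[OF cont[OF \<gamma>(1)] UV(1,3)] by metis
    obtain T2 where T2: "open T2" "t0 \<in> T2" "\<And>s. s \<in> T2 \<Longrightarrow> \<gamma>' (b + s) \<in> V"
      using isCont_neighbourhood[OF cont[OF \<gamma>(2)] UV(2,4)] by metis
    have "\<gamma> (a + x) \<noteq> \<gamma>' (b + x)" if "x \<in> T1 \<inter> T2" for x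
      using T1(3)[of x] T2(3)[of x] UV(5) that by auto
    then show ?thesis using T1 T2 by (intro exI[of _ "T1 \<inter> T2"]) auto
  qed
  then show "\<exists>T. openin (top_of_set UNIV) T \<and> t0 \<in> T \<and>
      (\<forall>x\<in>T. \<forall>y\<in>T. \<gamma> (a + x) = \<gamma>' (b + x) \<longrightarrow> \<gamma> (a + y) = \<gamma>' (b + y))" by simp
qed (use eq in auto)

text \<open>Within one flow box criticality passes between any two points of the curve by
  \<open>flow_box_critical\<close>; connectedness of the real line does the rest.
  \<open>crit\<close> asks for some chart because the curve may run through many of them.\<close>

lemma critical_transport:
  fixes u :: real
  defines "Q \<equiv> \<lambda>q. \<sigma> q + u *\<^sub>R \<xi> q"
  defines "crit \<equiv> \<lambda>q. \<exists>c\<in>A. q \<in> dom_of c \<and> (\<forall>v. differential c Q q v = 0)"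
  assumes \<gamma>: "integral_curve A X UNIV \<gamma>" and crit: "crit (\<gamma> s)"
  shows "crit (\<gamma> t)"
proof (rule connected_induction_simple[where S = UNIV and a = s and b = t and P = "\<lambda>t. crit (\<gamma> t)"])
  fix t0
  define q where "q = \<gamma> t0"
  have Q: "C2_map Q" unfolding Q_def by (rule C2_pencil)
  have crit_chart: "\<forall>v. differential c Q q v = 0" if "crit q" "c \<in> A" "q \<in> dom_of c" for q c
    using that differential_change_chart[OF Q] unfolding crit_def by metis
  obtain c where c: "c \<in> A" "q \<in> dom_of c" by (rule ex_chart)
  obtain y :: "'m \<Rightarrow> real" where y: "C2_map y"
    and yc: "\<And>\<gamma> t s. integral_curve A X UNIV \<gamma> \<Longrightarrow> y (\<gamma> t) = y (\<gamma> s)"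
    and dy: "differential c y q (perp (X c q)) \<noteq> 0"
    by (rule ex_transverse_function[OF c]) blast
  obtain e N g where fb: "flow_box c y q e N g"
    by (rule ex_flow_box[OF y differential_X_eq_0[OF y yc c(1)] c dy open_UNIV UNIV_I])
  note N = flow_boxD(2-4)[OF fb]
  obtain T where T: "open T" "t0 \<in> T" "\<And>s. s \<in> T \<Longrightarrow> \<gamma> s \<in> N"
    using isCont_neighbourhood[OF integral_curve_isCont[OF \<gamma>] N(1)] N(2)[unfolded q_def] by metis
  have "crit (\<gamma> w)" if "x \<in> T" "w \<in> T" "crit (\<gamma> x)" for x w
  proof -
    note gx = flow_boxD(5-7)[OF fb T(3)[OF that(1)]] and gw = flow_boxD(5-7)[OF fb T(3)[OF that(2)]]
    have yxw: "y (\<gamma> x) = y (\<gamma> w)" by (rule yc[OF \<gamma>])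
    have "\<And>v. differential c Q (\<gamma> x) v = 0"
      using crit_chart[OF that(3) c(1)] T(3)[OF that(1)] N(3) by blast
    then have "differential c Q (g (y (\<gamma> w)) (F (\<gamma> x) $ 1)) v = 0" for v
      using gx(3) yxw by simp
    then have "differential c Q (g (y (\<gamma> w)) (F (\<gamma> w) $ 1)) v = 0" for v
      by (rule flow_box_critical[OF fb Q, rotated 4])
        (use differential_pencil_X[OF c(1)] gx gw in \<open>auto simp: Q_def\<close>)
    then have "differential c Q (\<gamma> w) v = 0" for v using gw(3) by simp
    then show ?thesis unfolding crit_def using c(1) T(3)[OF that(2)] N(3) by blast
  qed
  with T show "\<exists>T. openin (top_of_set UNIV) T \<and> t0 \<in> T \<and> (\<forall>x\<in>T. \<forall>y\<in>T. crit (\<gamma> x) \<longrightarrow> crit (\<gamma> y))"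
    by auto
qed (use crit in auto)

text \<open>Transport brings the equation d\<sigma> + u d\<xi> = 0 of the first singular point to
  the second one, where it holds for its own time as well. Different times would force d\<xi> = 0
  and d\<sigma> = 0.\<close>

lemma singular_unique_on_curve:
  assumes \<gamma>: "integral_curve A X UNIV \<gamma>" and s: "\<gamma> s \<in> singular_set A F" and t: "\<gamma> t \<in> singular_set A F"
  shows "s = t"
proof -
  obtain d where d: "d \<in> A" "\<gamma> s \<in> dom_of d" by (rule ex_chart)
  let ?u = "F (\<gamma> s) $ 1"
  have "\<exists>c\<in>A. \<gamma> t \<in> dom_of c \<and> (\<forall>v. differential c (\<lambda>q. \<sigma> q + ?u *\<^sub>R \<xi> q) (\<gamma> t) v = 0)"
    by (rule critical_transport[OF \<gamma>, of s])
      (use d s singular_iff_dsigma[OF d] in \<open>auto simp: differential_pencil[OF d]\<close>)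
  then obtain c where c: "c \<in> A" "\<gamma> t \<in> dom_of c"
    and "\<And>v. differential c (\<lambda>q. \<sigma> q + ?u *\<^sub>R \<xi> q) (\<gamma> t) v = 0" by blast
  then have 1: "differential c \<sigma> (\<gamma> t) v + ?u *\<^sub>R differential c \<xi> (\<gamma> t) v = 0" for v
    using differential_pencil[OF c] by simp
  have 2: "differential c \<sigma> (\<gamma> t) v + F (\<gamma> t) $ 1 *\<^sub>R differential c \<xi> (\<gamma> t) v = 0" for v
    using t singular_iff_dsigma[OF c] by blast
  have "(F (\<gamma> t) $ 1 - ?u) *\<^sub>R differential c \<xi> (\<gamma> t) v = 0" for v
    using 1[of v] 2[of v] unfolding scaleR_diff_left by (metis add_left_cancel eq_iff_diff_eq_0)
  moreover have "differential c \<xi> (\<gamma> t) (perp (X c (\<gamma> t))) \<noteq> 0"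
    using dsigma_dxi_nonzero[OF c] 2[of "perp (X c (\<gamma> t))"] by auto
  ultimately have "F (\<gamma> t) $ 1 = ?u" by (metis eq_iff_diff_eq_0 scaleR_eq_0_iff)
  then show ?thesis using F1_line[OF \<gamma>, of t s] by simp
qed

text \<open>The radius \<delta>/2 in the last clause leaves room to move on from any singular point
  in N within the domain of the section. The bound \<delta> \<le> 1 keeps the angles involved so
  close that \<Xi> is injective on them.\<close>

definition section_at :: "real \<Rightarrow> 'm chart \<Rightarrow> 'm set \<Rightarrow> real \<Rightarrow> (real \<Rightarrow> 'm) \<Rightarrow> bool" where
  "section_at \<theta>0 c N \<delta> s \<longleftrightarrow> c \<in> A \<and> open N \<and> s \<theta>0 \<in> N \<and> 0 < \<delta> \<and> \<delta> \<le> 1 \<and>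
     (\<forall>\<theta>. \<bar>\<theta> - \<theta>0\<bar> < \<delta> \<longrightarrow> s \<theta> \<in> singular_set A F \<and> \<xi> (s \<theta>) = \<Xi> \<theta> \<and> s \<theta> \<in> dom_of c \<and>
        (\<lambda>\<theta>. coord c (s \<theta>)) differentiable (at \<theta>)) \<and>
     (\<forall>q\<in>N \<inter> singular_set A F. \<exists>\<theta>. \<bar>\<theta> - \<theta>0\<bar> < \<delta> / 2 \<and> q = s \<theta>)"

text \<open>At a singular point d\<xi> cannot vanish transversally, since d\<sigma> would vanish
  too. So a component y of \<xi> is a transversal coordinate, the singular set is a graph of t over
  y in a flow box, and y is the sine of the angle measured from \<theta>0.\<close>

lemma ex_section:
  assumes p: "p \<in> singular_set A F" and p\<theta>: "\<xi> p = \<Xi> \<theta>0"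
  obtains c N \<delta> s where "section_at \<theta>0 c N \<delta> s" "s \<theta>0 = p"
proof -
  obtain c where c: "c \<in> A" "p \<in> dom_of c" by (rule ex_chart)
  \<comment> \<open>\<open>e0\<close> is the derivative of \<Xi> at \<theta>0 and \<open>n0\<close>
    the spatial part of \<open>\<Xi> \<theta>0\<close>: pairing them with
    \<open>\<Xi> \<theta>\<close> gives the sine and the cosine of \<theta> - \<theta>0.\<close>
  define e0 :: "real^3" where "e0 = vector [0, - sin \<theta>0, cos \<theta>0]"
  define n0 :: "real^3" where "n0 = vector [0, cos \<theta>0, sin \<theta>0]"
  have inner3: "v \<bullet> w = v $ 1 * w $ 1 + v $ 2 * w $ 2 + v $ 3 * w $ 3" for v w :: "real^3"
    by (simp add: inner_vec_def sum_3)
  define y where "y q = \<xi> q \<bullet> e0" for q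
  have y: "C2_map y" unfolding y_def[abs_def] by (rule C2_map_bounded_linear[OF bounded_linear_inner_left C2_xi])
  have yc: "y (\<gamma> t) = y (\<gamma> s)" if "integral_curve A X UNIV \<gamma>" for \<gamma> t s
    using xi_const[OF that, of t s] by (simp add: y_def)
  have circ: "(cos \<theta>0)\<^sup>2 + (sin \<theta>0)\<^sup>2 = 1" by simp
  have dy: "differential c y p (perp (X c p)) \<noteq> 0"
  proof
    define w where "w = differential c \<xi> p (perp (X c p))"
    assume "differential c y p (perp (X c p)) = 0"
    then have "w \<bullet> e0 = 0"
      unfolding y_def[abs_def] w_def by (simp add: differential_bounded_linear[OF bounded_linear_inner_left C2_xi c])
    then have 1: "- sin \<theta>0 * w $ 2 + cos \<theta>0 * w $ 3 = 0" by (simp add: inner3 e0_def mult.commute)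
    have 2: "w $ 1 = 0" "cos \<theta>0 * w $ 2 + sin \<theta>0 * w $ 3 = 0"
      using dxi_orth[OF c, of "perp (X c p)"] by (simp_all add: w_def p\<theta> \<Xi>_def)
    have "w $ 2 = 0" "w $ 3 = 0" using 1 2 circ by algebra+
    then have "w = 0" using 2 by (simp add: vec_eq_iff forall_3)
    then have "differential c \<sigma> p (perp (X c p)) = 0"
      using p singular_iff_dsigma[OF c] by (metis w_def add.right_neutral scaleR_zero_right)
    with \<open>w = 0\<close> dsigma_dxi_nonzero[OF c] show False by (simp add: w_def)
  qed
  define b1 b2 :: "real^2" where "b1 = axis 1 1" and "b2 = axis 2 1"
  have split: "z = z $ 1 *\<^sub>R b1 + z $ 2 *\<^sub>R b2" for z by (simp add: vec_eq_iff forall_2 b1_def b2_def axis_def)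
  define dS where "dS x v = frechet_derivative (\<sigma> \<circ> param c) (at x) v" for x v
  define dX where "dX x v = frechet_derivative (\<xi> \<circ> param c) (at x) v" for x v
  have dS: "dS (coord c q) v = differential c \<sigma> q v" and dX: "dX (coord c q) v = differential c \<xi> q v" for q v
    by (simp_all add: dS_def dX_def differential_def)
  \<comment> \<open>\<nu> is the squared size of d\<xi>, which makes \<open>h\<close> the least
    squares solution u of d\<sigma> + u d\<xi> = 0: a quotient of differentiable functions.\<close>
  define \<nu> where "\<nu> x = dX x b1 \<bullet> dX x b1 + dX x b2 \<bullet> dX x b2" for x
  \<comment> \<open>\<open>h x\<close> is the only \<open>u\<close> for which $d\sigma + u\,d\xi$ vanishes at \<open>x\<close>, so the singular points are
    given by \<open>F $ 1 = h\<close>, and \<open>h\<close> is constant along the integral curves.\<close>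
  define h where "h x = - (dS x b1 \<bullet> dX x b1 + dS x b2 \<bullet> dX x b2) / \<nu> x" for x
  have dS_diff: "(\<lambda>x. dS x v) differentiable (at x)" and dX_diff: "(\<lambda>x. dX x v) differentiable (at x)"
    if "x \<in> cod_of c" for x v
    using that c C2_sigma C2_xi chart(2)[OF c(1)] unfolding dS_def dX_def C2_map_def
    by (auto intro!: C2_on_frechet_differentiable[of _ "cod_of c"])
  have inner_diff: "(\<lambda>x. f x \<bullet> g x) differentiable (at x)"
    if "f differentiable (at x)" "g differentiable (at x)" for f g :: "real^2 \<Rightarrow> real^3" and x
    using that unfolding differentiable_def by (blast intro: has_derivative_inner)
  have \<nu>_diff: "\<nu> differentiable (at x)" if "x \<in> cod_of c" for x
    unfolding \<nu>_def[abs_def] using that by (intro differentiable_add inner_diff dX_diff)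
  have h_diff: "h differentiable (at x)" if "x \<in> cod_of c" "\<nu> x \<noteq> 0" for x
    unfolding h_def[abs_def] using that
    by (intro differentiable_divide differentiable_minus differentiable_add inner_diff dX_diff dS_diff \<nu>_diff)
  \<comment> \<open>\<nu> > 0 makes \<open>h\<close> meaningful; the sign condition selects the half
    circle on which the sine determines the angle.\<close>
  define W where "W = (coord c -` (\<nu> -` {0<..} \<inter> cod_of c) \<inter> dom_of c) \<inter> {q. \<xi> q \<bullet> n0 > 0}"
  have openW: "open W"
  proof -
    have "continuous_on (cod_of c) \<nu>"
      by (intro continuous_at_imp_continuous_on ballI differentiable_imp_continuous_within \<nu>_diff)
    then have "open (\<nu> -` {0<..} \<inter> cod_of c)"
      by (rule continuous_on_open_vimage[OF chart(2)[OF c(1)], THEN iffD1, rule_format]) simp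
    then have "open (coord c -` (\<nu> -` {0<..} \<inter> cod_of c) \<inter> dom_of c)"
      by (rule continuous_on_open_vimage[OF chart(1)[OF c(1)], THEN iffD1, rule_format, OF chart(3)[OF c(1)]])
    moreover have "open {q. \<xi> q \<bullet> n0 > 0}"
      by (intro open_Collect_less continuous_intros C2_map_continuous[OF C2_xi])
    ultimately show ?thesis unfolding W_def by (rule open_Int)
  qed
  have dX0: "\<nu> (coord c q) > 0" if q: "q \<in> dom_of c" and "differential c \<xi> q v \<noteq> 0" for q v
  proof (rule ccontr)
    assume "\<not> ?thesis"
    moreover have "0 \<le> dX (coord c q) b \<bullet> dX (coord c q) b" for b by simp
    ultimately have "dX (coord c q) b1 \<bullet> dX (coord c q) b1 = 0" "dX (coord c q) b2 \<bullet> dX (coord c q) b2 = 0"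
      unfolding \<nu>_def by (metis add_nonneg_eq_0_iff add_nonneg_nonneg antisym_conv2 linorder_not_le)+
    then have "differential c \<xi> q b1 = 0" "differential c \<xi> q b2 = 0" by (simp_all add: dX)
    moreover have "differential c \<xi> q (v $ 1 *\<^sub>R b1 + v $ 2 *\<^sub>R b2) = v $ 1 *\<^sub>R differential c \<xi> q b1 + v $ 2 *\<^sub>R differential c \<xi> q b2"
      using differential_linear[OF C2_xi c(1) q] by (simp add: linear_add linear_scale)
    ultimately show False using that(2) unfolding split[of v, symmetric] by simp
  qed
  have dXpos: "\<exists>v. differential c \<xi> q v \<noteq> 0" if "\<nu> (coord c q) > 0" for q
    using that unfolding \<nu>_def dX by (metis add.right_neutral inner_zero_left less_irrefl)
  have pW: "p \<in> W"
  proof -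
    have "differential c \<xi> p (perp (X c p)) \<noteq> 0"
      using dy unfolding y_def[abs_def] by (auto simp: differential_bounded_linear[OF bounded_linear_inner_left C2_xi c])
    then have "\<nu> (coord c p) > 0" by (rule dX0[OF c(2)])
    moreover have "\<xi> p \<bullet> n0 = 1" using circ by (simp add: p\<theta> \<Xi>_def n0_def inner3 power2_eq_square)
    ultimately show ?thesis using c by (simp add: W_def)
  qed
  have W: "q \<in> dom_of c" "\<nu> (coord c q) > 0" "\<xi> q \<bullet> n0 > 0" if "q \<in> W" for q
    using that by (auto simp: W_def)
  \<comment> \<open>All values of d\<sigma> and d\<xi> are multiples of the unit vector
    \<open>e\<close>, and both vanish on X, so d\<sigma> = k d\<xi>. Hence the least squares
    solution -k is an exact one.\<close>
  have h: "differential c \<sigma> q v + h (coord c q) *\<^sub>R differential c \<xi> q v = 0" if "q \<in> W" for q v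
  proof -
    note q = W(1)[OF that]
    let ?w = "perp (X c q)"
    define e where "e = (vector [0, - \<xi> q $ 3, \<xi> q $ 2] :: real^3)"
    have par: "z = (z \<bullet> e) *\<^sub>R e" if "z $ 1 = 0" "\<xi> q $ 2 * z $ 2 + \<xi> q $ 3 * z $ 3 = 0" for z
    proof -
      have "z $ 2 = (z \<bullet> e) * - \<xi> q $ 3" "z $ 3 = (z \<bullet> e) * \<xi> q $ 2"
        using that xi_circle[of q] unfolding inner3 e_def vector_3 by algebra+
      then show ?thesis using that(1) by (simp add: vec_eq_iff forall_3 e_def)
    qed
    note lx = differential_linear[OF C2_xi c(1) q] and ls = differential_linear[OF C2_sigma c(1) q]
    have dec: "\<exists>b. differential c \<xi> q v = b *\<^sub>R differential c \<xi> q ?w \<and> differential c \<sigma> q v = b *\<^sub>R differential c \<sigma> q ?w" for v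
    proof -
      obtain a b where "v = a *\<^sub>R X c q + b *\<^sub>R ?w" using plane_decomposition[OF X_nonzero[OF c(1) q]] by blast
      then show ?thesis
        by (intro exI[of _ b]) (simp add: linear_add[OF lx] linear_scale[OF lx] linear_add[OF ls] linear_scale[OF ls]
            dxi_X[OF _ c(1) q] dsigma_X[OF _ c(1) q])
    qed
    have "differential c \<xi> q ?w \<noteq> 0" using dXpos[OF W(2)[OF that]] dec by (metis scaleR_zero_right)
    define k where "k = (differential c \<sigma> q ?w \<bullet> e) / (differential c \<xi> q ?w \<bullet> e)"
    have xe: "differential c \<xi> q ?w = (differential c \<xi> q ?w \<bullet> e) *\<^sub>R e"
      by (rule par) (use dxi_orth[OF c(1) q] in auto)
    then have xe0: "differential c \<xi> q ?w \<bullet> e \<noteq> 0" using \<open>differential c \<xi> q ?w \<noteq> 0\<close> by (metis scaleR_zero_left)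
    have "differential c \<sigma> q ?w = (differential c \<sigma> q ?w \<bullet> e) *\<^sub>R e"
      by (rule par) (use dsigma_orth[OF c(1) q] in auto)
    also have "\<dots> = (k * (differential c \<xi> q ?w \<bullet> e)) *\<^sub>R e" using xe0 by (simp add: k_def)
    also have "\<dots> = k *\<^sub>R ((differential c \<xi> q ?w \<bullet> e) *\<^sub>R e)" by simp
    finally have "differential c \<sigma> q ?w = k *\<^sub>R differential c \<xi> q ?w" using xe by metis
    then have k: "differential c \<sigma> q v = k *\<^sub>R differential c \<xi> q v" for v
      using dec[of v] by (metis scaleR_left_commute)
    have "dS (coord c q) b1 \<bullet> dX (coord c q) b1 + dS (coord c q) b2 \<bullet> dX (coord c q) b2 = k * \<nu> (coord c q)"
      by (simp add: dS k dX \<nu>_def distrib_left)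
    then have "h (coord c q) = - k" using W(2)[OF that] by (simp add: h_def)
    then show ?thesis by (simp add: k)
  qed
  have sing: "q \<in> singular_set A F \<longleftrightarrow> F q $ 1 = h (coord c q)" if "q \<in> W" for q
  proof -
    note q = W(1)[OF that]
    obtain v where v: "differential c \<xi> q v \<noteq> 0" using dXpos[OF W(2)[OF \<open>q \<in> W\<close>]] by blast
    have "F q $ 1 = h (coord c q)" if "differential c \<sigma> q v + F q $ 1 *\<^sub>R differential c \<xi> q v = 0"
      using that h[OF \<open>q \<in> W\<close>, of v] v by (metis add_left_cancel scaleR_cancel_right)
    then show ?thesis using h[OF that] unfolding singular_iff_dsigma[OF c(1) q] by metis
  qed
  obtain e N0 g where fb: "flow_box c y p e N0 g" and N0W: "N0 \<subseteq> W"
    by (rule ex_flow_box[OF y differential_X_eq_0[OF y yc c(1)] c dy openW pW])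
  note e = flow_boxD(1)[OF fb] and N0 = flow_boxD(2,3)[OF fb] and g1 = flow_boxD(5-7)[OF fb]
    and g2 = flow_boxD(8)[OF fb] and g3 = flow_box_differentiable[OF fb]
  have yp: "y p = 0" by (simp add: y_def p\<theta> \<Xi>_def e0_def inner3)
  define \<tau> where "\<tau> = F p $ 1"
  have h_const: "h (coord c (g a b)) = h (coord c (g a b'))"
    if "\<bar>a\<bar> < e" "\<bar>b - \<tau>\<bar> < e" "\<bar>b' - \<tau>\<bar> < e" for a b b'
  proof -
    let ?u = "h (coord c (g a b))"
    have "g a b \<in> W" "g a b' \<in> W" using g2[of a b] g2[of a b'] N0W that by (auto simp: yp \<tau>_def)
    note q = W(1)[OF this(1)] W(1)[OF this(2)]
    have "differential c (\<lambda>q. \<sigma> q + ?u *\<^sub>R \<xi> q) (g a b) v = 0" for v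
      using h[OF \<open>g a b \<in> W\<close>] by (simp add: differential_pencil[OF c(1) q(1)])
    then have "differential c (\<lambda>q. \<sigma> q + ?u *\<^sub>R \<xi> q) (g a b') v = 0" for v
      by (rule flow_box_critical[OF fb C2_pencil, rotated 4])
        (use that differential_pencil_X[OF c(1)] in \<open>auto simp: yp \<tau>_def\<close>)
    then have "differential c \<sigma> (g a b') v + ?u *\<^sub>R differential c \<xi> (g a b') v = 0" for v
      by (simp add: differential_pencil[OF c(1) q(2)])
    moreover obtain v where "differential c \<xi> (g a b') v \<noteq> 0" using dXpos[OF W(2)[OF \<open>g a b' \<in> W\<close>]] by blast
    ultimately show ?thesis using h[OF \<open>g a b' \<in> W\<close>, of v] by (metis add_left_cancel scaleR_cancel_right)
  qed
  \<comment> \<open>The time of the singular point on the line with angle \<theta>. By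
    \<open>h_const\<close> the height \<tau> at which \<open>h\<close> is evaluated does not matter
    inside the box.\<close>
  define T where "T \<theta> = h (coord c (g (sin (\<theta> - \<theta>0)) \<tau>))" for \<theta>
  have sin_diff: "(\<lambda>\<theta>. sin (\<theta> - \<theta>0)) differentiable (at \<theta>)" for \<theta>
  proof -
    have "((\<lambda>\<theta>. sin (\<theta> - \<theta>0)) has_real_derivative cos (\<theta> - \<theta>0)) (at \<theta>)"
      by (auto intro!: derivative_eq_intros)
    then show ?thesis by (auto simp: has_field_derivative_def differentiable_def)
  qed
  have sin_le: "\<bar>sin (\<theta> - \<theta>0)\<bar> < e" if "\<bar>\<theta> - \<theta>0\<bar> < e" for \<theta>
    using that abs_sin_x_le_abs_x[of "\<theta> - \<theta>0"] by linarith
  have T_diff: "T differentiable (at \<theta>)" if "\<bar>\<theta> - \<theta>0\<bar> < e" for \<theta>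
  proof -
    have 1: "(\<lambda>\<theta>. coord c (g (sin (\<theta> - \<theta>0)) \<tau>)) differentiable (at \<theta>)"
      by (rule g3[OF sin_diff]) (use sin_le[OF that] e in \<open>auto simp: yp \<tau>_def\<close>)
    have gW: "g (sin (\<theta> - \<theta>0)) \<tau> \<in> W" using g2[of "sin (\<theta> - \<theta>0)" \<tau>] sin_le[OF that] e N0W by (auto simp: yp \<tau>_def)
    then have "h differentiable (at (coord c (g (sin (\<theta> - \<theta>0)) \<tau>)))"
      using W(1,2)[OF gW] by (intro h_diff) auto
    with 1 show ?thesis using differentiable_chain_at[OF 1] by (simp add: T_def[abs_def] o_def)
  qed
  have T0: "T \<theta>0 = \<tau>"
  proof -
    have "g 0 \<tau> = p" using g1[OF N0(2)] by (simp add: yp \<tau>_def)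
    then show ?thesis using sing[OF pW] p by (simp add: T_def \<tau>_def)
  qed
  have "isCont T \<theta>0" using T_diff[of \<theta>0] e by (auto intro: differentiable_imp_continuous_within)
  then obtain d where d: "d > 0" "\<And>\<theta>. \<bar>\<theta> - \<theta>0\<bar> < d \<Longrightarrow> \<bar>T \<theta> - \<tau>\<bar> < e"
    using e unfolding continuous_at_eps_delta by (metis T0 dist_real_def)
  define \<delta> where "\<delta> = min (min d e) 1"
  have \<delta>: "0 < \<delta>" "\<delta> \<le> 1" "\<delta> \<le> d" "\<delta> \<le> e" using d e by (auto simp: \<delta>_def)
  define s where "s \<theta> = g (sin (\<theta> - \<theta>0)) (T \<theta>)" for \<theta>
  \<comment> \<open>With the bound sin(\<delta>/2) the arcsine of y lies within \<delta>/2.\<close>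
  define N where "N = N0 \<inter> {q. \<bar>y q\<bar> < sin (\<delta> / 2)}"
  have s0: "s \<theta>0 = p" using g1[OF N0(2)] T0 by (simp add: s_def yp \<tau>_def)
  have "section_at \<theta>0 c N \<delta> s"
    unfolding section_at_def
  proof (intro conjI c(1) allI impI ballI)
    have "sin (\<delta> / 2) > 0" using \<delta> pi_gt3 by (intro sin_gt_zero) auto
    then show "s \<theta>0 \<in> N" using N0 by (simp add: N_def yp s0)
    have "open {q. \<bar>y q\<bar> < sin (\<delta> / 2)}"
      by (intro open_Collect_less continuous_intros C2_map_continuous[OF y])
    then show "open N" unfolding N_def by (intro open_Int N0)
    show "0 < \<delta>" "\<delta> \<le> 1" by fact+
  next
    fix \<theta> assume \<theta>: "\<bar>\<theta> - \<theta>0\<bar> < \<delta>"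
    let ?a = "sin (\<theta> - \<theta>0)"
    have a: "\<bar>?a\<bar> < e" and T: "\<bar>T \<theta> - \<tau>\<bar> < e" using sin_le[of \<theta>] d(2)[of \<theta>] \<theta> \<delta> by auto
    have s: "s \<theta> \<in> N0" "y (s \<theta>) = ?a" "F (s \<theta>) $ 1 = T \<theta>"
      using g2[of ?a "T \<theta>"] a T by (auto simp: s_def yp \<tau>_def)
    have sW: "s \<theta> \<in> W" using s(1) N0W by auto
    have "T \<theta> = h (coord c (s \<theta>))" unfolding s_def
      by (subst T_def) (rule h_const, use a T e in auto)
    then have "s \<theta> \<in> singular_set A F" using sing[OF sW] s(3) by simp
    moreover have "\<xi> (s \<theta>) = \<Xi> \<theta>"
    proof -
      define m where "m = \<xi> (s \<theta>) \<bullet> n0"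
      have m: "cos \<theta>0 * \<xi> (s \<theta>) $ 2 + sin \<theta>0 * \<xi> (s \<theta>) $ 3 = m"
        by (simp add: m_def n0_def inner3 mult.commute)
      have l: "- sin \<theta>0 * \<xi> (s \<theta>) $ 2 + cos \<theta>0 * \<xi> (s \<theta>) $ 3 = ?a"
        using s(2) by (simp add: y_def e0_def inner3 mult.commute)
      have "m\<^sup>2 + ?a\<^sup>2 = 1"
        unfolding m[symmetric] l[symmetric] using xi_circle[of "s \<theta>"] circ by algebra
      then have "m\<^sup>2 = (cos (\<theta> - \<theta>0))\<^sup>2" by (simp add: cos_squared_eq)
      moreover have "cos (\<theta> - \<theta>0) > 0" using \<theta> \<delta> pi_gt3 by (intro cos_gt_zero_pi) auto
      moreover have "m > 0" using W(3)[OF sW] by (simp add: m_def)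
      ultimately have mcos: "m = cos (\<theta> - \<theta>0)" by (simp add: power2_eq_iff)
      have "\<xi> (s \<theta>) $ 2 = cos \<theta>0 * m - sin \<theta>0 * ?a" "\<xi> (s \<theta>) $ 3 = sin \<theta>0 * m + cos \<theta>0 * ?a"
        unfolding m[symmetric] l[symmetric] using circ by algebra+
      moreover have "cos \<theta> = cos (\<theta>0 + (\<theta> - \<theta>0))" "sin \<theta> = sin (\<theta>0 + (\<theta> - \<theta>0))" by simp_all
      ultimately have "\<xi> (s \<theta>) $ 2 = cos \<theta>" "\<xi> (s \<theta>) $ 3 = sin \<theta>"
        unfolding mcos cos_add sin_add by simp_all
      then show ?thesis by (simp add: vec_eq_iff forall_3 \<Xi>_def xi_1)
    qed
    moreover have "(\<lambda>\<theta>. coord c (s \<theta>)) differentiable (at \<theta>)"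
      unfolding s_def by (rule g3[OF sin_diff]) (use a T T_diff[of \<theta>] \<theta> \<delta> in \<open>auto simp: yp \<tau>_def\<close>)
    ultimately show "s \<theta> \<in> singular_set A F" "\<xi> (s \<theta>) = \<Xi> \<theta>" "s \<theta> \<in> dom_of c"
      "(\<lambda>\<theta>. coord c (s \<theta>)) differentiable (at \<theta>)" using W(1)[OF sW] by blast+
  next
    fix q assume "q \<in> N \<inter> singular_set A F"
    then have q: "q \<in> N" "q \<in> singular_set A F" by auto
    have qN0: "q \<in> N0" and yq: "\<bar>y q\<bar> < sin (\<delta> / 2)" using q(1) by (auto simp: N_def)
    have qW: "q \<in> W" using qN0 N0W by auto
    define \<beta> where "\<beta> = arcsin (y q)"
    have "\<bar>y q\<bar> \<le> 1" using yq sin_le_one[of "\<delta> / 2"] by linarith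
    then have \<beta>: "sin \<beta> = y q" "- pi / 2 \<le> \<beta>" "\<beta> \<le> pi / 2"
      unfolding \<beta>_def using arcsin[of "y q"] by auto
    have \<delta>pi: "\<delta> / 2 < pi / 2" using \<delta> pi_gt3 by simp
    have "\<beta> < \<delta> / 2"
    proof (rule ccontr)
      assume "\<not> ?thesis"
      then have "sin (\<delta> / 2) \<le> sin \<beta>" using \<beta> \<delta> by (intro sin_monotone_2pi_le) auto
      with yq \<beta> show False by simp
    qed
    moreover have "- (\<delta> / 2) < \<beta>"
    proof (rule ccontr)
      assume "\<not> ?thesis"
      then have "sin \<beta> \<le> sin (- (\<delta> / 2))" using \<beta> \<delta>pi \<delta>(1) pi_gt_zero by (intro sin_monotone_2pi_le) (linarith | simp)+
      with yq \<beta> show False by simp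
    qed
    ultimately have "\<bar>\<beta>\<bar> < \<delta> / 2" by (simp add: abs_less_iff)
    moreover have "q = s (\<theta>0 + \<beta>)"
    proof -
      note gq = g1[OF qN0]
      have "T (\<theta>0 + \<beta>) = h (coord c (g (y q) \<tau>))" by (simp add: T_def \<beta>)
      also have "\<dots> = h (coord c (g (y q) (F q $ 1)))" by (rule h_const) (use gq e in \<open>auto simp: yp \<tau>_def\<close>)
      also have "\<dots> = F q $ 1" using gq sing[OF qW] q(2) by simp
      finally show ?thesis using gq by (simp add: s_def \<beta>)
    qed
    ultimately show "\<exists>\<theta>. \<bar>\<theta> - \<theta>0\<bar> < \<delta> / 2 \<and> q = s \<theta>" by (intro exI[of _ "\<theta>0 + \<beta>"]) simp
  qed
  with s0 show thesis using that by blast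
qed

end

section \<open>The closed singular curve\<close>

lemma Xi_eq_iff: "\<Xi> a = \<Xi> b \<longleftrightarrow> (\<exists>n::int. a = b + 2 * pi * n)"
proof -
  have "\<Xi> a = \<Xi> b \<longleftrightarrow> sin a = sin b \<and> cos a = cos b"
    by (auto simp: \<Xi>_def vec_eq_iff forall_3)
  then show ?thesis by (simp add: sin_cos_eq_iff)
qed

lemma Xi_inj: "\<Xi> a = \<Xi> b \<Longrightarrow> \<bar>a - b\<bar> < 2 * pi \<Longrightarrow> a = b"
proof -
  assume "\<Xi> a = \<Xi> b" and less: "\<bar>a - b\<bar> < 2 * pi"
  then obtain n :: int where n: "a = b + 2 * pi * n" using Xi_eq_iff by blast
  with less have "2 * pi * \<bar>real_of_int n\<bar> < 2 * pi * 1" by (simp add: abs_mult)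
  then have "\<bar>real_of_int n\<bar> < 1" using mult_less_cancel_left_pos[of "2 * pi" "\<bar>real_of_int n\<bar>" 1] by simp
  then have "n = 0" by linarith
  with n show "a = b" by simp
qed

lemma Xi_period: "\<Xi> (\<theta> + 2 * pi * real n) = \<Xi> \<theta>"
  unfolding Xi_eq_iff by (intro exI[of _ "int n"]) simp

context null_front begin

abbreviation S :: "'m set" where "S \<equiv> singular_set A F"

text \<open>A lift of the angle through the map from the singular set to the circle given by
  \<xi>.\<close>

definition lift :: "real set \<Rightarrow> (real \<Rightarrow> 'm) \<Rightarrow> bool" where
  "lift J C \<longleftrightarrow> continuous_on J C \<and> (\<forall>\<theta>\<in>J. C \<theta> \<in> S \<and> \<xi> (C \<theta>) = \<Xi> \<theta>)"

lemma liftD: "lift J C \<Longrightarrow> continuous_on J C" "lift J C \<Longrightarrow> \<theta> \<in> J \<Longrightarrow> C \<theta> \<in> S" "lift J C \<Longrightarrow> \<theta> \<in> J \<Longrightarrow> \<xi> (C \<theta>) = \<Xi> \<theta>"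
  by (auto simp: lift_def)

lemma lift_subset: "lift J C \<Longrightarrow> K \<subseteq> J \<Longrightarrow> lift K C"
  by (auto simp: lift_def intro: continuous_on_subset)

lemma ex_angle: "\<exists>\<theta>. \<xi> p = \<Xi> \<theta>"
proof -
  obtain \<theta> where "\<xi> p $ 2 = cos \<theta>" "\<xi> p $ 3 = sin \<theta>"
    using sincos_total_2pi_le[OF xi_circle[of p]] by blast
  then show ?thesis by (intro exI[of _ \<theta>]) (simp add: \<Xi>_def vec_eq_iff forall_3 xi_1)
qed

lemma section_atD:
  assumes "section_at \<theta>0 c N \<delta> s"
  shows "c \<in> A" "open N" "s \<theta>0 \<in> N" "0 < \<delta>" "\<delta> \<le> 1"
    and "\<bar>\<theta> - \<theta>0\<bar> < \<delta> \<Longrightarrow> s \<theta> \<in> S" "\<bar>\<theta> - \<theta>0\<bar> < \<delta> \<Longrightarrow> \<xi> (s \<theta>) = \<Xi> \<theta>"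
    "\<bar>\<theta> - \<theta>0\<bar> < \<delta> \<Longrightarrow> s \<theta> \<in> dom_of c"
    "\<bar>\<theta> - \<theta>0\<bar> < \<delta> \<Longrightarrow> (\<lambda>\<theta>. coord c (s \<theta>)) differentiable (at \<theta>)"
    and "q \<in> N \<Longrightarrow> q \<in> S \<Longrightarrow> \<exists>\<theta>. \<bar>\<theta> - \<theta>0\<bar> < \<delta> / 2 \<and> q = s \<theta>"
  using assms unfolding section_at_def by blast+

lemma section_continuous:
  assumes "section_at \<theta>0 c N \<delta> s"
  shows "continuous_on {\<theta>0 - \<delta><..<\<theta>0 + \<delta>} s"
proof -
  note sec = section_atD[OF assms]
  let ?I = "{\<theta>0 - \<delta><..<\<theta>0 + \<delta>}"
  have I: "\<bar>\<theta> - \<theta>0\<bar> < \<delta>" if "\<theta> \<in> ?I" for \<theta> using that by (auto simp: abs_less_iff)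
  have "continuous_on ?I (\<lambda>\<theta>. coord c (s \<theta>))"
    by (intro continuous_at_imp_continuous_on ballI differentiable_imp_continuous_within sec(9) I)
  then have "continuous_on ?I (\<lambda>\<theta>. param c (coord c (s \<theta>)))"
    by (rule continuous_on_compose2[OF chart(4)[OF sec(1)]]) (use sec(8) I in auto)
  then show ?thesis
    by (rule continuous_on_eq) (use chart(5)[OF sec(1)] sec(8) I in auto)
qed

text \<open>By continuity C stays in N near \<theta>0, so its values are values of \<open>s\<close>.
  Comparing \<xi>, which determines nearby angles, shows that the parameters coincide.\<close>

lemma lift_eq_section:
  assumes C: "lift J C" "\<theta>0 \<in> J" and s: "section_at \<theta>0 c N \<delta> s" "s \<theta>0 = C \<theta>0"
  shows "\<exists>T. open T \<and> \<theta>0 \<in> T \<and> (\<forall>\<theta>\<in>J \<inter> T. C \<theta> = s \<theta>)"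
proof -
  note sec = section_atD[OF s(1)]
  obtain T where T: "open T" "\<theta>0 \<in> T" "\<And>\<theta>. \<theta> \<in> J \<Longrightarrow> \<theta> \<in> T \<Longrightarrow> C \<theta> \<in> N"
    using liftD(1)[OF C(1)] C(2) sec(2,3) s(2) unfolding continuous_on_topological by metis
  have "C \<theta> = s \<theta>" if h: "\<theta> \<in> J" "\<theta> \<in> T" "\<bar>\<theta> - \<theta>0\<bar> < \<delta> / 2" for \<theta>
  proof -
    obtain \<theta>' where \<theta>': "\<bar>\<theta>' - \<theta>0\<bar> < \<delta> / 2" "C \<theta> = s \<theta>'"
      using sec(10)[OF T(3)] liftD(2)[OF C(1)] h by blast
    then have "\<Xi> \<theta> = \<Xi> \<theta>'"
      using liftD(3)[OF C(1) h(1)] sec(7)[of \<theta>'] sec(4) by simp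
    then have "\<theta> = \<theta>'"
      by (rule Xi_inj) (use h \<theta>' sec(5) pi_gt3 in linarith)
    with \<theta>' show ?thesis by simp
  qed
  moreover have "open (T \<inter> {\<theta>. \<bar>\<theta> - \<theta>0\<bar> < \<delta> / 2})"
    by (intro open_Int T(1) open_Collect_less continuous_intros)
  ultimately show ?thesis
    using T(2) sec(4) by (intro exI[of _ "T \<inter> {\<theta>. \<bar>\<theta> - \<theta>0\<bar> < \<delta> / 2}"]) auto
qed

lemma lift_unique:
  assumes C: "lift J C" and D: "lift J D" and J: "connected J" "a \<in> J" "b \<in> J" and eq: "C a = D a"
  shows "C b = D b"
proof (rule connected_induction_simple[where S = J and a = a and b = b and P = "\<lambda>t. C t = D t"])
  fix t assume t: "t \<in> J"
  have "\<exists>T. open T \<and> t \<in> T \<and> (\<forall>x\<in>J \<inter> T. \<forall>y\<in>J \<inter> T. C x = D x \<longrightarrow> C y = D y)"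
  proof (cases "C t = D t")
    case True
    obtain c N \<delta> s where s: "section_at t c N \<delta> s" "s t = C t"
      by (rule ex_section[OF liftD(2,3)[OF C t]])
    obtain T1 where "open T1" "t \<in> T1" "\<forall>\<theta>\<in>J \<inter> T1. C \<theta> = s \<theta>"
      using lift_eq_section[OF C t s] by blast
    moreover obtain T2 where "open T2" "t \<in> T2" "\<forall>\<theta>\<in>J \<inter> T2. D \<theta> = s \<theta>"
      using lift_eq_section[OF D t s(1)] s(2) True by auto
    ultimately show ?thesis by (intro exI[of _ "T1 \<inter> T2"]) auto
  next
    case False
    then obtain U V where UV: "open U" "open V" "C t \<in> U" "D t \<in> V" "U \<inter> V = {}"
      using hausdorff[OF False] by metis
    obtain T1 where T1: "open T1" "t \<in> T1" "\<And>\<theta>. \<theta> \<in> J \<Longrightarrow> \<theta> \<in> T1 \<Longrightarrow> C \<theta> \<in> U"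
      using liftD(1)[OF C] t UV(1,3) unfolding continuous_on_topological by metis
    obtain T2 where T2: "open T2" "t \<in> T2" "\<And>\<theta>. \<theta> \<in> J \<Longrightarrow> \<theta> \<in> T2 \<Longrightarrow> D \<theta> \<in> V"
      using liftD(1)[OF D] t UV(2,4) unfolding continuous_on_topological by metis
    have "C x \<noteq> D x" if "x \<in> J" "x \<in> T1 \<inter> T2" for x
      using T1(3)[of x] T2(3)[of x] UV(5) that by auto
    then show ?thesis using T1 T2 by (intro exI[of _ "T1 \<inter> T2"]) auto
  qed
  then obtain T where "open T" "t \<in> T" "\<forall>x\<in>J \<inter> T. \<forall>y\<in>J \<inter> T. C x = D x \<longrightarrow> C y = D y" by blast
  then show "\<exists>T. openin (top_of_set J) T \<and> t \<in> T \<and> (\<forall>x\<in>T. \<forall>y\<in>T. C x = D x \<longrightarrow> C y = D y)"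
    using t by (intro exI[of _ "J \<inter> T"]) (auto simp: openin_open_Int)
qed (use J eq in auto)

text \<open>A Lebesgue number argument: finitely many of the neighbourhoods N cover the singular
  set, and the smallest of their radii serves everywhere.\<close>

lemma uniform_sections:
  assumes "compact S"
  obtains \<delta> where "\<delta> > 0"
    "\<And>p \<theta>. p \<in> S \<Longrightarrow> \<xi> p = \<Xi> \<theta> \<Longrightarrow> \<exists>s. s \<theta> = p \<and> lift {\<theta> - \<delta>..\<theta> + \<delta>} s"
proof -
  define ok where "ok N \<delta> \<longleftrightarrow> (\<forall>q\<in>N \<inter> S. \<forall>\<theta>. \<xi> q = \<Xi> \<theta> \<longrightarrow> (\<exists>s. s \<theta> = q \<and> lift {\<theta> - \<delta>..\<theta> + \<delta>} s))" for N \<delta>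
  have "\<exists>N \<delta>. open N \<and> p \<in> N \<and> \<delta> > 0 \<and> ok N \<delta>" if p: "p \<in> S" for p
  proof -
    obtain \<theta>0 where "\<xi> p = \<Xi> \<theta>0" using ex_angle by blast
    from ex_section[OF p this] obtain c N \<delta> s where s: "section_at \<theta>0 c N \<delta> s" "s \<theta>0 = p" .
    note sec = section_atD[OF s(1)]
    have "\<exists>s'. s' \<theta> = q \<and> lift {\<theta> - \<delta> / 4..\<theta> + \<delta> / 4} s'" if q: "q \<in> N" "q \<in> S" and \<theta>: "\<xi> q = \<Xi> \<theta>" for q \<theta>
    proof -
      obtain \<theta>1 where \<theta>1: "\<bar>\<theta>1 - \<theta>0\<bar> < \<delta> / 2" "q = s \<theta>1" using sec(10)[OF q] by blast
      then have "\<Xi> \<theta> = \<Xi> \<theta>1" using \<theta> sec(7)[of \<theta>1] sec(4) by simp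
      then obtain n :: int where n: "\<theta> = \<theta>1 + 2 * pi * n" using Xi_eq_iff by blast
      \<comment> \<open>The direction of q fixes its angle only modulo 2 pi, so the section is
        shifted. Starting within \<delta>/2 of its centre, a further \<delta>/4 stays inside its
        domain.\<close>
      let ?s = "\<lambda>t. s (t - 2 * pi * n)"
      have close: "\<bar>t - 2 * pi * n - \<theta>0\<bar> < \<delta>" if "t \<in> {\<theta> - \<delta> / 4..\<theta> + \<delta> / 4}" for t
        using that \<theta>1(1) sec(4) unfolding n atLeastAtMost_iff by linarith
      have "continuous_on {\<theta> - \<delta> / 4..\<theta> + \<delta> / 4} ?s"
      proof (rule continuous_on_compose2[OF section_continuous[OF s(1)]])
        show "(\<lambda>t. t - 2 * pi * n) ` {\<theta> - \<delta> / 4..\<theta> + \<delta> / 4} \<subseteq> {\<theta>0 - \<delta><..<\<theta>0 + \<delta>}"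
        proof (rule image_subsetI)
          fix t assume "t \<in> {\<theta> - \<delta> / 4..\<theta> + \<delta> / 4}"
          from close[OF this] show "t - 2 * pi * n \<in> {\<theta>0 - \<delta><..<\<theta>0 + \<delta>}" by (simp add: abs_less_iff)
        qed
      qed (intro continuous_intros)
      moreover have "?s t \<in> S" "\<xi> (?s t) = \<Xi> t" if "t \<in> {\<theta> - \<delta> / 4..\<theta> + \<delta> / 4}" for t
      proof -
        show "?s t \<in> S" using sec(6)[OF close[OF that]] .
        have "\<Xi> (t - 2 * pi * n) = \<Xi> t" unfolding Xi_eq_iff by (intro exI[of _ "- n"]) simp
        then show "\<xi> (?s t) = \<Xi> t" using sec(7)[OF close[OF that]] by simp
      qed
      ultimately have "lift {\<theta> - \<delta> / 4..\<theta> + \<delta> / 4} ?s" by (simp add: lift_def)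
      then show ?thesis using n \<theta>1(2) by (intro exI[of _ ?s]) simp
    qed
    then have "ok N (\<delta> / 4)" unfolding ok_def by blast
    then show ?thesis using sec(2,3,4) s(2) by (intro exI[of _ N] exI[of _ "\<delta> / 4"]) auto
  qed
  then obtain N \<delta> where N: "\<And>p. p \<in> S \<Longrightarrow> open (N p)" "\<And>p. p \<in> S \<Longrightarrow> p \<in> N p" "\<And>p. p \<in> S \<Longrightarrow> \<delta> p > (0::real)"
    and ok: "\<And>p. p \<in> S \<Longrightarrow> ok (N p) (\<delta> p)"
    by metis
  obtain D where D: "D \<subseteq> S" "finite D" "S \<subseteq> (\<Union>p\<in>D. N p)"
    using compactE_image[OF assms, of S N] N(1,2) by blast
  \<comment> \<open>The inserted 1 keeps \<open>Min\<close> meaningful when D is empty.\<close>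
  define \<delta>0 where "\<delta>0 = Min (insert 1 (\<delta> ` D))"
  have "\<delta>0 > 0" using D N(3) by (auto simp: \<delta>0_def)
  moreover have "\<exists>s. s \<theta> = p \<and> lift {\<theta> - \<delta>0..\<theta> + \<delta>0} s" if p: "p \<in> S" "\<xi> p = \<Xi> \<theta>" for p \<theta>
  proof -
    obtain d where d: "d \<in> D" "p \<in> N d" using D(3) p by blast
    then have "\<delta>0 \<le> \<delta> d" using D(2) by (auto simp: \<delta>0_def)
    moreover obtain s where "s \<theta> = p" "lift {\<theta> - \<delta> d..\<theta> + \<delta> d} s" using ok[of d] d D(1) p unfolding ok_def by blast
    ultimately show ?thesis by (intro exI[of _ s]) (auto intro: lift_subset)
  qed
  ultimately show thesis using that by blast
qed

section \<open>From local sections to a lift over the real line\<close>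

lemma lift_glue:
  assumes "lift {a..b} C" "lift {b..d} D" "C b = D b" "a \<le> b" "b \<le> d"
  shows "lift {a..d} (\<lambda>\<theta>. if \<theta> \<le> b then C \<theta> else D \<theta>)"
proof -
  have "continuous_on ({a..b} \<union> {b..d}) (\<lambda>\<theta>. if \<theta> \<le> b then C \<theta> else D \<theta>)"
    by (rule continuous_on_cases) (use assms in \<open>auto simp: lift_def\<close>)
  moreover have "{a..b} \<union> {b..d} = {a..d}" using assms(4,5) by auto
  ultimately show ?thesis using assms by (auto simp: lift_def)
qed

lemma lift_bounded_interval:
  assumes p: "p \<in> S" "\<xi> p = \<Xi> \<theta>0" and \<delta>: "\<delta> > 0"
    and ext: "\<And>p \<theta>. p \<in> S \<Longrightarrow> \<xi> p = \<Xi> \<theta> \<Longrightarrow> \<exists>s. s \<theta> = p \<and> lift {\<theta> - \<delta>..\<theta> + \<delta>} s"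
  shows "\<exists>C. C \<theta>0 = p \<and> lift {\<theta>0 - real n * \<delta>..\<theta>0 + real n * \<delta>} C"
proof (induction n)
  case 0
  show ?case using p by (intro exI[of _ "\<lambda>_. p"]) (auto simp: lift_def)
next
  case (Suc n)
  let ?a = "\<theta>0 - real n * \<delta>" and ?b = "\<theta>0 + real n * \<delta>"
  obtain C where C: "C \<theta>0 = p" "lift {?a..?b} C" using Suc by blast
  have ab: "?a \<le> \<theta>0" "\<theta>0 \<le> ?b" "?a \<le> ?b" using \<delta> by auto
  obtain s where s: "s ?b = C ?b" "lift {?b - \<delta>..?b + \<delta>} s"
    using ext[of "C ?b" ?b] liftD(2,3)[OF C(2), of ?b] ab by auto
  obtain s' where s': "s' ?a = C ?a" "lift {?a - \<delta>..?a + \<delta>} s'"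
    using ext[of "C ?a" ?a] liftD(2,3)[OF C(2), of ?a] ab by auto
  define D where "D \<theta> = (if \<theta> \<le> ?b then C \<theta> else s \<theta>)" for \<theta>
  have D: "lift {?a..?b + \<delta>} D"
    unfolding D_def[abs_def] by (rule lift_glue) (use C s ab \<delta> in \<open>auto intro: lift_subset\<close>)
  have Da: "D ?a = C ?a" using ab by (simp add: D_def)
  define E where "E \<theta> = (if \<theta> \<le> ?a then s' \<theta> else D \<theta>)" for \<theta>
  have "lift {?a - \<delta>..?b + \<delta>} E"
    unfolding E_def[abs_def]
    by (rule lift_glue) (use D Da s' ab \<delta> in \<open>auto intro: lift_subset\<close>)
  moreover have "E \<theta>0 = p" using C(1) s'(1) ab by (auto simp: E_def D_def)
  moreover have "?a - \<delta> = \<theta>0 - real (Suc n) * \<delta>" "?b + \<delta> = \<theta>0 + real (Suc n) * \<delta>"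
    by (simp_all add: algebra_simps)
  ultimately show ?case by (intro exI[of _ E]) simp
qed

lemma ex_lift:
  assumes "compact S" "S \<noteq> {}"
  obtains C where "lift UNIV C"
proof -
  obtain \<delta> where \<delta>: "\<delta> > 0"
    and ext: "\<And>p \<theta>. p \<in> S \<Longrightarrow> \<xi> p = \<Xi> \<theta> \<Longrightarrow> \<exists>s. s \<theta> = p \<and> lift {\<theta> - \<delta>..\<theta> + \<delta>} s"
    by (rule uniform_sections[OF assms(1)]) blast
  obtain p \<theta>0 where p: "p \<in> S" "\<xi> p = \<Xi> \<theta>0" using assms(2) ex_angle by blast
  define J where "J n = {\<theta>0 - real n * \<delta>..\<theta>0 + real n * \<delta>}" for n
  obtain C where C0: "\<And>n. C n \<theta>0 = p" and C: "\<And>n. lift (J n) (C n)"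
    using lift_bounded_interval[OF p \<delta> ext] unfolding J_def by metis
  have J0: "\<theta>0 \<in> J n" for n using \<delta> by (simp add: J_def)
  have mono: "J m \<subseteq> J n" if "m \<le> n" for m n
    using mult_right_mono[of "real m" "real n" \<delta>] that \<delta> by (auto simp: J_def)
  have agree: "C m \<theta> = C n \<theta>" if "\<theta> \<in> J m" "m \<le> n" for m n \<theta>
    by (rule lift_unique[OF C lift_subset[OF C mono[OF that(2)]], where a = \<theta>0])
      (use C0 J0 that in \<open>auto simp: J_def\<close>)
  have agree': "C m \<theta> = C n \<theta>" if "\<theta> \<in> J m" "\<theta> \<in> J n" for m n \<theta>
  proof (cases "m \<le> n")
    case True
    then show ?thesis by (rule agree[OF that(1)])
  next
    case False
    then show ?thesis by (intro agree[OF that(2), symmetric]) simp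
  qed
  have ex_n: "\<exists>n. \<bar>\<theta> - \<theta>0\<bar> < real n * \<delta>" for \<theta>
    using reals_Archimedean3[OF \<delta>] by blast
  have inJ: "\<theta> \<in> J n" if "\<bar>\<theta> - \<theta>0\<bar> < real n * \<delta>" for \<theta> n
    using that by (auto simp: J_def abs_less_iff)
  \<comment> \<open>Any admissible n gives the same value by \<open>agree'\<close>. The strict
    inequality puts \<theta> in the interior of \<open>J n\<close>, where a single
    \<open>C n\<close> shows continuity.\<close>
  define N where "N \<theta> = (SOME n. \<bar>\<theta> - \<theta>0\<bar> < real n * \<delta>)" for \<theta>
  have N: "\<theta> \<in> J (N \<theta>)" for \<theta>
    using someI_ex[OF ex_n[of \<theta>]] inJ unfolding N_def by blast
  define E where "E \<theta> = C (N \<theta>) \<theta>" for \<theta>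
  have E: "E \<theta> = C n \<theta>" if "\<theta> \<in> J n" for \<theta> n
    unfolding E_def using agree'[OF N that] .
  have "isCont E \<theta>" for \<theta>
  proof -
    obtain n where n: "\<bar>\<theta> - \<theta>0\<bar> < real n * \<delta>" using ex_n by blast
    let ?I = "{\<theta>0 - real n * \<delta><..<\<theta>0 + real n * \<delta>}"
    have "?I \<subseteq> J n" by (auto simp: J_def)
    then have "continuous_on ?I (C n)" by (rule continuous_on_subset[OF liftD(1)[OF C]])
    then have "continuous_on ?I E"
      by (rule continuous_on_eq) (rule E[symmetric], use \<open>?I \<subseteq> J n\<close> in blast)
    then show ?thesis using n by (simp add: continuous_on_eq_continuous_at abs_less_iff)
  qed
  then have "lift UNIV E"
    unfolding lift_def E_def using liftD[OF C] N
    by (auto intro!: continuous_at_imp_continuous_on simp: E_def[abs_def])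
  then show thesis by (rule that)
qed

section \<open>The period of the lift and the velocity of its image\<close>

lemma lift_shift:
  assumes "lift UNIV C"
  shows "lift UNIV (\<lambda>\<theta>. C (\<theta> + 2 * pi * real n))"
proof -
  have "continuous_on UNIV (\<lambda>\<theta>. C (\<theta> + 2 * pi * real n))"
    by (rule continuous_on_compose2[OF liftD(1)[OF assms]]) (auto intro!: continuous_intros)
  then show ?thesis
    using liftD(2,3)[OF assms] by (simp add: lift_def Xi_period)
qed

lemma lift_periodic:
  assumes C: "lift UNIV C" and eq: "C (a + 2 * pi * real i) = C (a + 2 * pi * real j)" and "i \<le> j"
  shows "C (\<theta> + 2 * pi * real (j - i)) = C \<theta>"
proof -
  have "C ((\<theta> - 2 * pi * real i) + 2 * pi * real i) = C ((\<theta> - 2 * pi * real i) + 2 * pi * real j)"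
    by (rule lift_unique[OF lift_shift[OF C] lift_shift[OF C], where a = a]) (use eq in auto)
  then show ?thesis using \<open>i \<le> j\<close> by (simp add: of_nat_diff algebra_simps)
qed

text \<open>The points C(2 pi j) all have angle 0. Infinitely many of them would accumulate at a
  singular point, but a section shows that its neighbourhood N contains at most one singular point
  of a given direction. So two of them coincide, and uniqueness of lifts makes C periodic.\<close>

lemma lift_ex_period:
  assumes C: "lift UNIV C" and "compact S"
  obtains k :: nat where "k > 0" "\<And>\<theta>. C (\<theta> + 2 * pi * real k) = C \<theta>"
proof -
  let ?f = "\<lambda>j::nat. C (0 + 2 * pi * real j)"
  have "\<not> inj ?f"
  proof
    assume "inj ?f"
    then have "infinite (range ?f)" by (rule range_inj_infinite)
    moreover have "range ?f \<subseteq> S" using liftD(2)[OF C] by auto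
    ultimately obtain x where x: "x \<in> S" "x islimpt range ?f"
      using Heine_Borel_imp_Bolzano_Weierstrass[OF assms(2)] by blast
    obtain \<theta>0 where "\<xi> x = \<Xi> \<theta>0" using ex_angle by blast
    from ex_section[OF x(1) this] obtain c N \<delta> s where s: "section_at \<theta>0 c N \<delta> s" "s \<theta>0 = x" .
    note sec = section_atD[OF s(1)]
    have uniq: "q1 = q2" if q: "q1 \<in> N" "q1 \<in> range ?f" "q2 \<in> N" "q2 \<in> range ?f" for q1 q2
    proof -
      have xi: "\<xi> q1 = \<Xi> 0" "\<xi> q2 = \<Xi> 0"
        using q(2,4) liftD(3)[OF C] Xi_period[of 0] by auto
      obtain t1 where t1: "\<bar>t1 - \<theta>0\<bar> < \<delta> / 2" "q1 = s t1"
        using sec(10)[OF q(1)] q(2) liftD(2)[OF C] by blast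
      obtain t2 where t2: "\<bar>t2 - \<theta>0\<bar> < \<delta> / 2" "q2 = s t2"
        using sec(10)[OF q(3)] q(4) liftD(2)[OF C] by blast
      have "\<Xi> t1 = \<Xi> t2" using xi t1 t2 sec(7)[of t1] sec(7)[of t2] sec(4) by simp
      then have "t1 = t2"
        by (rule Xi_inj) (use t1(1) t2(1) sec(5) pi_gt3 in linarith)
      with t1 t2 show ?thesis by simp
    qed
    have "x \<in> N" using sec(3) s(2) by simp
    then obtain q1 where q1: "q1 \<in> range ?f" "q1 \<in> N" "q1 \<noteq> x"
      using islimptE[OF x(2) _ sec(2)] by metis
    have "open (N - {q1})" using sec(2) by (intro open_Diff) auto
    moreover have "x \<in> N - {q1}" using q1(3) \<open>x \<in> N\<close> by simp
    ultimately obtain q2 where "q2 \<in> range ?f" "q2 \<in> N - {q1}"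
      using islimptE[OF x(2)] by metis
    with uniq[OF q1(2,1), of q2] show False by simp
  qed
  then obtain i j where "?f i = ?f j" "i < j"
    unfolding inj_def by (metis linorder_neqE_nat)
  then show thesis using lift_periodic[OF C, of 0 i j] by (intro that[of "j - i"]) auto
qed

text \<open>C is locally a section, which is differentiable in a chart, and at a singular point
  every value of dF is a multiple of \<xi>.\<close>

lemma lift_has_vector_derivative:
  assumes C: "lift UNIV C"
  shows "\<exists>m. ((F \<circ> C) has_vector_derivative m *\<^sub>R \<Xi> \<theta>) (at \<theta>)"
proof -
  obtain c N \<delta> s where s: "section_at \<theta> c N \<delta> s" "s \<theta> = C \<theta>"
    by (rule ex_section[OF liftD(2,3)[OF C UNIV_I]])
  note sec = section_atD[OF s(1)]
  obtain T where T: "open T" "\<theta> \<in> T" "\<And>t. t \<in> T \<Longrightarrow> C t = s t"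
    using lift_eq_section[OF C UNIV_I s] by auto
  have ev: "\<forall>\<^sub>F t in nhds \<theta>. C t \<in> dom_of c"
    unfolding eventually_nhds
  proof (intro exI conjI ballI)
    show "open (T \<inter> {t. \<bar>t - \<theta>\<bar> < \<delta>})" by (intro open_Int T(1) open_Collect_less continuous_intros)
  qed (use T sec(4,8) in auto)
  have Cd: "C \<theta> \<in> dom_of c" using eventually_nhds_x_imp_x[OF ev] .
  obtain D where D: "((\<lambda>t. coord c (s t)) has_derivative D) (at \<theta>)"
    using sec(9)[of \<theta>] sec(4) unfolding differentiable_def by auto
  then have "((coord c \<circ> C) has_derivative D) (at \<theta>)"
    by (rule has_derivative_transform_within_open[OF _ T(1,2)]) (use T(3) in auto)
  moreover have "D = (\<lambda>h. h *\<^sub>R D 1)"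
  proof
    fix h show "D h = h *\<^sub>R D 1"
      using linear_scale[OF has_derivative_linear[OF D], of h 1] by simp
  qed
  ultimately have "((coord c \<circ> C) has_vector_derivative D 1) (at \<theta>)"
    unfolding has_vector_derivative_def by metis
  from has_vector_derivative_along[where \<gamma> = C, OF C2_F sec(1) Cd ev this]
  have "((F \<circ> C) has_vector_derivative differential c F (C \<theta>) (D 1)) (at \<theta>)" .
  moreover have "differential c F (C \<theta>) (D 1) = differential c F (C \<theta>) (D 1) $ 1 *\<^sub>R \<Xi> \<theta>"
    using liftD(2,3)[OF C UNIV_I, of \<theta>] singular_iff[OF sec(1) Cd] by auto
  ultimately show ?thesis by metis
qed

text \<open>Outside K the point P has one preimage only, so both integral curves pass through it and
  are the same curve; it carries one singular point.\<close>

lemma singular_points_on_meeting_lines: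
  assumes p: "p \<in> S" and q: "q \<in> S" and inj: "inj_on F (F -` (- K))" and P: "P \<notin> K"
    and Pa: "P = F (p) + u *\<^sub>R \<xi> (p)" and Pb: "P = F (q) + v *\<^sub>R \<xi> (q)"
  shows "p = q"
proof -
  obtain \<gamma> s where \<gamma>: "integral_curve A X UNIV \<gamma>" "p = \<gamma> s" using curve[of "p"] by blast
  obtain \<gamma>' t where \<gamma>': "integral_curve A X UNIV \<gamma>'" "q = \<gamma>' t" using curve[of "q"] by blast
  have "F (\<gamma> (s + u)) = P" "F (\<gamma>' (t + v)) = P"
    using F_line[OF \<gamma>(1), of "s + u" s] F_line[OF \<gamma>'(1), of "t + v" t] Pa Pb \<gamma>(2) \<gamma>'(2) by simp_all
  then have "\<gamma> (s + u) = \<gamma>' (t + v)" using inj P by (auto dest: inj_onD)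
  from integral_curve_unique[OF \<gamma>(1) \<gamma>'(1) this, of "- v"]
  have eq: "\<gamma> (s + u - v) = q" using \<gamma>'(2) by simp
  then have "s = s + u - v"
    using singular_unique_on_curve[OF \<gamma>(1), of s "s + u - v"] p q \<gamma>(2) by simp
  with eq \<gamma>(2) show ?thesis by simp
qed

lemma lift_simple_period:
  assumes C: "lift UNIV C" and S: "compact S" and K: "compact K" "inj_on F (F -` (- K))"
  shows "C (\<theta> + 2 * pi) = C \<theta>"
proof -
  obtain m where m: "\<And>\<theta>. ((F \<circ> C) has_vector_derivative m \<theta> *\<^sub>R \<Xi> \<theta>) (at \<theta>)"
    using lift_has_vector_derivative[OF C] by metis
  have d: "((\<lambda>t. F (C t) $ i) has_real_derivative m \<theta> * \<Xi> \<theta> $ i) (at \<theta>)" for i \<theta>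
    using bounded_linear.has_vector_derivative[OF bounded_linear_vec_nth m, of i \<theta>]
    by (simp add: o_def has_real_derivative_iff_has_vector_derivative)
  \<comment> \<open>\<open>H\<close> is minus the Lorentz product of \<open>F (C \<theta>)\<close> and \<open>\<Xi> \<theta>\<close>. A point \<open>P\<close> lies on the line through
    \<open>F (C \<theta>)\<close> iff \<open>P - F (C \<theta>)\<close> is Lorentz orthogonal to \<open>\<Xi> \<theta>\<close> and to its derivative, which for
    the \<open>P\<close> below are conditions on \<open>H \<theta>\<close> and \<open>H' \<theta>\<close>.\<close>
  define H where "H \<theta> = F (C \<theta>) $ 1 - F (C \<theta>) $ 2 * cos \<theta> - F (C \<theta>) $ 3 * sin \<theta>" for \<theta>
  define H' where "H' \<theta> = F (C \<theta>) $ 2 * sin \<theta> - F (C \<theta>) $ 3 * cos \<theta>" for \<theta>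
  \<comment> \<open>The terms with \<open>m\<close> cancel because \<Xi> is light-like. So
    \<open>H'\<close> contains no derivative of F \<circ> C and is bounded by the size of F on the
    compact singular set.\<close>
  have H: "(H has_real_derivative H' \<theta>) (at \<theta>)" for \<theta>
  proof -
    have "m \<theta> - m \<theta> * cos \<theta> * cos \<theta> - m \<theta> * sin \<theta> * sin \<theta> = 0"
      using sin_cos_squared_add3[of \<theta>] by algebra
    then have "m \<theta> * \<Xi> \<theta> $ 1 - (m \<theta> * \<Xi> \<theta> $ 2 * cos \<theta> + (- sin \<theta>) * F (C \<theta>) $ 2) -
        (m \<theta> * \<Xi> \<theta> $ 3 * sin \<theta> + cos \<theta> * F (C \<theta>) $ 3) = H' \<theta>"
      unfolding H'_def \<Xi>_def vector_3 by algebra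
    moreover have "(H has_real_derivative m \<theta> * \<Xi> \<theta> $ 1 - (m \<theta> * \<Xi> \<theta> $ 2 * cos \<theta> + (- sin \<theta>) * F (C \<theta>) $ 2) -
        (m \<theta> * \<Xi> \<theta> $ 3 * sin \<theta> + cos \<theta> * F (C \<theta>) $ 3)) (at \<theta>)"
      unfolding H_def[abs_def] by (intro DERIV_diff DERIV_mult d DERIV_cos DERIV_sin)
    ultimately show ?thesis by simp
  qed
  obtain k :: nat where k: "k > 0" "\<And>\<theta>. C (\<theta> + 2 * pi * real k) = C \<theta>"
    by (rule lift_ex_period[OF C S]) blast
  have "\<Xi> (\<theta> + 2 * pi * real k) = \<Xi> \<theta>" for \<theta> by (rule Xi_period)
  then have trig: "cos (\<theta> + 2 * pi * real k) = cos \<theta>" "sin (\<theta> + 2 * pi * real k) = sin \<theta>" for \<theta>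
    by (simp_all add: \<Xi>_def vec_eq_iff forall_3)
  have per: "H (\<theta> + 2 * pi * real k) = H \<theta>" for \<theta>
    by (simp add: H_def k(2) trig)
  have "compact (F ` S)"
    using S C2_map_continuous[OF C2_F] by (intro compact_continuous_image) (auto intro: continuous_on_subset)
  then obtain B where B: "\<And>x. x \<in> F ` S \<Longrightarrow> norm x \<le> B" using compact_imp_bounded bounded_iff by metis
  obtain R where R: "\<And>x. x \<in> K \<Longrightarrow> norm x \<le> R" using K(1) compact_imp_bounded bounded_iff by metis
  \<comment> \<open>The part with B exceeds \<open>H'\<close>, as the window maxima require; the
    part with R puts P outside K. The absolute value of R covers an empty K, where R may be
    negative.\<close>
  define \<rho> where "\<rho> = 2 * \<bar>B\<bar> + \<bar>R\<bar> + 1"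
  have "\<bar>H' \<theta>\<bar> < \<rho>" for \<theta>
  proof -
    have n: "norm (F (C \<theta>)) \<le> B" using B liftD(2)[OF C] by simp
    have "\<bar>F (C \<theta>) $ 2 * sin \<theta>\<bar> \<le> \<bar>F (C \<theta>) $ 2\<bar>" "\<bar>F (C \<theta>) $ 3 * cos \<theta>\<bar> \<le> \<bar>F (C \<theta>) $ 3\<bar>"
      by (simp_all add: abs_mult mult_left_le)
    moreover have "\<bar>F (C \<theta>) $ 2\<bar> \<le> B" "\<bar>F (C \<theta>) $ 3\<bar> \<le> B"
      using component_le_norm_cart[of "F (C \<theta>)"] n by (meson order_trans)+
    ultimately show ?thesis unfolding H'_def \<rho>_def by linarith
  qed
  from common_value_of_window_maxima[OF H this per k(1)]
  obtain \<phi> a b where ab: "\<bar>a - \<phi>\<bar> < pi / 2" "\<bar>b - \<phi> - 2 * pi\<bar> < pi / 2"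
    and H'ab: "H' a = \<rho> * sin (a - \<phi>)" "H' b = \<rho> * sin (b - \<phi>)"
    and Hab: "\<rho> * cos (a - \<phi>) + H a = \<rho> * cos (b - \<phi>) + H b" by metis
  define P where "P = (vector [\<rho> * cos (a - \<phi>) + H a, \<rho> * cos \<phi>, \<rho> * sin \<phi>] :: real^3)"
  have "norm P > R"
  proof -
    have "\<rho>\<^sup>2 = (P $ 2)\<^sup>2 + (P $ 3)\<^sup>2" by (simp add: P_def power_mult_distrib flip: distrib_left)
    also have "\<dots> \<le> (norm P)\<^sup>2" by (simp add: norm_vec_def L2_set_def sum_3)
    finally have "\<rho> \<le> norm P" by (rule power2_le_imp_le) simp
    then show ?thesis by (simp add: \<rho>_def)
  qed
  then have PK: "P \<notin> K" using R by force
  have on_line: "P = F (C x) + (\<rho> * cos (x - \<phi>) + H x - F (C x) $ 1) *\<^sub>R \<xi> (C x)"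
    if H'x: "H' x = \<rho> * sin (x - \<phi>)" and Hx: "\<rho> * cos (x - \<phi>) + H x = \<rho> * cos (a - \<phi>) + H a" for x
  proof -
    have xi: "\<xi> (C x) = \<Xi> x" using liftD(3)[OF C] by simp
    define f2 f3 where "f2 = F (C x) $ 2" and "f3 = F (C x) $ 3"
    have t: "\<rho> * cos (x - \<phi>) + H x - F (C x) $ 1 = \<rho> * cos (x - \<phi>) - f2 * cos x - f3 * sin x"
      by (simp add: H_def f2_def f3_def)
    have s: "f2 * sin x - f3 * cos x = \<rho> * sin (x - \<phi>)" using H'x by (simp add: H'_def f2_def f3_def)
    have one: "(cos x)\<^sup>2 + (sin x)\<^sup>2 = 1" by simp
    \<comment> \<open>Writing \<phi> as x - (x - \<phi>) leaves only trigonometric functions of x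
      and of x - \<phi>, in which the line equation is polynomial.\<close>
    have "cos \<phi> = cos (x - (x - \<phi>))" "sin \<phi> = sin (x - (x - \<phi>))" by simp_all
    then have "cos \<phi> = cos x * cos (x - \<phi>) + sin x * sin (x - \<phi>)" "sin \<phi> = sin x * cos (x - \<phi>) - cos x * sin (x - \<phi>)"
      unfolding cos_diff[of x "x - \<phi>"] sin_diff[of x "x - \<phi>"] by simp_all
    then have "\<rho> * cos \<phi> = f2 + (\<rho> * cos (x - \<phi>) - f2 * cos x - f3 * sin x) * cos x"
      "\<rho> * sin \<phi> = f3 + (\<rho> * cos (x - \<phi>) - f2 * cos x - f3 * sin x) * sin x"
      using s one by algebra+
    moreover have "P $ 1 = F (C x) $ 1 + (\<rho> * cos (x - \<phi>) - f2 * cos x - f3 * sin x)"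
      using Hx t by (simp add: P_def)
    ultimately show ?thesis
      unfolding xi t by (simp add: vec_eq_iff forall_3 \<Xi>_def P_def f2_def f3_def)
  qed
  have Cab: "C a = C b"
    by (rule singular_points_on_meeting_lines[where p = "C a" and q = "C b", OF _ _ K(2) PK on_line on_line])
      (use liftD(2)[OF C] H'ab Hab in auto)
  \<comment> \<open>Equal directions give b = a modulo 2 pi, and the two windows place b within pi
    of a + 2 pi. So C repeats after one turn.\<close>
  then have "\<Xi> b = \<Xi> a" using liftD(3)[OF C, of a] liftD(3)[OF C, of b] by simp
  then have "\<Xi> b = \<Xi> (a + 2 * pi)" using Xi_period[of a 1] by simp
  then have "b = a + 2 * pi" by (rule Xi_inj) (use ab pi_gt_zero in linarith)
  then show ?thesis using lift_periodic[OF C, of a 0 1 \<theta>] Cab by simp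
qed

end

section \<open>Cuspidal edges\<close>

lemma diffeomorphism_derivative:
  assumes "diffeomorphism g V W" "x \<in> V"
  obtains D where "(g has_derivative D) (at x)" "inj D"
proof -
  let ?h = "inv_into V g"
  have V: "open V" "bij_betw g V W" and sm: "C2_on g V" "C2_on ?h W"
    using assms(1) by (auto simp: diffeomorphism_def intro: smooth_on_imp_C2_on)
  have "g x \<in> W" using V(2) assms(2) by (auto simp: bij_betw_def)
  obtain D where D: "(g has_derivative D) (at x)"
    using C2_on_imp_differentiable[OF sm(1) assms(2)] unfolding differentiable_def by blast
  obtain E where E: "(?h has_derivative E) (at (g x))"
    using C2_on_imp_differentiable[OF sm(2) \<open>g x \<in> W\<close>] unfolding differentiable_def by blast
  have "(?h \<circ> g has_derivative E \<circ> D) (at x)" by (rule diff_chain_at[OF D E])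
  then have "((\<lambda>z. z) has_derivative E \<circ> D) (at x)"
    by (rule has_derivative_transform_within_open[OF _ V(1) assms(2)])
      (use V(2) in \<open>auto simp: bij_betw_def\<close>)
  then have "E \<circ> D = (\<lambda>z. z)" using has_derivative_unique has_derivative_ident by blast
  then have "inj D" by (metis inj_on_id2 inj_on_imageI2)
  with D show thesis by (rule that)
qed

lemma standard_cuspidal_edge_has_derivative:
  "(standard_cuspidal_edge has_derivative (\<lambda>v. vector [2 * x $ 1 * v $ 1, 3 * (x $ 1)\<^sup>2 * v $ 1, v $ 2])) (at x)"
proof -
  have eq: "(vector [a, b, c] :: real^3) = a *\<^sub>R axis 1 1 + b *\<^sub>R axis 2 1 + c *\<^sub>R axis 3 1" for a b c
    by (simp add: vec_eq_iff forall_3 axis_def)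
  have "((\<lambda>x::real^2. x $ i) has_derivative (\<lambda>v. v $ i)) (at x)" for i
    by (rule bounded_linear_imp_has_derivative[OF bounded_linear_vec_nth])
  then show ?thesis
    unfolding standard_cuspidal_edge_def[abs_def] eq
    by (auto intro!: derivative_eq_intros simp: power2_eq_square algebra_simps)
qed

context null_front begin

text \<open>The singular axis \<kappa> of a cuspidal edge runs in the singular set, so near p it is
  a reparametrized section, and the velocity of its image is a multiple of that of F \<circ> C at
  \<theta>0. In the standard form this velocity is (0, 0, 1), which is not zero.\<close>

lemma not_cuspidal_edge:
  assumes C: "lift UNIV C" and crit: "((F \<circ> C) has_vector_derivative 0) (at \<theta>0)"
  shows "\<not> cuspidal_edge A F (C \<theta>0)"
proof
  define p where "p = C \<theta>0"
  assume "cuspidal_edge A F (C \<theta>0)"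
  then obtain c \<psi> V U \<Phi> W W' where c: "c \<in> A" "p \<in> dom_of c"
    and \<psi>: "diffeomorphism \<psi> V U" "0 \<in> V" "\<psi> 0 = coord c p" and U: "U \<subseteq> cod_of c"
    and \<Phi>: "diffeomorphism \<Phi> W W'"
    and std: "\<And>x. x \<in> V \<Longrightarrow> F (param c (\<psi> x)) \<in> W"
      "\<And>x. x \<in> V \<Longrightarrow> \<Phi> (F (param c (\<psi> x))) = standard_cuspidal_edge x"
    unfolding cuspidal_edge_def p_def by blast
  have V: "open V" using \<psi>(1) by (simp add: diffeomorphism_def)
  define q where "q x = param c (\<psi> x)" for x
  have q: "q x \<in> dom_of c" "coord c (q x) = \<psi> x" if "x \<in> V" for x
  proof -
    have "\<psi> x \<in> cod_of c" using \<psi>(1) U that by (auto simp: diffeomorphism_def bij_betw_def)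
    then show "q x \<in> dom_of c" "coord c (q x) = \<psi> x" using chart(6,7)[OF c(1)] by (simp_all add: q_def)
  qed
  have chain: "\<exists>D\<psi> D\<Phi>. (\<psi> has_derivative D\<psi>) (at x) \<and> inj D\<psi> \<and> linear D\<psi> \<and> linear D\<Phi> \<and> inj D\<Phi> \<and>
      (\<forall>v::real^2. D\<Phi> (differential c F (q x) (D\<psi> v)) = (vector [2 * x $ 1 * v $ 1, 3 * (x $ 1)\<^sup>2 * v $ 1, v $ 2] :: real^3))"
    if x: "x \<in> V" for x
  proof -
    obtain D\<psi> where D\<psi>: "(\<psi> has_derivative D\<psi>) (at x)" "inj D\<psi>"
      by (rule diffeomorphism_derivative[OF \<psi>(1) x])
    obtain D\<Phi> where D\<Phi>: "(\<Phi> has_derivative D\<Phi>) (at (F (q x)))" "inj D\<Phi>"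
      by (rule diffeomorphism_derivative[OF \<Phi>]) (use std(1)[OF x] in \<open>auto simp: q_def\<close>)
    have "((F \<circ> param c) has_derivative differential c F (q x)) (at (\<psi> x))"
      using C2_map_has_differential[OF C2_F c(1) q(1)[OF x]] q(2)[OF x] by simp
    from diff_chain_at[OF D\<psi>(1) this]
    have 1: "((F \<circ> param c) \<circ> \<psi> has_derivative differential c F (q x) \<circ> D\<psi>) (at x)" .
    have "(\<Phi> has_derivative D\<Phi>) (at (((F \<circ> param c) \<circ> \<psi>) x))" using D\<Phi>(1) by (simp add: q_def)
    from diff_chain_at[OF 1 this]
    have "(\<Phi> \<circ> ((F \<circ> param c) \<circ> \<psi>) has_derivative D\<Phi> \<circ> (differential c F (q x) \<circ> D\<psi>)) (at x)" .
    then have "(standard_cuspidal_edge has_derivative D\<Phi> \<circ> (differential c F (q x) \<circ> D\<psi>)) (at x)"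
      by (rule has_derivative_transform_within_open[OF _ V x]) (simp add: std(2))
    from has_derivative_unique[OF this standard_cuspidal_edge_has_derivative]
    have "D\<Phi> (differential c F (q x) (D\<psi> v)) = (vector [2 * x $ 1 * v $ 1, 3 * (x $ 1)\<^sup>2 * v $ 1, v $ 2] :: real^3)" for v
      by (metis comp_apply)
    with D\<psi> D\<Phi> has_derivative_linear[OF D\<psi>(1)] has_derivative_linear[OF D\<Phi>(1)]
    show ?thesis by (intro exI[of _ D\<psi>] exI[of _ D\<Phi>] conjI allI)
  qed
  \<comment> \<open>On the axis the standard form annihilates the first basis vector, and the
    injective derivative of \<Phi> carries this back to dF.\<close>
  have sing: "q x \<in> S" if x: "x \<in> V" "x $ 1 = 0" for x
  proof -
    obtain D\<psi> D\<Phi> where D: "inj D\<psi>" "linear D\<psi>" "linear D\<Phi>" "inj D\<Phi>"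
      "\<And>v::real^2. D\<Phi> (differential c F (q x) (D\<psi> v)) = (vector [2 * x $ 1 * v $ 1, 3 * (x $ 1)\<^sup>2 * v $ 1, v $ 2] :: real^3)"
      using chain[OF x(1)] by blast
    let ?e = "axis 1 1 :: real^2"
    have "D\<Phi> (differential c F (q x) (D\<psi> ?e)) = 0"
      unfolding D(5) using x(2) by (simp add: vec_eq_iff forall_3 axis_def)
    then have "differential c F (q x) (D\<psi> ?e) = 0" using D(3,4) by (simp add: linear_injective_0)
    moreover have "D\<psi> ?e \<noteq> 0" using D(1) linear_injective_0[OF D(2)] by (auto simp: axis_eq_0_iff)
    ultimately have "\<not> inj (differential c F (q x))"
      using linear_injective_0[OF differential_linear[OF C2_F c(1) q(1)[OF x(1)]]] by blast
    then show ?thesis using c(1) q(1)[OF x(1)] unfolding singular_set_def immersion_at_def by blast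
  qed
  \<comment> \<open>The singular axis of the standard cuspidal edge, whose image has non-zero velocity.\<close>
  define \<kappa> where "\<kappa> v = q (v *\<^sub>R axis 2 1)" for v :: real
  have \<kappa>0: "\<kappa> 0 = p" using \<psi>(3) chart(5)[OF c] by (simp add: \<kappa>_def q_def)
  define I where "I = (\<lambda>v::real. v *\<^sub>R (axis 2 1 :: real^2)) -` V"
  have I: "open I" "0 \<in> I"
    unfolding I_def using \<psi>(2) by (auto intro!: open_vimage V continuous_intros)
  have \<kappa>I: "\<kappa> v \<in> S" "\<kappa> v \<in> dom_of c" "coord c (\<kappa> v) = \<psi> (v *\<^sub>R axis 2 1)" if "v \<in> I" for v
    using sing[of "v *\<^sub>R axis 2 1"] q[of "v *\<^sub>R axis 2 1"] that by (auto simp: \<kappa>_def I_def axis_def)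
  obtain D\<psi> D\<Phi> where D: "(\<psi> has_derivative D\<psi>) (at 0)" "linear D\<psi>" "linear D\<Phi>"
      "\<And>v::real^2. D\<Phi> (differential c F (q 0) (D\<psi> v)) = (vector [2 * (0::real^2) $ 1 * v $ 1, 3 * ((0::real^2) $ 1)\<^sup>2 * v $ 1, v $ 2] :: real^3)"
    using chain[OF \<psi>(2)] by blast
  have q0: "q 0 = p" using \<kappa>0 by (simp add: \<kappa>_def)
  define w where "w = D\<psi> (axis 2 1)"
  have ev: "\<forall>\<^sub>F v in nhds 0. \<kappa> v \<in> dom_of c"
    unfolding eventually_nhds using I \<kappa>I(2) by blast
  have "((\<lambda>v. \<psi> (v *\<^sub>R axis 2 1)) has_derivative (\<lambda>h. h *\<^sub>R w)) (at 0)"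
  proof -
    have 1: "((\<lambda>v. v *\<^sub>R axis 2 1 :: real^2) has_derivative (\<lambda>h. h *\<^sub>R axis 2 1)) (at 0)"
      by (auto intro!: derivative_eq_intros)
    have "(\<psi> has_derivative D\<psi>) (at ((\<lambda>v. v *\<^sub>R axis 2 1 :: real^2) 0))" using D(1) by simp
    from diff_chain_at[OF 1 this] show ?thesis by (simp add: o_def linear_scale[OF D(2)] w_def)
  qed
  then have "((coord c \<circ> \<kappa>) has_vector_derivative w) (at 0)"
    unfolding has_vector_derivative_def
    by (rule has_derivative_transform_within_open[OF _ I]) (simp add: \<kappa>I)
  note along = has_vector_derivative_along[where \<gamma> = \<kappa> and t = 0, OF _ c(1) _ ev this, unfolded \<kappa>0, OF _ c(2)]
  have F\<kappa>: "((F \<circ> \<kappa>) has_vector_derivative differential c F p w) (at 0)" by (rule along[OF C2_F])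
  have pS: "p \<in> S" and p\<theta>: "\<xi> p = \<Xi> \<theta>0" using liftD(2,3)[OF C] by (auto simp: p_def)
  obtain d N \<delta> s where s: "section_at \<theta>0 d N \<delta> s" "s \<theta>0 = p" by (rule ex_section[OF pS p\<theta>])
  note sec = section_atD[OF s(1)]
  obtain T where T: "open T" "\<theta>0 \<in> T" "\<And>t. t \<in> T \<Longrightarrow> C t = s t"
    using lift_eq_section[OF C UNIV_I s(1)] s(2) by (auto simp: p_def)
  have Fs: "((F \<circ> s) has_vector_derivative 0) (at \<theta>0)"
    by (rule has_vector_derivative_transform_within_open[OF crit T(1,2)]) (simp add: T(3))
  define e0 :: "real^3" where "e0 = vector [0, - sin \<theta>0, cos \<theta>0]"
  define a where "a v = \<xi> (\<kappa> v) \<bullet> e0" for v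
  have a: "(a has_real_derivative differential c \<xi> p w \<bullet> e0) (at 0)"
    using bounded_linear.has_vector_derivative[OF bounded_linear_inner_left along[OF C2_xi], of e0]
    by (simp add: a_def[abs_def] o_def has_real_derivative_iff_has_vector_derivative)
  have a_Xi: "\<Xi> \<theta> \<bullet> e0 = sin (\<theta> - \<theta>0)" for \<theta>
    by (simp add: \<Xi>_def e0_def inner_vec_def sum_3 sin_diff mult.commute)
  have a0: "a 0 = 0" using a_Xi[of \<theta>0] p\<theta> by (simp add: a_def \<kappa>0)
  have "isCont \<kappa> 0"
  proof -
    have "isCont (\<lambda>v. \<psi> (v *\<^sub>R axis 2 1)) 0"
      using \<open>((\<lambda>v. \<psi> (v *\<^sub>R axis 2 1)) has_derivative (\<lambda>h. h *\<^sub>R w)) (at 0)\<close> by (rule has_derivative_continuous)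
    moreover have "isCont (param c) (\<psi> (0 *\<^sub>R axis 2 1))"
      using chart(2,4)[OF c(1)] c(2) \<psi>(3) by (simp add: continuous_on_eq_continuous_at)
    ultimately show ?thesis
      unfolding \<kappa>_def[abs_def] q_def by (rule continuous_at_compose[unfolded o_def])
  qed
  then obtain J where J: "open J" "0 \<in> J" "\<And>v. v \<in> J \<Longrightarrow> \<kappa> v \<in> N"
    using isCont_neighbourhood[where \<gamma> = \<kappa> and t = 0 and N = N] sec(2,3) s(2) \<kappa>0 by auto
  \<comment> \<open>The component \<open>a\<close> of \<xi> is the sine of the angle measured from
    \<theta>0, so arcsine gives the section parameter as a differentiable function of v.\<close>
  have eq: "\<kappa> v = s (\<theta>0 + arcsin (a v))" if v: "v \<in> I \<inter> J" for v
  proof -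
    obtain t where t: "\<bar>t - \<theta>0\<bar> < \<delta> / 2" "\<kappa> v = s t"
      using sec(10)[OF J(3)] \<kappa>I(1) v by blast
    then have "a v = sin (t - \<theta>0)" using sec(7)[of t] sec(4) by (simp add: a_def a_Xi)
    moreover have "- (pi / 2) \<le> t - \<theta>0" "t - \<theta>0 \<le> pi / 2" using t(1) sec(5) pi_gt3 by linarith+
    ultimately have "arcsin (a v) = t - \<theta>0" by (simp add: arcsin_sin)
    with t(2) show ?thesis by simp
  qed
  have asn: "((\<lambda>v. \<theta>0 + arcsin (a v)) has_real_derivative differential c \<xi> p w \<bullet> e0) (at 0)"
  proof -
    have "(arcsin has_real_derivative inverse (sqrt (1 - (a 0)\<^sup>2))) (at (a 0))"
      by (rule DERIV_arcsin) (auto simp: a0)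
    from DERIV_add[OF DERIV_const DERIV_chain2[OF this a]] show ?thesis by (simp add: a0)
  qed
  \<comment> \<open>The chain rule works whatever the speed of the reparametrization is, zero
    included.\<close>
  have "((F \<circ> s) \<circ> (\<lambda>v. \<theta>0 + arcsin (a v)) has_vector_derivative (differential c \<xi> p w \<bullet> e0) *\<^sub>R 0) (at 0)"
    by (rule vector_diff_chain_at) (use asn Fs in \<open>auto simp: has_real_derivative_iff_has_vector_derivative a0\<close>)
  then have "((F \<circ> \<kappa>) has_vector_derivative 0) (at 0)"
    using has_vector_derivative_transform_within_open[of "(F \<circ> s) \<circ> (\<lambda>v. \<theta>0 + arcsin (a v))" 0 0 "I \<inter> J" "F \<circ> \<kappa>"]
      I J eq by auto
  with F\<kappa> have "differential c F p w = 0" by (metis vector_derivative_at)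
  then have "D\<Phi> 0 = (vector [0, 0, 1] :: real^3)"
    using D(4)[of "axis 2 1"] by (simp add: q0 w_def[symmetric])
  then have "(vector [0, 0, 1 :: real] :: real^3) = 0" using linear_0[OF D(3)] by simp
  from arg_cong[OF this, of "\<lambda>z. z $ 3"] show False by simp
qed

text \<open>The three coordinates of F \<circ> C are the periodic antiderivatives of m, m cos and m
  sin that \<open>four_critical_points\<close> asks for. Distinct zeros in one period give distinct
  points because \<xi> recovers the angle.\<close>

lemma four_non_cuspidal_edges:
  assumes S: "compact S" "S \<noteq> {}" and K: "compact K" "inj_on F (F -` (- K))"
  obtains Z where "Z \<subseteq> {p \<in> S. \<not> cuspidal_edge A F p}" "finite Z" "card Z = 4"
proof -
  obtain C where C: "lift UNIV C" by (rule ex_lift[OF S])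
  obtain m where m: "\<And>\<theta>. ((F \<circ> C) has_vector_derivative m \<theta> *\<^sub>R \<Xi> \<theta>) (at \<theta>)"
    using lift_has_vector_derivative[OF C] by metis
  have d: "((\<lambda>t. F (C t) $ i) has_real_derivative m \<theta> * \<Xi> \<theta> $ i) (at \<theta>)" for i \<theta>
    using bounded_linear.has_vector_derivative[OF bounded_linear_vec_nth m, of i \<theta>]
    by (simp add: o_def has_real_derivative_iff_has_vector_derivative)
  have per: "C (\<theta> + 2 * pi) = C \<theta>" for \<theta> by (rule lift_simple_period[OF C S(1) K])
  have 1: "((\<lambda>t. F (C t) $ 1) has_real_derivative m \<theta>) (at \<theta>)"
    and 2: "((\<lambda>t. F (C t) $ 2) has_real_derivative m \<theta> * cos \<theta>) (at \<theta>)"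
    and 3: "((\<lambda>t. F (C t) $ 3) has_real_derivative m \<theta> * sin \<theta>) (at \<theta>)" for \<theta>
    using d[of 1 \<theta>] d[of 2 \<theta>] d[of 3 \<theta>] by (simp_all add: \<Xi>_def)
  obtain Z where Z: "Z \<subseteq> {x. 0 \<le> x \<and> x < 2 * pi \<and> m x = 0}" "finite Z" "card Z = 4"
    by (rule four_critical_points[OF 1 2 3]) (auto simp: per)
  have "inj_on C Z"
  proof (rule inj_onI)
    fix x y assume xy: "x \<in> Z" "y \<in> Z" "C x = C y"
    then have "\<Xi> x = \<Xi> y" using liftD(3)[OF C, of x] liftD(3)[OF C, of y] by simp
    moreover have "0 \<le> x" "x < 2 * pi" "0 \<le> y" "y < 2 * pi" using Z(1) xy by auto
    ultimately show "x = y" by (intro Xi_inj) linarith+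
  qed
  moreover have "C x \<in> {p \<in> S. \<not> cuspidal_edge A F p}" if "x \<in> Z" for x
    using not_cuspidal_edge[OF C, of x] m[of x] liftD(2)[OF C, of x] Z(1) that by auto
  ultimately show thesis
    using that[of "C ` Z"] Z by (simp add: card_image image_subset_iff)
qed

end

theorem corollary4p6:
  fixes r :: regularity
    and A :: "'m::{t2_space, second_countable_topology} chart set"
    and F :: "'m \<Rightarrow> real^3"
    and \<alpha> :: "'m \<Rightarrow> covector"
  assumes "Cr_atlas r A"
    and "null_wave_front r A F \<alpha>"
    and "complete_front r A F \<alpha>"
    and "\<exists>K. compact K \<and> inj_on F (F -` (- K))"
  shows "\<exists>S. S \<subseteq> {p \<in> singular_set A F. \<not> cuspidal_edge A F p} \<and> finite S \<and> card S = 4"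
proof -
  obtain X where X: "E_normalized_null_field r A F \<alpha> X"
    and curves: "\<And>p. \<exists>\<gamma>. integral_curve A X UNIV \<gamma> \<and> p \<in> range \<gamma>"
    using assms(3) unfolding complete_front_def L_complete_def by metis
  interpret null_front r A F \<alpha> X
    by unfold_locales (use assms X curves in auto)
  show ?thesis
    using assms(3,4) four_non_cuspidal_edges unfolding complete_front_def by metis
qed

end
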